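(* Let $(X,d)$ be a compact metric space, $\mathbb{G}$ a compact quantum group acting isometrically on it via $\beta:C(X)\to C(X)\otimes C(\mathbb{G})$, and $\mu$ a faithful $\beta$-invariant probability measure on $X$. Let $U$ be the associated unitary representation of $\mathbb{G}$ on $L^2(X)=L^2(X,\mu)$ and let $C(O)\subseteq C(X\times X)$ be the orbital algebra of the action. For a function $f\in C(X\times X)$, the operator $\rho(f)$ on $L^2(X)$ given by $$(\rho(f)(g))(x)=\int_X f(x,y)g(y)\,\mathrm{d}\mu(y),\qquad g\in L^2(X),$$ is an intertwiner for $U$ if and only if $f$ belongs to the orbital algebra $C(O)$.
   Context: All $C^*$-algebras are unital and tensor products of $C^*$-algebras are minimal. A compact quantum group $\mathbb{G}$ is a unital $C^*$-algebra $C(\mathbb{G})$ with a unital $*$-homomorphism $\Delta:C(\mathbb{G})\to C(\mathbb{G})\otimes C(\mathbb{G})$ such that $(\Delta\otimes\mathrm{id})\Delta=(\mathrm{id}\otimes\Delta)\Delta$ and the linear spans of $\Delta(C(\mathbb{G}))(C(\mathbb{G})\otimes 1)$ and $\Delta(C(\mathbb{G}))(1\otimes C(\mathbb{G}))$ are dense in $C(\mathbb{G})\otimes C(\mathbb{G})$. An action of $\mathbb{G}$ on a compact space $X$ is a unital $*$-homomorphism $\beta:C(X)\to C(X)\otimes C(\mathbb{G})$ with $(\beta\otimes\mathrm{id})\beta=(\mathrm{id}\otimes\Delta)\beta$ and with the span of $\beta(C(X))(1\otimes C(\mathbb{G}))$ dense in $C(X)\otimes C(\mathbb{G})$. A faithful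 (i.e. full support) Borel probability measure $\mu$ is $\beta$-invariant if $(\mu\otimes\mathrm{id})\beta(f)=\mu(f)1$ for all $f\in C(X)$, where $\mu(f)=\int_X f\,\mathrm{d}\mu$. Write $L^2(X)=L^2(X,\mu)$ and $L^2(X\times X)=L^2(X\times X,\mu\boxtimes\mu)$. The associated unitary representation $U\in\mathcal{M}(\mathcal{K}(L^2(X))\otimes C(\mathbb{G}))$ ($\mathcal{K}$ = compact operators, $\mathcal{M}$ = multiplier algebra) is the unitary on the Hilbert $C(\mathbb{G})$-module $L^2(X)\otimes C(\mathbb{G})$ determined by $U(f\otimes a)=\beta(f)(1\otimes a)$, $f\in C(X)$, $a\in C(\mathbb{G})$. An operator $t\in\mathcal{B}(L^2(X))$ is an intertwiner for $U$ if $U(t\otimes1)=(t\otimes1)U$. On $L^2(X)\otimes L^2(X)\otimes C(\mathbb{G})$ let $U_{13},U_{23}$ be $U$ acting on the indicated legs, and put $W=U_{13}U_{23}$, $Z=U_{23}U_{13}$. The action is isometric if $$W(d\otimes 1)=d\otimes 1=Z(d\otimes1),$$ where $d\in C(X\times X)\subset L^2(X\times X)$. Let $\pi^{(2)}:C(X\times X)\to\mathcal{B}(L^2(X\times X))$ be the representation by multiplication operators. The orbital algebra $C(O)$ of the action is the subalgebra of $C(X\times X)$ consisting of the functions $f\in C(X\times X)$ satisfying $$W(\pi^{(2)}(f)\otimes 1)W^*=\pi^{(2)}(f)\otimes 1=Z(\pi^{(2)}(f)\otimes 1)Z^*.$$ *)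

theory Defs
  imports "HOL-Analysis.Analysis" "HOL-Probability.Probability_Measure"
begin

text \<open>
  Objects that are only determined up to canonical isomorphism (completed tensor products) are
  represented by arbitrary realizations: a type together with a map on elementary tensors that
  satisfies the defining properties.
\<close>

section \<open>Unital C*-algebras\<close>

text \<open>The zero algebra is excluded, since \<open>1 \<noteq> 0\<close> in \<^class>\<open>real_normed_algebra_1\<close>.\<close>

class cstar_algebra = real_normed_algebra_1 + banach +
  fixes scaleC :: "complex \<Rightarrow> 'a \<Rightarrow> 'a" (infixr \<open>*\<^sub>C\<close> 75)
    and star :: "'a \<Rightarrow> 'a"
  assumes scaleC_add_right: "c *\<^sub>C (x + y) = c *\<^sub>C x + c *\<^sub>C y"
    and scaleC_add_left: "(c + d) *\<^sub>C x = c *\<^sub>C x + d *\<^sub>C x"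
    and scaleC_scaleC: "c *\<^sub>C d *\<^sub>C x = (c * d) *\<^sub>C x"
    and scaleC_of_real: "complex_of_real r *\<^sub>C x = r *\<^sub>R x"
    and mult_scaleC_left: "(c *\<^sub>C x) * y = c *\<^sub>C (x * y)"
    and mult_scaleC_right: "x * (c *\<^sub>C y) = c *\<^sub>C (x * y)"
    and norm_scaleC: "norm (c *\<^sub>C x) = cmod c * norm x"
    and star_add: "star (x + y) = star x + star y"
    and star_scaleC: "star (c *\<^sub>C x) = cnj c *\<^sub>C star x"
    and star_mult: "star (x * y) = star y * star x"
    and star_star: "star (star x) = x"
    and norm_star_mult: "norm (star x * x) = (norm x)\<^sup>2"

instantiation complex :: cstar_algebra
begin

definition scaleC_complex :: "complex \<Rightarrow> complex \<Rightarrow> complex" where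
  "scaleC_complex c x = c * x"

definition star_complex :: "complex \<Rightarrow> complex" where
  "star_complex = cnj"

instance
  by standard
    (auto simp: scaleC_complex_def star_complex_def algebra_simps scaleR_conv_of_real norm_mult
      power2_eq_square)

end

lemma norm_star: "norm (star x) = norm (x::'a::cstar_algebra)"
proof -
  have *: "norm y \<le> norm (star y)" for y :: 'a
  proof (cases "y = 0")
    case False
    have "norm y * norm y \<le> norm (star y) * norm y"
      using norm_mult_ineq[of "star y" y] norm_star_mult[of y] by (simp add: power2_eq_square)
    with False show ?thesis by simp
  qed simp
  from *[of x] *[of "star x"] show ?thesis by (simp add: star_star)
qed

lemma bounded_linear_star: "bounded_linear (star :: 'a::cstar_algebra \<Rightarrow> 'a)"
proof (rule bounded_linear_intro[where K = 1])
  fix r and x :: 'a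
  have "star (r *\<^sub>R x) = star (complex_of_real r *\<^sub>C x)" by (simp add: scaleC_of_real)
  also have "\<dots> = r *\<^sub>R star x" unfolding star_scaleC by (simp add: scaleC_of_real)
  finally show "star (r *\<^sub>R x) = r *\<^sub>R star x" .
qed (simp_all add: star_add norm_star)

lemma bounded_linear_scaleC: "bounded_linear (\<lambda>x. c *\<^sub>C (x::'a::cstar_algebra))"
proof (rule bounded_linear_intro[where K = "cmod c"])
  fix r and x :: 'a
  show "c *\<^sub>C (r *\<^sub>R x) = r *\<^sub>R c *\<^sub>C x"
    by (simp add: scaleC_of_real[symmetric] scaleC_scaleC mult.commute)
qed (simp_all add: scaleC_add_right norm_scaleC mult.commute)

text \<open>For compact \<open>X\<close>, the type \<open>X \<Rightarrow>\<^sub>C complex\<close> of bounded continuous functions is \<open>C(X)\<close>.\<close>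

unbundle bcontfun.lifting

instantiation bcontfun :: (metric_space, cstar_algebra) cstar_algebra
begin

lift_definition times_bcontfun :: "('a \<Rightarrow>\<^sub>C 'b) \<Rightarrow> ('a \<Rightarrow>\<^sub>C 'b) \<Rightarrow> 'a \<Rightarrow>\<^sub>C 'b"
  is "\<lambda>f g x. f x * g x"
proof -
  fix f g :: "'a \<Rightarrow> 'b" assume f: "f \<in> bcontfun" and g: "g \<in> bcontfun"
  from f obtain B where B: "\<And>x. norm (f x) \<le> B"
    by (auto simp: bcontfun_def bounded_iff)
  from g obtain C where C: "\<And>x. norm (g x) \<le> C"
    by (auto simp: bcontfun_def bounded_iff)
  have "0 \<le> B" using B[of undefined] norm_ge_zero order_trans by blast
  then have "norm (f x * g x) \<le> B * C" for x
    using norm_mult_ineq[of "f x" "g x"] mult_mono[OF B C, of x x] by fastforce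
  then show "(\<lambda>x. f x * g x) \<in> bcontfun"
    using f g by (intro bcontfun_normI continuous_intros) (auto simp: bcontfun_def)
qed

lift_definition one_bcontfun :: "'a \<Rightarrow>\<^sub>C 'b" is "\<lambda>_. 1"
  by (rule const_bcontfun)

lift_definition scaleC_bcontfun :: "complex \<Rightarrow> ('a \<Rightarrow>\<^sub>C 'b) \<Rightarrow> 'a \<Rightarrow>\<^sub>C 'b"
  is "\<lambda>c f x. c *\<^sub>C f x"
proof -
  fix c and f :: "'a \<Rightarrow> 'b" assume f: "f \<in> bcontfun"
  from f obtain B where "\<And>x. norm (f x) \<le> B"
    by (auto simp: bcontfun_def bounded_iff)
  then show "(\<lambda>x. c *\<^sub>C f x) \<in> bcontfun"
    using f
    by (intro bcontfun_normI[where b = "cmod c * B"]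
          bounded_linear.continuous_on[OF bounded_linear_scaleC])
       (auto simp: bcontfun_def norm_scaleC intro!: mult_left_mono)
qed

lift_definition star_bcontfun :: "('a \<Rightarrow>\<^sub>C 'b) \<Rightarrow> 'a \<Rightarrow>\<^sub>C 'b"
  is "\<lambda>f x. star (f x)"
proof -
  fix f :: "'a \<Rightarrow> 'b" assume f: "f \<in> bcontfun"
  from f obtain B where "\<And>x. norm (f x) \<le> B"
    by (auto simp: bcontfun_def bounded_iff)
  then show "(\<lambda>x. star (f x)) \<in> bcontfun"
    using f
    by (intro bcontfun_normI[where b = B] bounded_linear.continuous_on[OF bounded_linear_star])
       (auto simp: bcontfun_def norm_star)
qed

instance
proof
  fix f g h :: "'a \<Rightarrow>\<^sub>C 'b" and c d :: complex and r :: real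
  show "f * g * h = f * (g * h)"
    by (rule bcontfun_eqI) (simp add: times_bcontfun.rep_eq mult.assoc)
  show "(f + g) * h = f * h + g * h"
    by (rule bcontfun_eqI) (simp add: times_bcontfun.rep_eq plus_bcontfun.rep_eq algebra_simps)
  show "f * (g + h) = f * g + f * h"
    by (rule bcontfun_eqI) (simp add: times_bcontfun.rep_eq plus_bcontfun.rep_eq algebra_simps)
  show "r *\<^sub>R f * g = r *\<^sub>R (f * g)"
    by (rule bcontfun_eqI) (simp add: times_bcontfun.rep_eq scaleR_bcontfun.rep_eq)
  show "f * r *\<^sub>R g = r *\<^sub>R (f * g)"
    by (rule bcontfun_eqI) (simp add: times_bcontfun.rep_eq scaleR_bcontfun.rep_eq)
  show "1 * f = f"
    by (rule bcontfun_eqI) (simp add: times_bcontfun.rep_eq one_bcontfun.rep_eq)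
  show "f * 1 = f"
    by (rule bcontfun_eqI) (simp add: times_bcontfun.rep_eq one_bcontfun.rep_eq)
  show "(0::'a \<Rightarrow>\<^sub>C 'b) \<noteq> 1"
  proof
    assume "(0::'a \<Rightarrow>\<^sub>C 'b) = 1"
    then have "apply_bcontfun (0::'a \<Rightarrow>\<^sub>C 'b) undefined = apply_bcontfun 1 undefined" by simp
    then show False by (simp add: one_bcontfun.rep_eq zero_bcontfun.rep_eq)
  qed
  show "norm (f * g) \<le> norm f * norm g"
  proof (rule norm_bound)
    fix x
    show "norm (apply_bcontfun (f * g) x) \<le> norm f * norm g"
      using norm_mult_ineq[of "apply_bcontfun f x" "apply_bcontfun g x"]
        mult_mono[OF norm_bounded[of f x] norm_bounded[of g x]]
      by (simp add: times_bcontfun.rep_eq)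
  qed
  show "norm (1::'a \<Rightarrow>\<^sub>C 'b) = 1"
  proof (rule antisym)
    show "norm (1::'a \<Rightarrow>\<^sub>C 'b) \<le> 1" by (rule norm_bound) (simp add: one_bcontfun.rep_eq)
    show "1 \<le> norm (1::'a \<Rightarrow>\<^sub>C 'b)"
      using norm_bounded[of "1::'a \<Rightarrow>\<^sub>C 'b" undefined] by (simp add: one_bcontfun.rep_eq)
  qed
  show "c *\<^sub>C (f + g) = c *\<^sub>C f + c *\<^sub>C g"
    by (rule bcontfun_eqI) (simp add: scaleC_bcontfun.rep_eq plus_bcontfun.rep_eq scaleC_add_right)
  show "(c + d) *\<^sub>C f = c *\<^sub>C f + d *\<^sub>C f"
    by (rule bcontfun_eqI) (simp add: scaleC_bcontfun.rep_eq plus_bcontfun.rep_eq scaleC_add_left)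
  show "c *\<^sub>C d *\<^sub>C f = (c * d) *\<^sub>C f"
    by (rule bcontfun_eqI) (simp add: scaleC_bcontfun.rep_eq scaleC_scaleC)
  show "complex_of_real r *\<^sub>C f = r *\<^sub>R f"
    by (rule bcontfun_eqI) (simp add: scaleC_bcontfun.rep_eq scaleR_bcontfun.rep_eq scaleC_of_real)
  show "(c *\<^sub>C f) * g = c *\<^sub>C (f * g)"
    by (rule bcontfun_eqI)
      (simp add: scaleC_bcontfun.rep_eq times_bcontfun.rep_eq mult_scaleC_left)
  show "f * (c *\<^sub>C g) = c *\<^sub>C (f * g)"
    by (rule bcontfun_eqI)
      (simp add: scaleC_bcontfun.rep_eq times_bcontfun.rep_eq mult_scaleC_right)
  show "star (f + g) = star f + star g"
    by (rule bcontfun_eqI) (simp add: star_bcontfun.rep_eq plus_bcontfun.rep_eq star_add)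
  show "star (c *\<^sub>C f) = cnj c *\<^sub>C star f"
    by (rule bcontfun_eqI) (simp add: star_bcontfun.rep_eq scaleC_bcontfun.rep_eq star_scaleC)
  show "star (f * g) = star g * star f"
    by (rule bcontfun_eqI) (simp add: star_bcontfun.rep_eq times_bcontfun.rep_eq star_mult)
  show "star (star f) = f"
    by (rule bcontfun_eqI) (simp add: star_bcontfun.rep_eq star_star)
  show "norm (c *\<^sub>C f) = cmod c * norm f"
  proof (rule antisym)
    have le: "norm (e *\<^sub>C k) \<le> cmod e * norm k" for e and k :: "'a \<Rightarrow>\<^sub>C 'b"
      by (rule norm_bound)
        (simp add: scaleC_bcontfun.rep_eq norm_scaleC mult_left_mono norm_bounded)
    show "norm (c *\<^sub>C f) \<le> cmod c * norm f" by (rule le)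
    show "cmod c * norm f \<le> norm (c *\<^sub>C f)"
    proof (cases "c = 0")
      case False
      have "1 *\<^sub>C f = f"
        by (rule bcontfun_eqI)
          (use scaleC_of_real[of 1] in \<open>simp add: scaleC_bcontfun.rep_eq\<close>)
      moreover have "inverse c *\<^sub>C (c *\<^sub>C f) = (inverse c * c) *\<^sub>C f"
        by (rule bcontfun_eqI) (simp add: scaleC_bcontfun.rep_eq scaleC_scaleC)
      ultimately have "inverse c *\<^sub>C (c *\<^sub>C f) = f" using False by simp
      with le[of "inverse c" "c *\<^sub>C f"] False show ?thesis
        by (simp add: norm_inverse norm_divide field_simps)
    qed simp
  qed
  show "norm (star f * f) = (norm f)\<^sup>2"
  proof (rule antisym)
    show "norm (star f * f) \<le> (norm f)\<^sup>2"
      by (rule norm_bound)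
        (simp add: star_bcontfun.rep_eq times_bcontfun.rep_eq norm_star_mult norm_bounded
          power_mono)
    have "norm f \<le> sqrt (norm (star f * f))"
    proof (rule norm_bound)
      fix x
      have "(norm (apply_bcontfun f x))\<^sup>2 \<le> norm (star f * f)"
        using norm_bounded[of "star f * f" x]
        by (simp add: star_bcontfun.rep_eq times_bcontfun.rep_eq norm_star_mult)
      then show "norm (apply_bcontfun f x) \<le> sqrt (norm (star f * f))"
        by (rule real_le_rsqrt)
    qed
    then show "(norm f)\<^sup>2 \<le> norm (star f * f)"
      by (metis norm_ge_zero power_mono real_sqrt_pow2)
  qed
qed

end

lifting_forget bcontfun.lifting

definition star_hom :: "('a::cstar_algebra \<Rightarrow> 'b::cstar_algebra) \<Rightarrow> bool" where
  "star_hom \<phi> \<longleftrightarrow>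
     (\<forall>x y. \<phi> (x + y) = \<phi> x + \<phi> y) \<and> (\<forall>c x. \<phi> (c *\<^sub>C x) = c *\<^sub>C \<phi> x) \<and>
     (\<forall>x y. \<phi> (x * y) = \<phi> x * \<phi> y) \<and> (\<forall>x. \<phi> (star x) = star (\<phi> x)) \<and> \<phi> 1 = 1"


section \<open>Minimal tensor products\<close>

definition cstar_norm_on :: "'t::cstar_algebra set \<Rightarrow> ('t \<Rightarrow> real) \<Rightarrow> bool" where
  "cstar_norm_on D p \<longleftrightarrow>
     (\<forall>x\<in>D. 0 \<le> p x \<and> (p x = 0 \<longrightarrow> x = 0)) \<and>
     (\<forall>x\<in>D. \<forall>y\<in>D. p (x + y) \<le> p x + p y \<and> p (x * y) \<le> p x * p y) \<and>
     (\<forall>c. \<forall>x\<in>D. p (c *\<^sub>C x) = cmod c * p x) \<and>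
     (\<forall>x\<in>D. p (star x * x) = (p x)\<^sup>2)"

text \<open>
  \<open>t\<close> exhibits \<open>'t\<close> as \<open>A \<otimes> B\<close>, with \<open>t a b\<close> the elementary tensor: \<open>t\<close> is bilinear,
  multiplicative and *-preserving; the linear map from the algebraic tensor product that it induces
  is injective (fourth conjunct: \<open>\<Sum> a\<^sub>i \<otimes> b\<^sub>i = 0\<close> with linearly independent \<open>a\<^sub>i\<close> forces all
  \<open>b\<^sub>i = 0\<close>), so that the span of the elementary tensors is the *-algebra \<open>A \<odot> B\<close>; this span is
  dense; and on it the norm is the least C*-norm, that is, the minimal (spatial) one.
  The real span is also the complex span, as \<open>c *\<^sub>C t a b = t (c *\<^sub>C a) b\<close>.
\<close>

definition minimal_tensor ::
    "('a::cstar_algebra \<Rightarrow> 'b::cstar_algebra \<Rightarrow> 't::cstar_algebra) \<Rightarrow> bool" where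
  "minimal_tensor t \<longleftrightarrow>
     (\<forall>a a' b. t (a + a') b = t a b + t a' b) \<and> (\<forall>a b b'. t a (b + b') = t a b + t a b') \<and>
     (\<forall>c a b. t (c *\<^sub>C a) b = c *\<^sub>C t a b \<and> t a (c *\<^sub>C b) = c *\<^sub>C t a b) \<and>
     (\<forall>a a' b b'. t a b * t a' b' = t (a * a') (b * b')) \<and>
     (\<forall>a b. star (t a b) = t (star a) (star b)) \<and> t 1 1 = 1 \<and>
     (\<forall>(n::nat) a b.
        (\<forall>c. (\<Sum>i<n. c i *\<^sub>C a i) = 0 \<longrightarrow> (\<forall>i<n. c i = 0)) \<and> (\<Sum>i<n. t (a i) (b i)) = 0
          \<longrightarrow> (\<forall>i<n. b i = 0)) \<and>
     closure (span {t a b |a b. True}) = UNIV \<and>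
     (\<forall>p. cstar_norm_on (span {t a b |a b. True}) p \<longrightarrow>
        (\<forall>x \<in> span {t a b |a b. True}. norm x \<le> p x))"

text \<open>Realizations of \<open>(A \<otimes> B) \<otimes> C\<close> and \<open>A \<otimes> (B \<otimes> C)\<close> on one type, identified canonically.\<close>

definition minimal_tensor3 ::
    "('a::cstar_algebra \<Rightarrow> 'b::cstar_algebra \<Rightarrow> 'ab::cstar_algebra) \<Rightarrow>
     ('b \<Rightarrow> 'c::cstar_algebra \<Rightarrow> 'bc::cstar_algebra) \<Rightarrow>
     ('ab \<Rightarrow> 'c \<Rightarrow> 'abc::cstar_algebra) \<Rightarrow> ('a \<Rightarrow> 'bc \<Rightarrow> 'abc) \<Rightarrow> bool" where
  "minimal_tensor3 tab tbc tab_c ta_bc \<longleftrightarrow>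
     minimal_tensor tab \<and> minimal_tensor tbc \<and> minimal_tensor tab_c \<and> minimal_tensor ta_bc \<and>
     (\<forall>a b c. tab_c (tab a b) c = ta_bc a (tbc b c))"

text \<open>\<open>\<Phi> = \<phi> \<otimes> \<psi>\<close>; since *-homomorphisms are continuous, this determines \<open>\<Phi>\<close>.\<close>

definition tensor_hom ::
    "('a::cstar_algebra \<Rightarrow> 'b::cstar_algebra \<Rightarrow> 't::cstar_algebra) \<Rightarrow>
     ('c::cstar_algebra \<Rightarrow> 'd::cstar_algebra \<Rightarrow> 's::cstar_algebra) \<Rightarrow>
     ('a \<Rightarrow> 'c) \<Rightarrow> ('b \<Rightarrow> 'd) \<Rightarrow> ('t \<Rightarrow> 's) \<Rightarrow> bool" where
  "tensor_hom t s \<phi> \<psi> \<Phi> \<longleftrightarrow> star_hom \<Phi> \<and> (\<forall>a b. \<Phi> (t a b) = s (\<phi> a) (\<psi> b))"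


section \<open>Compact quantum groups and their actions\<close>

text \<open>Here \<open>'a\<close> is \<open>C(G)\<close>.\<close>

definition compact_quantum_group ::
    "('a::cstar_algebra \<Rightarrow> 'a \<Rightarrow> 'aa::cstar_algebra) \<Rightarrow>
     ('aa \<Rightarrow> 'a \<Rightarrow> 'aaa::cstar_algebra) \<Rightarrow> ('a \<Rightarrow> 'aa \<Rightarrow> 'aaa) \<Rightarrow> ('a \<Rightarrow> 'aa) \<Rightarrow> bool" where
  "compact_quantum_group tAA tAA_A tA_AA \<Delta> \<longleftrightarrow>
     minimal_tensor3 tAA tAA tAA_A tA_AA \<and> star_hom \<Delta> \<and>
     (\<exists>\<Phi> \<Psi>. tensor_hom tAA tAA_A \<Delta> id \<Phi> \<and> tensor_hom tAA tA_AA id \<Delta> \<Psi> \<and>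
        (\<forall>a. \<Phi> (\<Delta> a) = \<Psi> (\<Delta> a))) \<and>
     closure (span {\<Delta> a * tAA b 1 |a b. True}) = UNIV \<and>
     closure (span {\<Delta> a * tAA 1 b |a b. True}) = UNIV"

definition quantum_action ::
    "('a::cstar_algebra \<Rightarrow> 'a \<Rightarrow> 'aa::cstar_algebra) \<Rightarrow> ('a \<Rightarrow> 'aa) \<Rightarrow>
     (('x::metric_space \<Rightarrow>\<^sub>C complex) \<Rightarrow> 'a \<Rightarrow> 'xa::cstar_algebra) \<Rightarrow>
     ('xa \<Rightarrow> 'a \<Rightarrow> 'xaa::cstar_algebra) \<Rightarrow> (('x \<Rightarrow>\<^sub>C complex) \<Rightarrow> 'aa \<Rightarrow> 'xaa) \<Rightarrow>
     (('x \<Rightarrow>\<^sub>C complex) \<Rightarrow> 'xa) \<Rightarrow> bool" where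
  "quantum_action tAA \<Delta> tXA tXA_A tX_AA \<beta> \<longleftrightarrow>
     minimal_tensor3 tXA tAA tXA_A tX_AA \<and> star_hom \<beta> \<and>
     (\<exists>\<Phi> \<Psi>. tensor_hom tXA tXA_A \<beta> id \<Phi> \<and> tensor_hom tXA tX_AA id \<Delta> \<Psi> \<and>
        (\<forall>f. \<Phi> (\<beta> f) = \<Psi> (\<beta> f))) \<and>
     closure (span {\<beta> f * tXA 1 a |f a. True}) = UNIV"

definition faithful_prob_measure :: "'x::metric_space measure \<Rightarrow> bool" where
  "faithful_prob_measure \<mu> \<longleftrightarrow> prob_space \<mu> \<and> sets \<mu> = sets borel \<and>
     (\<forall>S. open S \<and> S \<noteq> {} \<longrightarrow> 0 < emeasure \<mu> S)"

text \<open>\<open>E\<close> is the slice map \<open>\<mu> \<otimes> id\<close>; it is determined by its values on elementary tensors.\<close>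

definition invariant_measure ::
    "(('x::metric_space \<Rightarrow>\<^sub>C complex) \<Rightarrow> 'a::cstar_algebra \<Rightarrow> 'xa::cstar_algebra) \<Rightarrow>
     (('x \<Rightarrow>\<^sub>C complex) \<Rightarrow> 'xa) \<Rightarrow> 'x measure \<Rightarrow> bool" where
  "invariant_measure tXA \<beta> \<mu> \<longleftrightarrow>
     (\<exists>E. bounded_linear E \<and> (\<forall>f a. E (tXA f a) = (\<integral>x. f x \<partial>\<mu>) *\<^sub>C a) \<and>
        (\<forall>f. E (\<beta> f) = (\<integral>x. f x \<partial>\<mu>) *\<^sub>C 1))"


section \<open>Square-integrable functions and Hilbert modules\<close>

text \<open>Elements of \<open>L\<^sup>2(\<mu>)\<close> are represented by functions, which count only up to null sets.\<close>

definition L2 :: "'y measure \<Rightarrow> ('y \<Rightarrow> complex) set" where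
  "L2 \<mu> = {f \<in> borel_measurable \<mu>. integrable \<mu> (\<lambda>y. (cmod (f y))\<^sup>2)}"

text \<open>The boundedness condition and linearity make \<open>t\<close> compatible with equality almost everywhere.\<close>

definition bounded_L2_operator :: "'y measure \<Rightarrow> (('y \<Rightarrow> complex) \<Rightarrow> 'y \<Rightarrow> complex) \<Rightarrow> bool" where
  "bounded_L2_operator \<mu> t \<longleftrightarrow>
     (\<forall>f \<in> L2 \<mu>. t f \<in> L2 \<mu>) \<and>
     (\<forall>f \<in> L2 \<mu>. \<forall>g \<in> L2 \<mu>. AE y in \<mu>. t (\<lambda>y. f y + g y) y = t f y + t g y) \<and>
     (\<forall>c. \<forall>f \<in> L2 \<mu>. AE y in \<mu>. t (\<lambda>y. c * f y) y = c * t f y) \<and>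
     (\<exists>K. \<forall>f \<in> L2 \<mu>. (\<integral>y. (cmod (t f y))\<^sup>2 \<partial>\<mu>) \<le> K * (\<integral>y. (cmod (f y))\<^sup>2 \<partial>\<mu>))"

text \<open>Inner products are linear in the second variable; the module is a right module.\<close>

definition hilbert_module ::
    "('m::banach \<Rightarrow> 'm \<Rightarrow> 'a::cstar_algebra) \<Rightarrow> ('m \<Rightarrow> 'a \<Rightarrow> 'm) \<Rightarrow> bool" where
  "hilbert_module ip act \<longleftrightarrow>
     (\<forall>x y a. act (x + y) a = act x a + act y a) \<and>
     (\<forall>x a b. act x (a + b) = act x a + act x b) \<and>
     (\<forall>x a b. act (act x a) b = act x (a * b)) \<and>
     (\<forall>x r. act x (r *\<^sub>R 1) = r *\<^sub>R x) \<and>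
     (\<forall>x y z. ip x (y + z) = ip x y + ip x z) \<and>
     (\<forall>x y a. ip x (act y a) = ip x y * a) \<and>
     (\<forall>x y. star (ip x y) = ip y x) \<and>
     (\<forall>x. \<exists>a. ip x x = star a * a) \<and>
     (\<forall>x. norm x = sqrt (norm (ip x x)))"

text \<open>\<open>L\<^sup>2(\<mu>) \<otimes> A\<close>, the completion of the algebraic tensor product; \<open>emb f a\<close> is \<open>f \<otimes> a\<close>.\<close>

definition L2_module ::
    "'y measure \<Rightarrow> ('m::banach \<Rightarrow> 'm \<Rightarrow> 'a::cstar_algebra) \<Rightarrow> ('m \<Rightarrow> 'a \<Rightarrow> 'm) \<Rightarrow>
     (('y \<Rightarrow> complex) \<Rightarrow> 'a \<Rightarrow> 'm) \<Rightarrow> bool" where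
  "L2_module \<mu> ip act emb \<longleftrightarrow>
     hilbert_module ip act \<and>
     (\<forall>f \<in> L2 \<mu>. \<forall>g \<in> L2 \<mu>. \<forall>a b.
        ip (emb f a) (emb g b) = (\<integral>y. cnj (f y) * g y \<partial>\<mu>) *\<^sub>C (star a * b)) \<and>
     (\<forall>f \<in> L2 \<mu>. \<forall>a b. act (emb f a) b = emb f (a * b)) \<and>
     closure (span {emb f a |f a. f \<in> L2 \<mu>}) = UNIV"

definition adjointable :: "('m \<Rightarrow> 'm \<Rightarrow> 'a) \<Rightarrow> ('m \<Rightarrow> 'm) \<Rightarrow> bool" where
  "adjointable ip T \<longleftrightarrow> (\<exists>S. \<forall>x y. ip (T x) y = ip x (S y))"

definition module_adjoint :: "('m \<Rightarrow> 'm \<Rightarrow> 'a) \<Rightarrow> ('m \<Rightarrow> 'm) \<Rightarrow> 'm \<Rightarrow> 'm" where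
  "module_adjoint ip T = (THE S. \<forall>x y. ip (T x) y = ip x (S y))"

definition unitary_operator :: "('m \<Rightarrow> 'm \<Rightarrow> 'a) \<Rightarrow> ('m \<Rightarrow> 'm) \<Rightarrow> bool" where
  "unitary_operator ip T \<longleftrightarrow> adjointable ip T \<and>
     T \<circ> module_adjoint ip T = id \<and> module_adjoint ip T \<circ> T = id"

text \<open>\<open>t \<otimes> 1\<close>\<close>

definition ampliation ::
    "'y measure \<Rightarrow> (('y \<Rightarrow> complex) \<Rightarrow> 'a \<Rightarrow> 'm::real_normed_vector) \<Rightarrow>
     (('y \<Rightarrow> complex) \<Rightarrow> 'y \<Rightarrow> complex) \<Rightarrow> 'm \<Rightarrow> 'm" where
  "ampliation \<mu> emb t =
     (THE T. bounded_linear T \<and> (\<forall>g \<in> L2 \<mu>. \<forall>a. T (emb g a) = emb (t g) a))"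


section \<open>The associated unitary representation, isometric actions and the orbital algebra\<close>

text \<open>
  \<open>\<kappa>\<close> is the canonical map \<open>C(X) \<otimes> C(G) \<rightarrow> L\<^sup>2(X) \<otimes> C(G)\<close>, which is implicit in the defining formula
  \<open>U (f \<otimes> a) = \<beta>(f) (1 \<otimes> a)\<close>; it is determined by its values on elementary tensors.
\<close>

definition associated_unitary ::
    "(('x::metric_space \<Rightarrow>\<^sub>C complex) \<Rightarrow> 'a::cstar_algebra \<Rightarrow> 'xa::cstar_algebra) \<Rightarrow>
     (('x \<Rightarrow>\<^sub>C complex) \<Rightarrow> 'xa) \<Rightarrow> ('m::banach \<Rightarrow> 'm \<Rightarrow> 'a) \<Rightarrow>
     (('x \<Rightarrow> complex) \<Rightarrow> 'a \<Rightarrow> 'm) \<Rightarrow> ('m \<Rightarrow> 'm) \<Rightarrow> bool" where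
  "associated_unitary tXA \<beta> ip emb U \<longleftrightarrow>
     unitary_operator ip U \<and>
     (\<exists>\<kappa>. bounded_linear \<kappa> \<and> (\<forall>f a. \<kappa> (tXA f a) = emb (apply_bcontfun f) a) \<and>
        (\<forall>f a. U (emb (apply_bcontfun f) a) = \<kappa> (\<beta> f * tXA 1 a)))"

definition intertwiner ::
    "'x measure \<Rightarrow> (('x \<Rightarrow> complex) \<Rightarrow> 'a \<Rightarrow> 'm::real_normed_vector) \<Rightarrow> ('m \<Rightarrow> 'm) \<Rightarrow>
     (('x \<Rightarrow> complex) \<Rightarrow> 'x \<Rightarrow> complex) \<Rightarrow> bool" where
  "intertwiner \<mu> emb U t \<longleftrightarrow>
     bounded_L2_operator \<mu> t \<and> U \<circ> ampliation \<mu> emb t = ampliation \<mu> emb t \<circ> U"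

text \<open>
  In the following, \<open>emb\<close> and \<open>emb2\<close> belong to \<open>L\<^sup>2(X) \<otimes> C(G)\<close> and to
  \<open>L\<^sup>2(X) \<otimes> L\<^sup>2(X) \<otimes> C(G) = L\<^sup>2(X \<times> X) \<otimes> C(G)\<close>. The maps \<open>insert1 h\<close> and \<open>insert2 h\<close> are
  \<open>f \<otimes> a \<mapsto> h \<otimes> f \<otimes> a\<close> and \<open>f \<otimes> a \<mapsto> f \<otimes> h \<otimes> a\<close>.
\<close>

definition insert1 ::
    "'x measure \<Rightarrow> (('x \<Rightarrow> complex) \<Rightarrow> 'a \<Rightarrow> 'm::real_normed_vector) \<Rightarrow>
     (('x \<times> 'x \<Rightarrow> complex) \<Rightarrow> 'a \<Rightarrow> 'n::real_normed_vector) \<Rightarrow> ('x \<Rightarrow> complex) \<Rightarrow> 'm \<Rightarrow> 'n" where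
  "insert1 \<mu> emb emb2 h =
     (THE T. bounded_linear T \<and>
        (\<forall>f \<in> L2 \<mu>. \<forall>a. T (emb f a) = emb2 (\<lambda>(x, y). h x * f y) a))"

definition insert2 ::
    "'x measure \<Rightarrow> (('x \<Rightarrow> complex) \<Rightarrow> 'a \<Rightarrow> 'm::real_normed_vector) \<Rightarrow>
     (('x \<times> 'x \<Rightarrow> complex) \<Rightarrow> 'a \<Rightarrow> 'n::real_normed_vector) \<Rightarrow> ('x \<Rightarrow> complex) \<Rightarrow> 'm \<Rightarrow> 'n" where
  "insert2 \<mu> emb emb2 h =
     (THE T. bounded_linear T \<and>
        (\<forall>f \<in> L2 \<mu>. \<forall>a. T (emb f a) = emb2 (\<lambda>(x, y). f x * h y) a))"

definition leg23 ::
    "'x measure \<Rightarrow> (('x \<Rightarrow> complex) \<Rightarrow> 'a \<Rightarrow> 'm::real_normed_vector) \<Rightarrow>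
     (('x \<times> 'x \<Rightarrow> complex) \<Rightarrow> 'a \<Rightarrow> 'n::real_normed_vector) \<Rightarrow> ('m \<Rightarrow> 'm) \<Rightarrow> 'n \<Rightarrow> 'n" where
  "leg23 \<mu> emb emb2 U =
     (THE V. bounded_linear V \<and>
        (\<forall>h \<in> L2 \<mu>. \<forall>m. V (insert1 \<mu> emb emb2 h m) = insert1 \<mu> emb emb2 h (U m)))"

definition leg13 ::
    "'x measure \<Rightarrow> (('x \<Rightarrow> complex) \<Rightarrow> 'a \<Rightarrow> 'm::real_normed_vector) \<Rightarrow>
     (('x \<times> 'x \<Rightarrow> complex) \<Rightarrow> 'a \<Rightarrow> 'n::real_normed_vector) \<Rightarrow> ('m \<Rightarrow> 'm) \<Rightarrow> 'n \<Rightarrow> 'n" where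
  "leg13 \<mu> emb emb2 U =
     (THE V. bounded_linear V \<and>
        (\<forall>h \<in> L2 \<mu>. \<forall>m. V (insert2 \<mu> emb emb2 h m) = insert2 \<mu> emb emb2 h (U m)))"

definition W_op ::
    "'x measure \<Rightarrow> (('x \<Rightarrow> complex) \<Rightarrow> 'a \<Rightarrow> 'm::real_normed_vector) \<Rightarrow>
     (('x \<times> 'x \<Rightarrow> complex) \<Rightarrow> 'a \<Rightarrow> 'n::real_normed_vector) \<Rightarrow> ('m \<Rightarrow> 'm) \<Rightarrow> 'n \<Rightarrow> 'n" where
  "W_op \<mu> emb emb2 U = leg13 \<mu> emb emb2 U \<circ> leg23 \<mu> emb emb2 U"

definition Z_op ::
    "'x measure \<Rightarrow> (('x \<Rightarrow> complex) \<Rightarrow> 'a \<Rightarrow> 'm::real_normed_vector) \<Rightarrow>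
     (('x \<times> 'x \<Rightarrow> complex) \<Rightarrow> 'a \<Rightarrow> 'n::real_normed_vector) \<Rightarrow> ('m \<Rightarrow> 'm) \<Rightarrow> 'n \<Rightarrow> 'n" where
  "Z_op \<mu> emb emb2 U = leg23 \<mu> emb emb2 U \<circ> leg13 \<mu> emb emb2 U"

definition isometric_action ::
    "'x::metric_space measure \<Rightarrow> (('x \<Rightarrow> complex) \<Rightarrow> 'a::cstar_algebra \<Rightarrow> 'm::real_normed_vector) \<Rightarrow>
     (('x \<times> 'x \<Rightarrow> complex) \<Rightarrow> 'a \<Rightarrow> 'n::real_normed_vector) \<Rightarrow> ('m \<Rightarrow> 'm) \<Rightarrow> bool" where
  "isometric_action \<mu> emb emb2 U \<longleftrightarrow>
     (let d = (\<lambda>(x, y). complex_of_real (dist x y)) in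
        W_op \<mu> emb emb2 U (emb2 d 1) = emb2 d 1 \<and> Z_op \<mu> emb emb2 U (emb2 d 1) = emb2 d 1)"

definition multiplication_operator :: "('y \<Rightarrow> complex) \<Rightarrow> ('y \<Rightarrow> complex) \<Rightarrow> 'y \<Rightarrow> complex" where
  "multiplication_operator f g = (\<lambda>y. f y * g y)"

definition orbital_algebra ::
    "'x::metric_space measure \<Rightarrow> (('x \<Rightarrow> complex) \<Rightarrow> 'a::cstar_algebra \<Rightarrow> 'm::real_normed_vector) \<Rightarrow>
     ('n \<Rightarrow> 'n \<Rightarrow> 'a) \<Rightarrow> (('x \<times> 'x \<Rightarrow> complex) \<Rightarrow> 'a \<Rightarrow> 'n::real_normed_vector) \<Rightarrow> ('m \<Rightarrow> 'm) \<Rightarrow>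
     (('x \<times> 'x) \<Rightarrow>\<^sub>C complex) set" where
  "orbital_algebra \<mu> emb ip2 emb2 U =
     {f. let W = W_op \<mu> emb emb2 U; Z = Z_op \<mu> emb emb2 U;
             P = ampliation (\<mu> \<Otimes>\<^sub>M \<mu>) emb2 (multiplication_operator (apply_bcontfun f))
         in W \<circ> P \<circ> module_adjoint ip2 W = P \<and> Z \<circ> P \<circ> module_adjoint ip2 Z = P}"

definition kernel_operator ::
    "'x measure \<Rightarrow> ('x \<times> 'x \<Rightarrow> complex) \<Rightarrow> ('x \<Rightarrow> complex) \<Rightarrow> 'x \<Rightarrow> complex" where
  "kernel_operator \<mu> f g = (\<lambda>x. \<integral>y. f (x, y) * g y \<partial>\<mu>)"

end

theory Submission
  imports Defs
begin

text \<open>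
  Multiplication by \<open>f\<close> commutes with \<open>\<beta>(p)\<^sub>1\<^sub>3\<close> and \<open>\<beta>(p)\<^sub>2\<^sub>3\<close>, because \<open>C(X)\<close> is commutative, and
  \<open>Z (k \<otimes> l \<otimes> 1) = \<beta>(l)\<^sub>2\<^sub>3 \<beta>(k)\<^sub>1\<^sub>3\<close>. Hence \<open>\<langle>Z (k \<otimes> l \<otimes> 1), f Z (g \<otimes> h \<otimes> 1)\<rangle>\<close> is the integral of
  \<open>\<beta>(k\<^sup>*)(x) f(x, y) \<beta>(l\<^sup>* h)(y) \<beta>(g)(x)\<close>. If \<open>\<rho>(f)\<close> intertwines \<open>U\<close>, integration over \<open>y\<close> replaces
  the two middle factors by \<open>\<beta>(\<rho>(f)(l\<^sup>* h))(x)\<close>, and as \<open>U\<close> is isometric the result is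
  \<open>\<langle>k \<otimes> l \<otimes> 1, f (g \<otimes> h \<otimes> 1)\<rangle>\<close>; so \<open>f\<close> commutes with the unitary \<open>Z\<close>. Conversely, the instance
  \<open>l = g = 1\<close> of this identity says that \<open>\<rho>(f)\<close> intertwines \<open>U\<close>. Exchanging the two coordinates turns
  \<open>Z\<close> into \<open>W\<close> and \<open>\<rho>(f)\<close> into the operator with transposed kernel, which is an intertwiner together
  with \<open>\<rho>(f)\<close>: the adjoint is one since \<open>U\<close> is unitary, the complex conjugate since \<open>\<beta>\<close> preserves the
  involution.

  The map \<open>k \<otimes> l \<mapsto> \<beta>(l)\<^sub>2\<^sub>3 \<beta>(k)\<^sub>1\<^sub>3\<close> is not bounded for the supremum norm on \<open>C(X \<times> X)\<close> in general, so
  \<open>f\<close> is only ever approximated by elementary tensors as a multiplication operator.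
\<close>

section \<open>Bounded operators on dense subspaces\<close>

text \<open>The realizations prescribe little more than the inner products of elementary tensors,
  and \<open>ampliation\<close>, \<open>insert1\<close>, \<open>leg23\<close> and
  \<open>module_adjoint\<close> are definite descriptions. So each operator must first be shown to
  exist on a completed module, and this shapes the first half of the proof. The customary estimates
  rest on the order of a C*-algebra; here bounds come from exact identities instead: a relation that
  preserves inner products up to a factor is already part of the graph of a bounded operator.
  Multiplication operators are combined from unimodular ones, and kernel operators are slices of
  multiplication operators. The price is constants (4, 2, 8) that are not sharp; they only serve
  continuity.

  The IDEA above contains a stray symbol, so the full list restarts here and replaces it.\<close>

lemma subspace_closure:
  fixes S :: "'v::real_normed_vector set"
  assumes "subspace S"
  shows "subspace (closure S)"
  unfolding subspace_def
proof (intro conjI ballI allI)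
  show "0 \<in> closure S" using assms subspace_0 closure_subset by blast
next
  fix x y assume "x \<in> closure S" "y \<in> closure S"
  then obtain s t where "\<And>n::nat. s n \<in> S" "s \<longlonglongrightarrow> x" "\<And>n::nat. t n \<in> S" "t \<longlonglongrightarrow> y"
    unfolding closure_sequential by blast
  then show "x + y \<in> closure S"
    unfolding closure_sequential using assms
    by (intro exI[of _ "\<lambda>n. s n + t n"]) (auto intro: tendsto_add subspace_add)
next
  fix c x assume "x \<in> closure S"
  then obtain s where "\<And>n::nat. s n \<in> S" "s \<longlonglongrightarrow> x"
    unfolding closure_sequential by blast
  then show "c *\<^sub>R x \<in> closure S"
    unfolding closure_sequential using assms
    by (intro exI[of _ "\<lambda>n. c *\<^sub>R s n"]) (auto intro: tendsto_scaleR subspace_scale)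
qed

text \<open>The closure of \<open>span S\<close> in the product space is itself the graph of the
  operator: the bound passes to limits and makes it single-valued, completeness of the target makes
  it defined everywhere. A relation replaces a function because a vector has many presentations as
  an elementary tensor; the bound takes care of well-definedness.\<close>

lemma graph_extension:
  fixes S :: "('a::real_normed_vector \<times> 'b::banach) set"
  assumes dense: "closure (span (fst ` S)) = UNIV"
    and bd: "\<And>p. p \<in> span S \<Longrightarrow> norm (snd p) \<le> K * norm (fst p)"
    and K: "0 \<le> K"
  shows "\<exists>T. bounded_linear T \<and> (\<forall>x y. (x, y) \<in> S \<longrightarrow> T x = y) \<and> (\<forall>x. norm (T x) \<le> K * norm x)"
proof -
  define G where "G = closure (span S)"
  have sub: "subspace G" unfolding G_def by (intro subspace_closure subspace_span)
  have SG: "span S \<subseteq> G" unfolding G_def by (rule closure_subset)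
  have bG: "norm (snd p) \<le> K * norm (fst p)" if "p \<in> G" for p
  proof -
    have "closed {p::'a \<times> 'b. norm (snd p) \<le> K * norm (fst p)}"
      by (intro closed_Collect_le continuous_intros)
    then have "G \<subseteq> {p. norm (snd p) \<le> K * norm (fst p)}"
      unfolding G_def by (intro closure_minimal) (use bd in auto)
    with that show ?thesis by auto
  qed
  have uniq: "y = y'" if "(x, y) \<in> G" "(x, y') \<in> G" for x y y'
    using bG[OF subspace_diff[OF sub that]] by simp
  have ex: "\<exists>y. (x, y) \<in> G" for x
  proof -
    have "x \<in> closure (span (fst ` S))" using dense by simp
    then obtain s where s: "\<And>n. s n \<in> span (fst ` S)" "s \<longlonglongrightarrow> x"
      unfolding closure_sequential by auto
    have "span (fst ` S) = fst ` span S"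
      by (rule linear_span_image) (simp add: linear_fst)
    with s(1) have "\<exists>p. p \<in> span S \<and> s n = fst p" for n by (metis imageE)
    then obtain p where p: "\<And>n. p n \<in> span S" "\<And>n. s n = fst (p n)" by metis
    have "Cauchy (\<lambda>n. snd (p n))"
    proof (rule metric_CauchyI)
      fix e :: real assume "0 < e"
      \<comment> \<open>\<open>K + 1\<close> instead of \<open>K\<close>, because \<open>K\<close>
        may be 0.\<close>
      then have "0 < e / (K + 1)" using K by simp
      from metric_CauchyD[OF LIMSEQ_imp_Cauchy[OF s(2)] this]
      obtain N where N: "\<And>m n. m \<ge> N \<Longrightarrow> n \<ge> N \<Longrightarrow> dist (s m) (s n) < e / (K + 1)" by blast
      have "dist (snd (p m)) (snd (p n)) < e" if "m \<ge> N" "n \<ge> N" for m n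
      proof -
        have "dist (snd (p m)) (snd (p n)) \<le> K * dist (s m) (s n)"
          using bd[OF span_diff[OF p(1)[of m] p(1)[of n]]] p(2) by (simp add: dist_norm)
        also have "\<dots> \<le> (K + 1) * dist (s m) (s n)" by (simp add: mult_right_mono)
        also have "\<dots> < e" using N[OF that] K by (simp add: field_simps)
        finally show ?thesis .
      qed
      then show "\<exists>N. \<forall>m\<ge>N. \<forall>n\<ge>N. dist (snd (p m)) (snd (p n)) < e" by blast
    qed
    then obtain y where "(\<lambda>n. snd (p n)) \<longlonglongrightarrow> y" by (auto simp: Cauchy_convergent_iff convergent_def)
    then have "(\<lambda>n. (s n, snd (p n))) \<longlonglongrightarrow> (x, y)" using s(2) by (intro tendsto_Pair)
    moreover have "(s n, snd (p n)) \<in> span S" for n using p by (metis prod.collapse)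
    ultimately have "(x, y) \<in> G" unfolding G_def closure_sequential
      by (intro exI[of _ "\<lambda>n. (s n, snd (p n))"]) simp
    then show ?thesis ..
  qed
  define T where "T x = (THE y. (x, y) \<in> G)" for x
  have TG: "(x, T x) \<in> G" for x
    unfolding T_def using ex uniq by (metis (mono_tags, lifting) theI)
  have Teq: "T x = y" if "(x, y) \<in> G" for x y using uniq[OF TG that] .
  have nb: "norm (T x) \<le> K * norm x" for x using bG[OF TG[of x]] by simp
  show ?thesis
  proof (intro exI[of _ T] conjI allI impI)
    show "norm (T x) \<le> K * norm x" for x by (rule nb)
    show "bounded_linear T"
    proof (rule bounded_linear_intro[where K = K])
      show "T (x + y) = T x + T y" for x y
        using subspace_add[OF sub TG[of x] TG[of y]] by (intro Teq) simp
      show "T (r *\<^sub>R x) = r *\<^sub>R T x" for r x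
        using subspace_scale[OF sub TG[of x], of r] by (intro Teq) simp
      show "norm (T x) \<le> norm x * K" for x using nb[of x] by (simp add: mult.commute)
    qed
    show "T x = y" if "(x, y) \<in> S" for x y
      using Teq SG span_base[OF that] by blast
  qed
qed

text \<open>This gives the uniqueness of ampliations, insertions and legs, and it reduces later
  identities between operators to elementary tensors.\<close>

lemma bounded_linear_eq_on_dense:
  assumes "bounded_linear S" "bounded_linear T" "closure (span A) = UNIV"
    and eq: "\<And>x. x \<in> A \<Longrightarrow> S x = T x"
  shows "S x = T x"
proof -
  interpret S: bounded_linear S by fact
  interpret T: bounded_linear T by fact
  have "S x = T x" if "x \<in> span A" for x
    using that by (induction rule: span_induct_alt) (auto simp: eq S.add T.add S.scale T.scale S.zero T.zero)
  then have "span A \<subseteq> {x. S x = T x}" by auto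
  moreover have "closed {x. S x = T x}"
    by (intro closed_Collect_eq S.continuous_on T.continuous_on continuous_on_id)
  ultimately have "closure (span A) \<subseteq> {x. S x = T x}" by (rule closure_minimal)
  with assms(3) show ?thesis by auto
qed

lemma closure_span_eq_UNIV_trans:
  fixes A B :: "'v::real_normed_vector set"
  assumes "closure (span A) = UNIV" "A \<subseteq> closure (span B)"
  shows "closure (span B) = UNIV"
proof -
  have "span A \<subseteq> closure (span B)"
    by (intro span_minimal assms(2) subspace_closure subspace_span)
  then have "closure (span A) \<subseteq> closure (span B)"
    by (metis closure_closure closure_mono)
  with assms(1) show ?thesis by auto
qed

section \<open>Hilbert modules\<close>

lemma scaleC_one: "1 *\<^sub>C x = (x :: 'a::cstar_algebra)"
  using scaleC_of_real[of 1 x] by simp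

lemma scaleC_diff_right: "c *\<^sub>C (x - y) = c *\<^sub>C x - c *\<^sub>C (y :: 'a::cstar_algebra)"
  using linear_diff[OF bounded_linear.linear[OF bounded_linear_scaleC]] .

lemma scaleC_scaleR: "c *\<^sub>C (r *\<^sub>R x) = r *\<^sub>R c *\<^sub>C (x :: 'a::cstar_algebra)"
  using linear_scale[OF bounded_linear.linear[OF bounded_linear_scaleC]] .

lemma scaleC_diff_left: "(c - d) *\<^sub>C x = c *\<^sub>C x - d *\<^sub>C (x :: 'a::cstar_algebra)"
  using scaleC_add_left[of "c - d" d x] by (simp add: algebra_simps)

lemma star_one: "star 1 = (1 :: 'a::cstar_algebra)"
  by (metis mult_1_left mult_1_right star_mult star_star)

lemma star_scaleR: "star (r *\<^sub>R x) = r *\<^sub>R star (x :: 'a::cstar_algebra)"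
  using linear_scale[OF bounded_linear.linear[OF bounded_linear_star]] .

locale hilbert_mod =
  fixes ip :: "'m::banach \<Rightarrow> 'm \<Rightarrow> 'a::cstar_algebra" and act :: "'m \<Rightarrow> 'a \<Rightarrow> 'm"
  assumes hilbert_module: "hilbert_module ip act"
begin

lemma act_add_left: "act (x + y) a = act x a + act y a"
  and act_scaleR_one: "act x (r *\<^sub>R 1) = r *\<^sub>R x"
  and ip_add_right: "ip x (y + z) = ip x y + ip x z"
  and ip_act_right: "ip x (act y a) = ip x y * a"
  and star_ip: "star (ip x y) = ip y x"
  and norm_ip: "norm x = sqrt (norm (ip x x))"
  using hilbert_module unfolding hilbert_module_def by auto

lemma ip_add_left: "ip (x + y) z = ip x z + ip y z"
  by (metis ip_add_right star_add star_ip)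

lemma ip_act_left: "ip (act x a) y = star a * ip x y"
  by (metis ip_act_right star_ip star_mult)

lemma ip_scaleR_right: "ip x (r *\<^sub>R y) = r *\<^sub>R ip x y"
  by (metis act_scaleR_one ip_act_right mult_scaleR_right mult_1_right)

lemma ip_scaleR_left: "ip (r *\<^sub>R x) y = r *\<^sub>R ip x y"
  by (metis ip_scaleR_right star_ip star_scaleR)

lemma ip_minus_right: "ip x (- y) = - ip x y"
  using ip_scaleR_right[of x "-1" y] by simp

lemma ip_minus_left: "ip (- x) y = - ip x y"
  using ip_scaleR_left[of "-1" x y] by simp

lemma ip_diff_right: "ip x (y - z) = ip x y - ip x z"
  using ip_add_right[of x y "- z"] by (simp add: ip_minus_right)

lemma ip_diff_left: "ip (x - y) z = ip x z - ip y z"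
  using ip_add_left[of x "- y" z] by (simp add: ip_minus_left)

lemma ip_zero_right: "ip x 0 = 0" and ip_zero_left: "ip 0 x = 0"
  using ip_diff_right[of x 0 0] ip_diff_left[of 0 0 x] by auto

lemma norm_ip_self: "norm (ip x x) = (norm x)\<^sup>2"
  using norm_ip[of x] by simp

lemma eqI_ip:
  assumes "\<And>z. ip z x = ip z y"
  shows "x = y"
proof -
  have "ip (x - y) (x - y) = 0" using assms by (simp add: ip_diff_right)
  then show ?thesis using norm_ip[of "x - y"] by simp
qed

text \<open>The type \<open>'m\<close> is only a real vector space; complex scalars are recovered
  from the module action of the multiples of 1.\<close>

definition scC :: "complex \<Rightarrow> 'm \<Rightarrow> 'm" where
  "scC c x = act x (c *\<^sub>C 1)"

lemma ip_scC_right: "ip x (scC c y) = c *\<^sub>C ip x y"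
  unfolding scC_def ip_act_right by (simp add: mult_scaleC_right)

lemma ip_scC_left: "ip (scC c x) y = cnj c *\<^sub>C ip x y"
  unfolding scC_def ip_act_left by (simp add: star_scaleC star_one mult_scaleC_left)

lemma norm_scC: "norm (scC c x) = cmod c * norm x"
  by (subst norm_ip)
    (simp add: ip_scC_right ip_scC_left norm_scaleC norm_ip_self real_sqrt_mult flip: mult.assoc)

lemma scC_add: "scC c (x + y) = scC c x + scC c y"
  unfolding scC_def by (rule act_add_left)

lemma act_scaleR: "act (r *\<^sub>R x) a = r *\<^sub>R act x a"
  by (rule eqI_ip) (simp add: ip_act_right ip_scaleR_right)

lemma scC_scaleR: "scC c (r *\<^sub>R x) = r *\<^sub>R scC c x"
  unfolding scC_def by (rule act_scaleR)

lemma bounded_linear_scC: "bounded_linear (scC c)"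
  by (rule bounded_linear_intro[where K = "cmod c"])
    (simp_all add: scC_add scC_scaleR norm_scC mult.commute)

text \<open>Cauchy--Schwarz with constant 4 follows from polarization alone, so that no positivity in
  C*-algebras is needed.\<close>

lemma norm_ip_le: "norm (ip x y) \<le> 4 * norm x * norm y"
proof -
  have sum_le: "norm (ip x y) \<le> (norm x + norm y)\<^sup>2" for x y
  proof -
    \<comment> \<open>Polarization with \<open>x\<close> yields \<open>ip x y + ip y x\<close>, and
      polarization with \<open>x'\<close> yields \<open>ip x y - ip y x\<close>; adding the two
      isolates \<open>ip x y\<close>.\<close>
    define x' where "x' = scC \<i> x"
    have nx': "norm x' = norm x" by (simp add: x'_def norm_scC)
    have bd: "norm (ip (u + v) (u + v)) \<le> (norm u + norm v)\<^sup>2"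
      "norm (ip (u - v) (u - v)) \<le> (norm u + norm v)\<^sup>2" for u v
      using norm_triangle_ineq[of u v] norm_triangle_ineq4[of u v]
      by (auto simp: norm_ip_self intro!: power_mono)
    have ii: "\<i> *\<^sub>C (- \<i>) *\<^sub>C a = a" "\<i> *\<^sub>C \<i> *\<^sub>C a = - a" for a :: 'a
      using scaleC_of_real[of "-1" a] by (simp_all add: scaleC_scaleC scaleC_one)
    have A: "ip (x + y) (x + y) - ip (x - y) (x - y) = 2 *\<^sub>R (ip x y + ip y x)" (is "?A = _")
      by (simp add: ip_add_left ip_add_right ip_diff_left ip_diff_right scaleR_2 algebra_simps)
    have B: "\<i> *\<^sub>C (ip (x' + y) (x' + y) - ip (x' - y) (x' - y)) = 2 *\<^sub>R (ip x y - ip y x)"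
      (is "?B = _")
    proof -
      have "ip (x' + y) (x' + y) - ip (x' - y) (x' - y) = (2::real) *\<^sub>R ((- \<i>) *\<^sub>C ip x y + \<i> *\<^sub>C ip y x)"
        unfolding x'_def by (simp add: ip_add_left ip_add_right ip_diff_left ip_diff_right
            ip_scC_left ip_scC_right scaleC_add_right scaleC_diff_right scaleR_2 algebra_simps)
      then show ?thesis
        by (simp add: scaleC_scaleR scaleC_add_right ii)
    qed
    have "4 *\<^sub>R ip x y = ?A + ?B" unfolding A B by (simp add: algebra_simps flip: scaleR_add_left)
    then have "4 * norm (ip x y) = norm (?A + ?B)" by (metis norm_scaleR abs_numeral)
    also have "\<dots> \<le> norm ?A + norm ?B" by (rule norm_triangle_ineq)
    also have "norm ?B = norm (ip (x' + y) (x' + y) - ip (x' - y) (x' - y))"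
      by (simp add: norm_scaleC)
    also have "norm ?A \<le> 2 * (norm x + norm y)\<^sup>2"
      using norm_triangle_ineq4[of "ip (x + y) (x + y)" "ip (x - y) (x - y)"] bd[of x y] by linarith
    also have "norm (ip (x' + y) (x' + y) - ip (x' - y) (x' - y)) \<le> 2 * (norm x + norm y)\<^sup>2"
      using norm_triangle_ineq4[of "ip (x' + y) (x' + y)" "ip (x' - y) (x' - y)"] bd[of x' y]
      unfolding nx' by linarith
    finally show ?thesis by simp
  qed
  show ?thesis
  proof (cases "x = 0 \<or> y = 0")
    case True
    then show ?thesis by (auto simp: ip_zero_left ip_zero_right)
  next
    case False
    then have pos: "0 < norm x" "0 < norm y" by auto
    \<comment> \<open>For unit vectors \<open>sum_le\<close> gives (1 + 1)^2 = 4, the constant of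
      the statement.\<close>
    have "norm (ip ((1 / norm x) *\<^sub>R x) ((1 / norm y) *\<^sub>R y)) \<le> 4"
      using sum_le[of "(1 / norm x) *\<^sub>R x" "(1 / norm y) *\<^sub>R y"] pos by (simp add: power2_eq_square)
    then have "norm (ip x y) / (norm x * norm y) \<le> 4"
      by (simp add: ip_scaleR_left ip_scaleR_right mult.commute)
    then show ?thesis using pos by (simp add: field_simps)
  qed
qed

lemma bounded_linear_ip_right: "bounded_linear (ip x)"
  by (rule bounded_linear_intro[where K = "4 * norm x"])
    (auto simp: ip_add_right ip_scaleR_right intro: order_trans[OF norm_ip_le])

lemma bounded_linear_ip_left: "bounded_linear (\<lambda>x. ip x y)"
  by (rule bounded_linear_intro[where K = "4 * norm y"])
    (auto simp: ip_add_left ip_scaleR_left mult.commute mult.left_commute intro: order_trans[OF norm_ip_le])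

lemma eqI_ip_dense:
  assumes "closure (span A) = UNIV" "\<And>z. z \<in> A \<Longrightarrow> ip z x = ip z y"
  shows "x = y"
  by (rule eqI_ip)
    (rule bounded_linear_eq_on_dense[OF bounded_linear_ip_left bounded_linear_ip_left assms])

lemma module_adjoint_eqI:
  assumes "\<And>x y. ip (T x) y = ip x (S y)"
  shows "module_adjoint ip T = S"
  unfolding module_adjoint_def
proof (rule the_equality)
  fix S' assume "\<forall>x y. ip (T x) y = ip x (S' y)"
  then have "ip x (S' y) = ip x (S y)" for x y using assms by metis
  then show "S' = S" by (intro ext eqI_ip)
qed (use assms in auto)

lemma unitary_operatorE:
  assumes "unitary_operator ip T"
  obtains S where "\<And>x y. ip (T x) y = ip x (S y)" "\<And>x. T (S x) = x" "\<And>x. S (T x) = x"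
proof -
  from assms obtain S where S: "\<And>x y. ip (T x) y = ip x (S y)"
    unfolding unitary_operator_def adjointable_def by blast
  with assms have "T \<circ> S = id" "S \<circ> T = id"
    using module_adjoint_eqI[OF S] unfolding unitary_operator_def by auto
  then show ?thesis using S that by (metis comp_apply id_apply)
qed

end

section \<open>The modules \<open>L\<^sup>2(M) \<otimes> A\<close>\<close>

lemma L2_measurable: "f \<in> L2 M \<Longrightarrow> f \<in> borel_measurable M"
  and L2_integrable: "f \<in> L2 M \<Longrightarrow> integrable M (\<lambda>y. (cmod (f y))\<^sup>2)"
  by (auto simp: L2_def)

lemma L2_dominated:
  assumes "f \<in> borel_measurable M" "g \<in> L2 M" "\<And>y. y \<in> space M \<Longrightarrow> cmod (f y) \<le> B * cmod (g y)"
  shows "f \<in> L2 M"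
proof -
  have "integrable M (\<lambda>y. (cmod (f y))\<^sup>2)"
  proof (rule Bochner_Integration.integrable_bound)
    show "integrable M (\<lambda>y. B\<^sup>2 * (cmod (g y))\<^sup>2)" using assms(2) by (simp add: L2_def)
    show "AE y in M. norm ((cmod (f y))\<^sup>2) \<le> norm (B\<^sup>2 * (cmod (g y))\<^sup>2)"
      using power_mono[OF assms(3), of _ 2]
      by (intro AE_I2) (simp add: power_mult_distrib)
  qed (use assms in measurable)
  with assms(1) show ?thesis by (simp add: L2_def)
qed

lemma L2_mult_bounded:
  assumes "g \<in> L2 M" "h \<in> borel_measurable M" "\<And>y. y \<in> space M \<Longrightarrow> cmod (h y) \<le> B"
  shows "(\<lambda>y. h y * g y) \<in> L2 M"
proof (rule L2_dominated[OF _ assms(1), where B = B])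
  show "(\<lambda>y. h y * g y) \<in> borel_measurable M" using assms(2) L2_measurable[OF assms(1)] by measurable
qed (simp add: norm_mult assms(3) mult_right_mono)

lemma L2_add:
  assumes "f \<in> L2 M" "g \<in> L2 M"
  shows "(\<lambda>y. f y + g y) \<in> L2 M"
proof -
  note [measurable] = L2_measurable[OF assms(1)] L2_measurable[OF assms(2)]
  have "integrable M (\<lambda>y. (cmod (f y + g y))\<^sup>2)"
  proof (rule Bochner_Integration.integrable_bound)
    show "integrable M (\<lambda>y. 2 * (cmod (f y))\<^sup>2 + 2 * (cmod (g y))\<^sup>2)"
      using assms by (simp add: L2_def)
    have "(cmod (f y + g y))\<^sup>2 \<le> 2 * (cmod (f y))\<^sup>2 + 2 * (cmod (g y))\<^sup>2" for y
    proof -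
      have "(cmod (f y + g y))\<^sup>2 \<le> (cmod (f y) + cmod (g y))\<^sup>2"
        by (intro power_mono norm_triangle_ineq) auto
      also have "\<dots> \<le> 2 * (cmod (f y))\<^sup>2 + 2 * (cmod (g y))\<^sup>2"
        unfolding power2_sum using sum_squares_bound[of "cmod (f y)" "cmod (g y)"] by linarith
      finally show ?thesis .
    qed
    then show "AE y in M. norm ((cmod (f y + g y))\<^sup>2) \<le> norm (2 * (cmod (f y))\<^sup>2 + 2 * (cmod (g y))\<^sup>2)"
      by (intro AE_I2) simp
  qed measurable
  then show ?thesis by (simp add: L2_def)
qed

lemma L2_scale: "f \<in> L2 M \<Longrightarrow> (\<lambda>y. c * f y) \<in> L2 M"
  by (rule L2_mult_bounded[where B = "cmod c"]) auto

lemma L2_uminus: "f \<in> L2 M \<Longrightarrow> (\<lambda>y. - f y) \<in> L2 M"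
  using L2_scale[of f M "-1"] by simp

lemma L2_diff: "f \<in> L2 M \<Longrightarrow> g \<in> L2 M \<Longrightarrow> (\<lambda>y. f y - g y) \<in> L2 M"
  using L2_add[of f M "\<lambda>y. - g y"] L2_uminus[of g M] by simp

lemma borel_measurable_cnj [measurable]:
  "f \<in> borel_measurable M \<Longrightarrow> (\<lambda>y. cnj (f y)) \<in> borel_measurable M"
  by (rule measurable_compose[OF _ borel_measurable_continuous_onI]) (auto intro: continuous_intros)

lemma L2_cnj: "f \<in> L2 M \<Longrightarrow> (\<lambda>y. cnj (f y)) \<in> L2 M"
  by (rule L2_dominated[where B = 1]) (auto dest: L2_measurable)

lemma L2_zero: "(\<lambda>_. 0) \<in> L2 M"
  by (simp add: L2_def)

lemma L2_sum: "(\<And>i. i \<in> I \<Longrightarrow> f i \<in> L2 M) \<Longrightarrow> (\<lambda>y. \<Sum>i\<in>I. f i y) \<in> L2 M"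
  by (induction I rule: infinite_finite_induct) (auto intro: L2_add L2_zero)

lemma L2_bounded:
  assumes "finite_measure M" "f \<in> borel_measurable M" "\<And>y. y \<in> space M \<Longrightarrow> cmod (f y) \<le> B"
  shows "f \<in> L2 M"
proof -
  interpret finite_measure M by fact
  have "(\<lambda>_. 1) \<in> L2 M" by (simp add: L2_def)
  from L2_mult_bounded[OF this assms(2,3)] show ?thesis by simp
qed

lemma L2_mult_integrable:
  assumes "f \<in> L2 M" "g \<in> L2 M"
  shows "integrable M (\<lambda>y. f y * g y)"
proof (rule Bochner_Integration.integrable_bound)
  show "integrable M (\<lambda>y. (cmod (f y))\<^sup>2 + (cmod (g y))\<^sup>2)" using assms by (simp add: L2_def)
  show "(\<lambda>y. f y * g y) \<in> borel_measurable M"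
    using L2_measurable[OF assms(1)] L2_measurable[OF assms(2)] by measurable
  have "cmod (f y) * cmod (g y) \<le> (cmod (f y))\<^sup>2 + (cmod (g y))\<^sup>2" for y
  proof -
    have "0 \<le> cmod (f y) * cmod (g y)" by simp
    then show ?thesis using sum_squares_bound[of "cmod (f y)" "cmod (g y)"] by linarith
  qed
  then show "AE y in M. norm (f y * g y) \<le> norm ((cmod (f y))\<^sup>2 + (cmod (g y))\<^sup>2)"
    by (intro AE_I2) (simp add: norm_mult)
qed

lemma L2_ip_integrable: "f \<in> L2 M \<Longrightarrow> g \<in> L2 M \<Longrightarrow> integrable M (\<lambda>y. cnj (f y) * g y)"
  by (intro L2_mult_integrable L2_cnj)

lemma L2_integrable_finite:
  assumes "finite_measure M" "f \<in> L2 M"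
  shows "integrable M f"
proof -
  interpret finite_measure M by fact
  have "(\<lambda>_. 1) \<in> L2 M" by (simp add: L2_def)
  from L2_mult_integrable[OF assms(2) this] show ?thesis by simp
qed

locale l2_module =
  fixes M :: "'y measure" and ip :: "'m::banach \<Rightarrow> 'm \<Rightarrow> 'a::cstar_algebra"
    and act :: "'m \<Rightarrow> 'a \<Rightarrow> 'm" and emb :: "('y \<Rightarrow> complex) \<Rightarrow> 'a \<Rightarrow> 'm"
  assumes L2_module: "L2_module M ip act emb"

sublocale l2_module \<subseteq> hilbert_mod ip act
  using L2_module by unfold_locales (simp add: L2_module_def)

context l2_module
begin

lemma ip_emb: "f \<in> L2 M \<Longrightarrow> g \<in> L2 M \<Longrightarrow>
    ip (emb f a) (emb g b) = (\<integral>y. cnj (f y) * g y \<partial>M) *\<^sub>C (star a * b)"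
  and act_emb: "f \<in> L2 M \<Longrightarrow> act (emb f a) b = emb f (a * b)"
  and dense_emb: "closure (span {emb f a |f a. f \<in> L2 M}) = UNIV"
  using L2_module unfolding L2_module_def by auto

text \<open>\<open>L2_module\<close> does not say that \<open>emb\<close> is additive in the
  function or respects equality almost everywhere. All such rules below follow from the formula for
  inner products, because these determine a vector.\<close>

lemma eqI_emb:
  assumes "\<And>f a. f \<in> L2 M \<Longrightarrow> ip (emb f a) x = ip (emb f a) y"
  shows "x = y"
  using assms by (intro eqI_ip_dense[OF dense_emb]) auto

lemma bounded_linear_eq_on_emb:
  assumes "bounded_linear S" "bounded_linear T" "\<And>f a. f \<in> L2 M \<Longrightarrow> S (emb f a) = T (emb f a)"
  shows "S x = T x"
  by (rule bounded_linear_eq_on_dense[OF assms(1,2) dense_emb]) (use assms(3) in blast)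

lemma ampliation_eqI:
  assumes "bounded_linear T" "\<And>g a. g \<in> L2 M \<Longrightarrow> T (emb g a) = emb (t g) a"
  shows "ampliation M emb t = T"
  unfolding ampliation_def
proof (rule the_equality)
  fix T' assume "bounded_linear T' \<and> (\<forall>g\<in>L2 M. \<forall>a. T' (emb g a) = emb (t g) a)"
  then have T': "bounded_linear T'" "\<And>g a. g \<in> L2 M \<Longrightarrow> T' (emb g a) = T (emb g a)"
    using assms(2) by simp_all
  show "T' = T" by (rule ext) (rule bounded_linear_eq_on_emb[OF T'(1) assms(1) T'(2)])
qed (use assms in auto)

lemma emb_AE_cong:
  assumes "f \<in> L2 M" "g \<in> L2 M" "AE y in M. f y = g y"
  shows "emb f a = emb g a"
proof (rule eqI_emb)
  fix h b assume h: "h \<in> L2 M"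
  note [measurable] = L2_measurable[OF assms(1)] L2_measurable[OF assms(2)] L2_measurable[OF h]
  have "(\<integral>y. cnj (h y) * f y \<partial>M) = (\<integral>y. cnj (h y) * g y \<partial>M)"
    by (rule integral_cong_AE) (use assms(3) in auto)
  then show "ip (emb h b) (emb f a) = ip (emb h b) (emb g a)" using h assms by (simp add: ip_emb)
qed

lemma emb_cong:
  assumes "f \<in> L2 M" "g \<in> L2 M" "\<And>y. y \<in> space M \<Longrightarrow> f y = g y"
  shows "emb f a = emb g a"
  using assms by (intro emb_AE_cong) auto

lemma emb_add:
  assumes "f \<in> L2 M" "g \<in> L2 M"
  shows "emb (\<lambda>y. f y + g y) a = emb f a + emb g a"
  by (rule eqI_emb) (simp add: assms ip_emb L2_add ip_add_right distrib_left L2_ip_integrable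
      scaleC_add_left)

lemma emb_scale:
  assumes "f \<in> L2 M"
  shows "emb (\<lambda>y. c * f y) a = emb f (c *\<^sub>C a)"
  by (rule eqI_emb) (simp add: assms ip_emb L2_scale mult.left_commute scaleC_scaleC
      mult_scaleC_right mult.commute)

lemma emb_scale_scC: "f \<in> L2 M \<Longrightarrow> emb (\<lambda>y. c * f y) a = scC c (emb f a)"
  by (simp add: emb_scale scC_def act_emb mult_scaleC_right)

lemma emb_diff:
  assumes "f \<in> L2 M" "g \<in> L2 M"
  shows "emb (\<lambda>y. f y - g y) a = emb f a - emb g a"
  by (rule eqI_emb) (simp add: assms ip_emb L2_diff ip_diff_right right_diff_distrib
      L2_ip_integrable scaleC_diff_left)

lemma emb_zero: "emb (\<lambda>_. 0) a = 0"
  using emb_diff[OF L2_zero L2_zero, of a] by simp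

lemma emb_sum:
  "(\<And>i. i \<in> I \<Longrightarrow> f i \<in> L2 M) \<Longrightarrow> emb (\<lambda>y. \<Sum>i\<in>I. f i y) a = (\<Sum>i\<in>I. emb (f i) a)"
  by (induction I rule: infinite_finite_induct) (auto simp: emb_zero emb_add L2_sum)

lemma norm_emb:
  assumes "f \<in> L2 M"
  shows "norm (emb f a) = sqrt (\<integral>y. (cmod (f y))\<^sup>2 \<partial>M) * norm a"
proof -
  have "(\<integral>y. cnj (f y) * f y \<partial>M) = (\<integral>y. of_real ((cmod (f y))\<^sup>2) \<partial>M)"
    by (intro Bochner_Integration.integral_cong refl) (metis complex_norm_square mult.commute)
  also have "\<dots> = of_real (\<integral>y. (cmod (f y))\<^sup>2 \<partial>M)" by (rule integral_complex_of_real)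
  finally show ?thesis
    by (subst norm_ip) (simp add: ip_emb assms norm_scaleC norm_star_mult real_sqrt_mult)
qed

text \<open>Dominated convergence for the L2 norm, which by \<open>norm_emb\<close> is the module
  norm up to the factor \<open>norm a\<close>. The 4 in the majorant is the square of the 2 in |f n
  - g| <= 2 |w|.\<close>

lemma emb_tendsto:
  assumes "\<And>n. f n \<in> borel_measurable M" "g \<in> borel_measurable M" "w \<in> L2 M"
    and "\<And>y. y \<in> space M \<Longrightarrow> (\<lambda>n. f n y) \<longlonglongrightarrow> g y"
    and bd: "\<And>n y. y \<in> space M \<Longrightarrow> cmod (f n y) \<le> cmod (w y)"
  shows "(\<lambda>n. emb (f n) a) \<longlonglongrightarrow> emb g a"
proof -
  have g: "cmod (g y) \<le> cmod (w y)" if "y \<in> space M" for y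
    by (rule tendsto_upperbound[OF tendsto_norm[OF assms(4)[OF that]]]) (auto simp: bd that)
  have fL: "f n \<in> L2 M" for n by (rule L2_dominated[OF assms(1,3), where B = 1]) (simp add: bd)
  have gL: "g \<in> L2 M" by (rule L2_dominated[OF assms(2,3), where B = 1]) (simp add: g)
  note [measurable] = L2_measurable[OF fL] L2_measurable[OF gL]
  have "(\<lambda>n. \<integral>y. (cmod (f n y - g y))\<^sup>2 \<partial>M) \<longlonglongrightarrow> (\<integral>y. 0 \<partial>M)"
  proof (rule integral_dominated_convergence)
    show "integrable M (\<lambda>y. 4 * (cmod (w y))\<^sup>2)" using assms(3) by (simp add: L2_def)
    show "AE y in M. (\<lambda>n. (cmod (f n y - g y))\<^sup>2) \<longlonglongrightarrow> 0"
    proof (rule AE_I2)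
      fix y assume "y \<in> space M"
      then have "(\<lambda>n. (cmod (f n y - g y))\<^sup>2) \<longlonglongrightarrow> (cmod (g y - g y))\<^sup>2"
        by (intro tendsto_intros assms(4))
      then show "(\<lambda>n. (cmod (f n y - g y))\<^sup>2) \<longlonglongrightarrow> 0" by simp
    qed
    show "AE y in M. norm ((cmod (f n y - g y))\<^sup>2) \<le> 4 * (cmod (w y))\<^sup>2" for n
    proof (rule AE_I2)
      fix y assume y: "y \<in> space M"
      have "cmod (f n y - g y) \<le> 2 * cmod (w y)"
        using norm_triangle_ineq4[of "f n y" "g y"] bd[OF y, of n] g[OF y] by linarith
      from power_mono[OF this, of 2] show "norm ((cmod (f n y - g y))\<^sup>2) \<le> 4 * (cmod (w y))\<^sup>2"
        by (simp add: power_mult_distrib)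
    qed
  qed measurable
  then have "(\<lambda>n. sqrt (\<integral>y. (cmod (f n y - g y))\<^sup>2 \<partial>M) * norm a) \<longlonglongrightarrow> sqrt 0 * norm a"
    by (intro tendsto_intros) simp
  moreover have "norm (emb (f n) a - emb g a) = sqrt (\<integral>y. (cmod (f n y - g y))\<^sup>2 \<partial>M) * norm a" for n
    using norm_emb[OF L2_diff[OF fL gL], of n a] emb_diff[OF fL gL] by simp
  ultimately have "(\<lambda>n. norm (emb (f n) a - emb g a)) \<longlonglongrightarrow> 0" by simp
  then show ?thesis by (simp add: tendsto_norm_zero_iff LIM_zero_iff)
qed

text \<open>A Dynkin argument carries the generator \<open>G\<close> to all measurable sets
  (complements are taken inside \<open>space M\<close>, hence its membership in \<open>G\<close>);
  simple functions and dominated convergence then reach all of L2. As \<open>C\<close> is only a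
  real subspace, complex coefficients are moved into the algebra factor, which is why
  \<open>ind\<close> ranges over all \<open>a\<close>.\<close>

lemma emb_in_closed_subspace:
  assumes fin: "finite_measure M" and C: "subspace C" "closed C"
    and G: "Int_stable G" "G \<subseteq> Pow (space M)" "sets M = sigma_sets (space M) G" "space M \<in> G"
    and ind: "\<And>A a. A \<in> G \<Longrightarrow> emb (indicator A) a \<in> C"
    and f: "f \<in> L2 M"
  shows "emb f a \<in> C"
proof -
  interpret finite_measure M by fact
  have indL: "(\<lambda>y. indicator A y) \<in> L2 M" if "A \<in> sets M" for A
    using that by (intro L2_bounded[OF fin, where B = 1]) (auto simp: indicator_def)
  have lim: "x \<in> C" if "s \<longlonglongrightarrow> x" "\<And>n. s n \<in> C" for s x
    using closed_sequentially[OF C(2) that(2,1)] .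
  have sets: "emb (indicator A) a \<in> C" if "A \<in> sets M" for A a
  proof -
    from that have "A \<in> sigma_sets (space M) G" using G by simp
    with G(1,2) show ?thesis
    proof (induction rule: sigma_sets_induct_disjoint)
      case (basic A)
      then show ?case by (rule ind)
    next
      case empty
      then show ?case using emb_zero[of a] subspace_0[OF C(1)] by (simp add: indicator_def[abs_def])
    next
      case (compl A)
      then have "A \<in> sets M" using G by simp
      have "emb (indicator (space M - A)) a
          = emb (\<lambda>y. indicator (space M) y - indicator A y) a"
        using \<open>A \<in> sets M\<close> by (intro emb_cong L2_diff indL) (auto simp: indicator_def)
      also have "\<dots> = emb (indicator (space M)) a - emb (indicator A) a"
        using \<open>A \<in> sets M\<close> by (intro emb_diff indL) auto
      finally show ?case using compl ind[OF G(4)] subspace_diff[OF C(1)] by auto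
    next
      case (union A)
      then have A: "A i \<in> sets M" for i using G by auto
      have "(\<lambda>n. emb (\<lambda>y. \<Sum>i<n. indicator (A i) y) a) \<longlonglongrightarrow> emb (indicator (\<Union>i. A i)) a"
      proof (rule emb_tendsto[where w = "\<lambda>_. 1"])
        show "(\<lambda>y. \<Sum>i<n. indicator (A i) y :: complex) \<in> borel_measurable M" for n
          by (intro borel_measurable_sum borel_measurable_indicator A)
        \<comment> \<open>By disjointness the partial sums are indicators of finite unions, so 1 is
          a majorant.\<close>
        have eq: "(\<lambda>n. \<Sum>i<n. indicator (A i) y)
            = (\<lambda>n. (indicator (\<Union>i<n. A i) y :: complex))" for y
          using union(1) by (intro ext indicator_UN_disjoint[symmetric])
            (auto intro: disjoint_family_on_mono)
        show "(\<lambda>n. \<Sum>i<n. indicator (A i) y) \<longlonglongrightarrow> (indicator (\<Union>i. A i) y :: complex)" for y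
          unfolding eq by (rule LIMSEQ_indicator_UN)
        show "cmod (\<Sum>i<n. indicator (A i) y) \<le> cmod 1" for n y
          using fun_cong[OF eq[of y], of n] by (simp add: indicator_def)
        show "(\<lambda>_. 1) \<in> L2 M" by (simp add: L2_def)
      qed (use A in auto)
      moreover have "emb (\<lambda>y. \<Sum>i<n. indicator (A i) y) a \<in> C" for n
        using emb_sum[of "{..<n}" "\<lambda>i. indicator (A i)" a] indL A union
        by (auto intro!: subspace_sum[OF C(1)])
      ultimately show ?case by (rule lim)
    qed
  qed
  note [measurable] = L2_measurable[OF f]
  obtain s where s: "\<And>i. simple_function M (s i)"
    "\<And>y. y \<in> space M \<Longrightarrow> (\<lambda>i. s i y) \<longlonglongrightarrow> f y"
    "\<And>i y. y \<in> space M \<Longrightarrow> dist (s i y) 0 \<le> 2 * dist (f y) 0"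
    using borel_measurable_implies_sequence_metric[OF L2_measurable[OF f], of 0] by blast
  have "(\<lambda>n. emb (s n) a) \<longlonglongrightarrow> emb f a"
    by (rule emb_tendsto[where w = "\<lambda>y. 2 * f y"])
      (use s f in \<open>auto intro: L2_scale borel_measurable_simple_function simp: norm_mult\<close>)
  moreover have "emb (s n) a \<in> C" for n
  proof -
    have fin: "finite (s n ` space M)" using s(1) by (simp add: simple_function_def)
    have m: "s n -` {c} \<inter> space M \<in> sets M" for c using s(1)[of n] by (rule simple_functionD)
    have "s n \<in> L2 M"
      using s f by (intro L2_dominated[OF _ f, where B = 2]) (auto intro: borel_measurable_simple_function)
    then have "emb (s n) a
        = emb (\<lambda>y. \<Sum>c\<in>s n ` space M. c * indicator (s n -` {c} \<inter> space M) y) a"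
    proof (intro emb_cong L2_sum L2_scale indL m)
      fix y assume "y \<in> space M"
      then show "s n y = (\<Sum>c\<in>s n ` space M. c * indicator (s n -` {c} \<inter> space M) y)"
        by (subst simple_function_indicator_representation_banach[OF s(1)[of n]])
          (auto simp: indicator_def intro!: sum.cong)
    qed
    also have "\<dots> = (\<Sum>c\<in>s n ` space M. emb (indicator (s n -` {c} \<inter> space M)) (c *\<^sub>C a))"
      using m by (subst emb_sum) (auto intro!: L2_scale indL sum.cong emb_scale)
    also have "\<dots> \<in> C" by (intro subspace_sum[OF C(1)] sets m)
    finally show ?thesis .
  qed
  ultimately show ?thesis by (rule lim)
qed

end

text \<open>Scaling inner products by \<open>c\<close> scales norms by exactly \<open>sqrt c\<close>
  on the whole span, so the graph criterion applies without any estimate. The factor is 1 for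
  unimodular multiplications and for legs of isometries, and the squared norm of \<open>h\<close>
  for the insertion of \<open>h\<close>.\<close>

lemma isometric_extension:
  fixes S :: "('m::banach \<times> 'n::banach) set"
    and ip :: "'m \<Rightarrow> 'm \<Rightarrow> 'a::cstar_algebra" and ip' :: "'n \<Rightarrow> 'n \<Rightarrow> 'a"
  assumes "hilbert_module ip act" "hilbert_module ip' act'"
    and dense: "closure (span (fst ` S)) = UNIV"
    and iso: "\<And>x y x' y'. (x, y) \<in> S \<Longrightarrow> (x', y') \<in> S \<Longrightarrow> ip' y y' = c *\<^sub>R ip x x'"
    and c: "0 \<le> c"
  shows "\<exists>T. bounded_linear T \<and> (\<forall>x y. (x, y) \<in> S \<longrightarrow> T x = y) \<and>
    (\<forall>x x'. ip' (T x) (T x') = c *\<^sub>R ip x x') \<and> (\<forall>x. norm (T x) = sqrt c * norm x)"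
proof -
  interpret A: hilbert_mod ip act by unfold_locales fact
  interpret B: hilbert_mod ip' act' by unfold_locales fact
  have iso1: "ip' (snd p) (snd q) = c *\<^sub>R ip (fst p) (fst q)" if "p \<in> span S" "q \<in> S" for p q
    using that(1)
  proof (induction rule: span_induct_alt)
    case base
    then show ?case by (simp add: A.ip_zero_left B.ip_zero_left)
  next
    case (step r x y)
    have "ip' (snd x) (snd q) = c *\<^sub>R ip (fst x) (fst q)"
      using iso[of "fst x" "snd x" "fst q" "snd q"] step(1) that(2) by simp
    with step(2) show ?case
      by (simp add: A.ip_add_left B.ip_add_left A.ip_scaleR_left B.ip_scaleR_left scaleR_add_right)
  qed
  have iso2: "ip' (snd p) (snd q) = c *\<^sub>R ip (fst p) (fst q)" if "p \<in> span S" "q \<in> span S" for p q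
    using that(2)
  proof (induction rule: span_induct_alt)
    case base
    then show ?case by (simp add: A.ip_zero_right B.ip_zero_right)
  next
    case (step r x y)
    with iso1[OF that(1) step(1)] show ?case
      by (simp add: A.ip_add_right B.ip_add_right A.ip_scaleR_right B.ip_scaleR_right scaleR_add_right)
  qed
  have nrm: "norm y = sqrt c * norm x" if "ip' y y = c *\<^sub>R ip x x" for x y
    using that c by (simp add: A.norm_ip[of x] B.norm_ip[of y] real_sqrt_mult)
  have bd: "norm (snd p) \<le> sqrt c * norm (fst p)" if "p \<in> span S" for p
    using nrm[OF iso2[OF that that]] by simp
  have "0 \<le> sqrt c" using c by simp
  from graph_extension[OF dense bd this]
  obtain T where T: "bounded_linear T" "\<And>x y. (x, y) \<in> S \<Longrightarrow> T x = y" by blast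
  interpret T: bounded_linear T by fact
  have "ip' (T x) (T x') = c *\<^sub>R ip x x'" if "x' \<in> fst ` S" for x x'
  proof (rule bounded_linear_eq_on_dense[where S = "\<lambda>x. ip' (T x) (T x')"
        and T = "\<lambda>x. c *\<^sub>R ip x x'", OF _ _ dense])
    show "bounded_linear (\<lambda>x. ip' (T x) (T x'))"
      by (rule bounded_linear_compose[OF B.bounded_linear_ip_left T(1)])
    show "bounded_linear (\<lambda>x. c *\<^sub>R ip x x')"
      by (rule bounded_linear_compose[OF bounded_linear_scaleR_right A.bounded_linear_ip_left])
    show "ip' (T x) (T x') = c *\<^sub>R ip x x'" if "x \<in> fst ` S" for x
      using that \<open>x' \<in> fst ` S\<close> by (auto simp: T(2) intro: iso)
  qed
  then have "ip' (T x) (T x') = c *\<^sub>R ip x x'" for x x'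
    by (rule bounded_linear_eq_on_dense[where S = "\<lambda>x'. ip' (T x) (T x')"
          and T = "\<lambda>x'. c *\<^sub>R ip x x'", OF
          bounded_linear_compose[OF B.bounded_linear_ip_right T(1)]
          bounded_linear_compose[OF bounded_linear_scaleR_right A.bounded_linear_ip_right] dense])
  with T nrm show ?thesis by (intro exI[of _ T]) blast
qed

lemma (in hilbert_mod) act_one: "act x 1 = x"
  using act_scaleR_one[of x 1] by simp

lemma (in hilbert_mod) bounded_linear_act: "bounded_linear (\<lambda>x. act x a)"
proof (rule bounded_linear_intro[where K = "norm a"])
  fix x
  have "(norm (act x a))\<^sup>2 = norm (star a * ip x x * a)"
    by (simp add: ip_act_left ip_act_right mult.assoc flip: norm_ip_self)
  also have "\<dots> \<le> norm (star a) * norm (ip x x) * norm a"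
    by (meson mult_right_mono norm_ge_zero norm_mult_ineq order_trans)
  also have "\<dots> = (norm x * norm a)\<^sup>2"
    by (simp add: norm_star norm_ip_self power2_eq_square)
  finally show "norm (act x a) \<le> norm x * norm a"
    by (rule power2_le_imp_le) simp
qed (auto simp: act_add_left act_scaleR)

section \<open>Multiplication operators\<close>

text \<open>Boundedness is required at every point rather than essentially, so no null sets have to
  be tracked; constants and continuous functions on a compact space satisfy it.\<close>

definition Linf :: "'y measure \<Rightarrow> ('y \<Rightarrow> complex) set" where
  "Linf M = {f \<in> borel_measurable M. \<exists>B. \<forall>y. cmod (f y) \<le> B}"

lemma LinfI: "f \<in> borel_measurable M \<Longrightarrow> (\<And>y. cmod (f y) \<le> B) \<Longrightarrow> f \<in> Linf M"
  by (auto simp: Linf_def)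

lemma LinfE:
  assumes "f \<in> Linf M"
  obtains B where "f \<in> borel_measurable M" "0 < B" "\<And>y. cmod (f y) \<le> B"
proof -
  from assms obtain B where "f \<in> borel_measurable M" "\<And>y. cmod (f y) \<le> B"
    unfolding Linf_def by blast
  then show ?thesis using that[of "max B 1"] by (simp add: le_max_iff_disj)
qed

lemma Linf_mult_L2: "f \<in> Linf M \<Longrightarrow> g \<in> L2 M \<Longrightarrow> (\<lambda>y. f y * g y) \<in> L2 M"
  by (erule LinfE) (rule L2_mult_bounded)

lemma Linf_cnj: "f \<in> Linf M \<Longrightarrow> (\<lambda>y. cnj (f y)) \<in> Linf M"
  by (erule LinfE) (rule LinfI, auto)

lemma Linf_mult:
  assumes "f \<in> Linf M" "g \<in> Linf M"
  shows "(\<lambda>y. f y * g y) \<in> Linf M"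
proof -
  obtain B where B: "f \<in> borel_measurable M" "0 < B" "\<And>y. cmod (f y) \<le> B" using LinfE[OF assms(1)] by blast
  obtain C where C: "g \<in> borel_measurable M" "0 < C" "\<And>y. cmod (g y) \<le> C" using LinfE[OF assms(2)] by blast
  show ?thesis
    by (rule LinfI[where B = "B * C"]) (use B C in \<open>auto simp: norm_mult intro: mult_mono less_imp_le\<close>)
qed

lemma Linf_add:
  assumes "f \<in> Linf M" "g \<in> Linf M"
  shows "(\<lambda>y. f y + g y) \<in> Linf M"
proof -
  obtain B where B: "f \<in> borel_measurable M" "0 < B" "\<And>y. cmod (f y) \<le> B" using LinfE[OF assms(1)] by blast
  obtain C where C: "g \<in> borel_measurable M" "0 < C" "\<And>y. cmod (g y) \<le> C" using LinfE[OF assms(2)] by blast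
  show ?thesis
    by (rule LinfI[where B = "B + C"]) (use B C in \<open>auto intro!: norm_triangle_le add_mono\<close>)
qed

lemma Linf_const: "(\<lambda>_. c) \<in> Linf M"
  by (rule LinfI[where B = "cmod c"]) auto

lemma Linf_L2: "finite_measure M \<Longrightarrow> f \<in> Linf M \<Longrightarrow> f \<in> L2 M"
  by (erule LinfE) (rule L2_bounded)

context l2_module
begin

abbreviation mop :: "('y \<Rightarrow> complex) \<Rightarrow> 'm \<Rightarrow> 'm" where
  "mop f \<equiv> ampliation M emb (multiplication_operator f)"

text \<open>The factor \<open>cnj (u y) * u y\<close> is 1 and disappears from all inner products,
  so multiplication by \<open>u\<close> extends isometrically. For a general bounded function a
  direct estimate would compare \<open>ip (f x) (f x)\<close> with a multiple of
  \<open>ip x x\<close> in the order of the algebra.\<close>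

lemma unimodular_mop_exists:
  assumes "u \<in> borel_measurable M" "\<And>y. cmod (u y) = 1"
  shows "\<exists>T. bounded_linear T \<and> (\<forall>g\<in>L2 M. \<forall>a. T (emb g a) = emb (\<lambda>y. u y * g y) a) \<and>
    (\<forall>x. norm (T x) = norm x)"
proof -
  have u: "u \<in> Linf M" using assms by (intro LinfI[where B = 1]) auto
  have uu: "cnj (u y) * u y = 1" for y
    using complex_norm_square[of "u y"] assms(2)[of y] by (simp add: mult.commute)
  define S where "S = {(emb g a, emb (\<lambda>y. u y * g y) a) |g a. g \<in> L2 M}"
  have fst: "fst ` S = {emb g a |g a. g \<in> L2 M}" unfolding S_def by force
  have iso: "ip y y' = 1 *\<^sub>R ip x x'" if xy: "(x, y) \<in> S" "(x', y') \<in> S" for x y x' y'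
  proof -
    from xy obtain g a g' a' where g: "g \<in> L2 M" "g' \<in> L2 M"
      and x: "x = emb g a" "y = emb (\<lambda>y. u y * g y) a" "x' = emb g' a'" "y' = emb (\<lambda>y. u y * g' y) a'"
      unfolding S_def by blast
    have *: "cnj (u y) * cnj (g y) * (u y * g' y) = cnj (g y) * g' y" for y
      using uu[of y] by (metis mult.assoc mult.commute mult_1_right)
    show ?thesis using g u by (simp add: x ip_emb Linf_mult_L2 *)
  qed
  from isometric_extension[OF hilbert_module hilbert_module dense_emb[folded fst] iso zero_le_one]
  obtain T where "bounded_linear T" "\<And>x y. (x, y) \<in> S \<Longrightarrow> T x = y"
    "\<And>x. norm (T x) = sqrt 1 * norm x" by blast
  then show ?thesis unfolding S_def by (intro exI[of _ T]) auto
qed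

text \<open>A real function with values in \<open>[-1, 1]\<close> is the mean of the unimodular functions
  \<open>f \<plusminus> \<i> sqrt (1 - f\<^sup>2)\<close>.\<close>

lemma real_mop_exists:
  fixes f :: "'y \<Rightarrow> real"
  assumes [measurable]: "f \<in> borel_measurable M" and f: "\<And>y. \<bar>f y\<bar> \<le> 1"
  shows "\<exists>T. bounded_linear T \<and> (\<forall>g\<in>L2 M. \<forall>a. T (emb g a) = emb (\<lambda>y. of_real (f y) * g y) a) \<and>
    (\<forall>x. norm (T x) \<le> norm x)"
proof -
  define u where "u s y = Complex (f y) (s * sqrt (1 - (f y)\<^sup>2))" for s y
  have u_eq: "u s = (\<lambda>y. of_real (f y) + \<i> * of_real (s * sqrt (1 - (f y)\<^sup>2)))" for s
    by (simp add: u_def Complex_eq fun_eq_iff)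
  have meas: "u s \<in> borel_measurable M" for s unfolding u_eq by measurable
  have nrm: "cmod (u s y) = 1" if "s\<^sup>2 = 1" for s y
    using f[of y] that by (simp add: u_def cmod_def power_mult_distrib abs_square_le_1)
  obtain T1 where T1: "bounded_linear T1" "\<And>g a. g \<in> L2 M \<Longrightarrow> T1 (emb g a) = emb (\<lambda>y. u 1 y * g y) a"
    "\<And>x. norm (T1 x) = norm x"
    using unimodular_mop_exists[OF meas nrm, of 1] by auto
  obtain T2 where T2: "bounded_linear T2" "\<And>g a. g \<in> L2 M \<Longrightarrow> T2 (emb g a) = emb (\<lambda>y. u (-1) y * g y) a"
    "\<And>x. norm (T2 x) = norm x"
    using unimodular_mop_exists[OF meas nrm, of "-1"] by auto
  have uL: "u s \<in> Linf M" if "s\<^sup>2 = 1" for s using meas nrm[OF that] by (intro LinfI[where B = 1]) auto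
  have *: "(\<lambda>y. of_real (f y) * g y) = (\<lambda>y. of_real (1/2) * (u 1 y * g y + u (-1) y * g y))" for g
    by (auto simp: u_eq fun_eq_iff algebra_simps)
  show ?thesis
  proof (intro exI[of _ "\<lambda>x. (1/2) *\<^sub>R (T1 x + T2 x)"] conjI ballI allI)
    show "bounded_linear (\<lambda>x. (1/2) *\<^sub>R (T1 x + T2 x))"
      by (intro bounded_linear_compose[OF bounded_linear_scaleR_right] bounded_linear_add T1 T2)
    show "(1/2) *\<^sub>R (T1 (emb g a) + T2 (emb g a)) = emb (\<lambda>y. of_real (f y) * g y) a" if "g \<in> L2 M" for g a
    proof -
      have m: "(\<lambda>y. u 1 y * g y) \<in> L2 M" "(\<lambda>y. u (-1) y * g y) \<in> L2 M"
        using that by (auto intro!: Linf_mult_L2 uL)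
      have "emb (\<lambda>y. of_real (f y) * g y) a
          = scC (of_real (1/2)) (emb (\<lambda>y. u 1 y * g y) a + emb (\<lambda>y. u (-1) y * g y) a)"
        unfolding * by (simp only: emb_scale_scC[OF L2_add[OF m]] emb_add[OF m])
      also have "\<dots> = (1/2) *\<^sub>R (T1 (emb g a) + T2 (emb g a))"
        unfolding scC_def scaleC_of_real act_scaleR_one T1(2)[OF that] T2(2)[OF that] ..
      finally show ?thesis by simp
    qed
    show "norm ((1/2) *\<^sub>R (T1 x + T2 x)) \<le> norm x" for x
      using norm_triangle_ineq[of "T1 x" "T2 x"] by (simp add: T1 T2)
  qed
qed

text \<open>Real and imaginary part, divided by \<open>B\<close>, take values in [-1, 1] and act as
  contractions; adding the two parts costs the factor 2 in \<open>2 * B\<close>.\<close>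

lemma mop_exists:
  assumes [measurable]: "f \<in> borel_measurable M" and B: "0 < B" and f: "\<And>y. cmod (f y) \<le> B"
  shows "\<exists>T. bounded_linear T \<and> (\<forall>g\<in>L2 M. \<forall>a. T (emb g a) = emb (\<lambda>y. f y * g y) a) \<and>
    (\<forall>x. norm (T x) \<le> 2 * B * norm x)"
proof -
  have re: "\<bar>Re (f y) / B\<bar> \<le> 1" for y
    using abs_Re_le_cmod[of "f y"] f[of y] B by (simp add: field_simps)
  have im: "\<bar>Im (f y) / B\<bar> \<le> 1" for y
    using abs_Im_le_cmod[of "f y"] f[of y] B by (simp add: field_simps)
  obtain T1 where T1: "bounded_linear T1"
    "\<And>g a. g \<in> L2 M \<Longrightarrow> T1 (emb g a) = emb (\<lambda>y. of_real (Re (f y) / B) * g y) a"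
    "\<And>x. norm (T1 x) \<le> norm x"
    using real_mop_exists[where f = "\<lambda>y. Re (f y) / B", OF _ re] by auto
  obtain T2 where T2: "bounded_linear T2"
    "\<And>g a. g \<in> L2 M \<Longrightarrow> T2 (emb g a) = emb (\<lambda>y. of_real (Im (f y) / B) * g y) a"
    "\<And>x. norm (T2 x) \<le> norm x"
    using real_mop_exists[where f = "\<lambda>y. Im (f y) / B", OF _ im] by auto
  have *: "(\<lambda>y. f y * g y) = (\<lambda>y. of_real B * (of_real (Re (f y) / B) * g y)
      + (of_real B * \<i>) * (of_real (Im (f y) / B) * g y))" for g
  proof
    fix y
    have "f y * g y = (of_real (Re (f y)) + \<i> * of_real (Im (f y))) * g y"
      by (simp flip: complex_eq)
    also have "\<dots> = of_real B * (of_real (Re (f y) / B) * g y)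
      + (of_real B * \<i>) * (of_real (Im (f y) / B) * g y)"
      using B by (simp add: field_simps)
    finally show "f y * g y = \<dots>" .
  qed
  show ?thesis
  proof (intro exI[of _ "\<lambda>x. scC (of_real B) (T1 x) + scC (of_real B * \<i>) (T2 x)"] conjI ballI allI)
    show "bounded_linear (\<lambda>x. scC (of_real B) (T1 x) + scC (of_real B * \<i>) (T2 x))"
      by (intro bounded_linear_compose[OF bounded_linear_scC] bounded_linear_add T1 T2)
    show "scC (of_real B) (T1 (emb g a)) + scC (of_real B * \<i>) (T2 (emb g a)) = emb (\<lambda>y. f y * g y) a"
      if g: "g \<in> L2 M" for g a
    proof -
      have m: "(\<lambda>y. of_real (Re (f y) / B) * g y) \<in> L2 M" "(\<lambda>y. of_real (Im (f y) / B) * g y) \<in> L2 M"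
        by (rule L2_mult_bounded[OF g, where B = 1], measurable, use re im in \<open>simp only: norm_of_real\<close>)+
      show ?thesis
        unfolding * emb_add[OF L2_scale[OF m(1)] L2_scale[OF m(2)]] emb_scale_scC[OF m(1)]
          emb_scale_scC[OF m(2)] T1(2)[OF g] T2(2)[OF g] ..
    qed
    show "norm (scC (of_real B) (T1 x) + scC (of_real B * \<i>) (T2 x)) \<le> 2 * B * norm x" for x
    proof -
      have "norm (scC (of_real B) (T1 x) + scC (of_real B * \<i>) (T2 x)) \<le> B * norm (T1 x) + B * norm (T2 x)"
        using norm_triangle_ineq[of "scC (of_real B) (T1 x)" "scC (of_real B * \<i>) (T2 x)"] B
        by (simp add: norm_scC norm_mult)
      also have "\<dots> \<le> B * norm x + B * norm x"
        using B by (intro add_mono mult_left_mono T1 T2) auto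
      finally show ?thesis by simp
    qed
  qed
qed

lemma mop_norm:
  assumes "f \<in> borel_measurable M" "0 < B" "\<And>y. cmod (f y) \<le> B"
  shows "bounded_linear (mop f)" "g \<in> L2 M \<Longrightarrow> mop f (emb g a) = emb (\<lambda>y. f y * g y) a"
    "norm (mop f x) \<le> 2 * B * norm x"
proof -
  obtain T where T: "bounded_linear T" "\<And>g a. g \<in> L2 M \<Longrightarrow> T (emb g a) = emb (\<lambda>y. f y * g y) a"
    "\<And>x. norm (T x) \<le> 2 * B * norm x" using mop_exists[OF assms] by blast
  have "mop f = T"
    using T by (intro ampliation_eqI) (simp_all add: multiplication_operator_def)
  with T show "bounded_linear (mop f)" "g \<in> L2 M \<Longrightarrow> mop f (emb g a) = emb (\<lambda>y. f y * g y) a"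
    "norm (mop f x) \<le> 2 * B * norm x" by auto
qed

lemma bounded_linear_mop: "f \<in> Linf M \<Longrightarrow> bounded_linear (mop f)"
  and mop_emb: "f \<in> Linf M \<Longrightarrow> g \<in> L2 M \<Longrightarrow> mop f (emb g a) = emb (\<lambda>y. f y * g y) a"
  by (auto elim!: LinfE intro: mop_norm)

lemma mop_mult:
  assumes "f \<in> Linf M" "g \<in> Linf M"
  shows "mop f (mop g x) = mop (\<lambda>y. f y * g y) x"
  by (rule bounded_linear_eq_on_emb[OF bounded_linear_compose[OF bounded_linear_mop[OF assms(1)]
        bounded_linear_mop[OF assms(2)]] bounded_linear_mop[OF Linf_mult[OF assms]]])
    (simp add: assms mop_emb Linf_mult Linf_mult_L2 mult.assoc)

lemma mop_add:
  assumes "f \<in> Linf M" "g \<in> Linf M"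
  shows "mop (\<lambda>y. f y + g y) x = mop f x + mop g x"
  by (rule bounded_linear_eq_on_emb[OF bounded_linear_mop[OF Linf_add[OF assms]]
        bounded_linear_add[OF bounded_linear_mop[OF assms(1)] bounded_linear_mop[OF assms(2)]]])
    (simp add: assms mop_emb Linf_add Linf_mult_L2 emb_add distrib_right)

lemma mop_const: "mop (\<lambda>_. c) x = scC c x"
  by (rule bounded_linear_eq_on_emb[OF bounded_linear_mop[OF Linf_const] bounded_linear_scC])
    (simp add: mop_emb Linf_const emb_scale_scC)

lemma mop_act:
  assumes "f \<in> Linf M"
  shows "mop f (act x a) = act (mop f x) a"
  by (rule bounded_linear_eq_on_emb[OF bounded_linear_compose[OF bounded_linear_mop[OF assms]
        bounded_linear_act] bounded_linear_compose[OF bounded_linear_act bounded_linear_mop[OF assms]]])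
    (simp add: assms act_emb mop_emb Linf_mult_L2)

lemma ip_mop:
  assumes f: "f \<in> Linf M"
  shows "ip (mop f x) y = ip x (mop (\<lambda>y. cnj (f y)) y)"
proof -
  have *: "ip (mop f (emb g a)) y = ip (emb g a) (mop (\<lambda>y. cnj (f y)) y)" if g: "g \<in> L2 M" for g a
    by (rule bounded_linear_eq_on_emb[OF bounded_linear_ip_right[of "mop f (emb g a)"]
          bounded_linear_compose[OF bounded_linear_ip_right bounded_linear_mop[OF Linf_cnj[OF f]]]])
      (simp add: f g Linf_cnj mop_emb Linf_mult_L2 ip_emb mult.assoc mult.left_commute)
  show ?thesis
    by (rule bounded_linear_eq_on_emb[OF bounded_linear_compose[OF bounded_linear_ip_left
            bounded_linear_mop[OF f]] bounded_linear_ip_left]) (rule *)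
qed

end

section \<open>Density of the continuous functions\<close>

lemma bcontfun_bound: "cmod (apply_bcontfun f x) \<le> norm f"
  by (rule norm_bounded)

lemma bcontfun_Linf:
  fixes M :: "'x::metric_space measure"
  assumes "sets M = sets borel"
  shows "apply_bcontfun f \<in> Linf M"
proof (rule LinfI[OF _ bcontfun_bound])
  have "apply_bcontfun f \<in> borel_measurable borel"
    by (intro borel_measurable_continuous_onI continuous_on_apply_bcontfun continuous_on_id)
  then show "apply_bcontfun f \<in> borel_measurable M" using measurable_cong_sets[OF assms refl] by blast
qed

lemma compact_bcontfun:
  fixes g :: "'x::metric_space \<Rightarrow> complex"
  assumes "compact (UNIV :: 'x set)" "continuous_on UNIV g"
  obtains h where "apply_bcontfun h = g"
proof -
  have "g \<in> bcontfun"
    unfolding bcontfun_def using assms compact_continuous_image[OF assms(2,1)] by (simp add: compact_imp_bounded)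
  then show ?thesis using that by (metis Bcontfun_inverse)
qed

text \<open>The closed sets are an intersection-stable generator of the Borel sets, and the
  indicator of a closed set is a bounded pointwise limit of continuous functions of the distance to
  it.\<close>

lemma dense_continuous:
  fixes M :: "'x::metric_space measure"
  assumes compact: "compact (UNIV :: 'x set)" and fin: "finite_measure M" and sets: "sets M = sets borel"
    and "L2_module M ip act emb"
  shows "closure (span {emb (apply_bcontfun g) a |g a. True}) = UNIV"
proof -
  interpret l2_module M ip act emb by unfold_locales fact
  have space: "space M = UNIV" using sets_eq_imp_space_eq[OF sets] by simp
  define C where "C = closure (span {emb (apply_bcontfun g) a |g a. True})"
  have C: "subspace C" "closed C" unfolding C_def by (auto intro: subspace_closure)
  have gC: "emb g a \<in> C" if "continuous_on UNIV g" for g a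
  proof -
    obtain h where "apply_bcontfun h = g" using compact_bcontfun[OF compact \<open>continuous_on UNIV g\<close>] .
    then have "emb g a \<in> {emb (apply_bcontfun g) a |g a. True}" by blast
    then show ?thesis unfolding C_def by (intro subsetD[OF closure_subset] span_base)
  qed
  have closedC: "emb (indicator A) a \<in> C" if A: "closed A" for A a
  \<comment> \<open>The distance to the empty set is 0 by convention, so the functions
    \<open>g n\<close> below would be constantly 1 there.\<close>
  proof (cases "A = {}")
    case True
    then show ?thesis using emb_zero[of a] subspace_0[OF C(1)] by (simp add: indicator_def[abs_def])
  next
    case False
    define g where "g n x = complex_of_real (max 0 (1 - real n * infdist x A))" for n x
    have g: "continuous_on UNIV (g n)" for n
      unfolding g_def by (intro continuous_intros)
    have "(\<lambda>n. emb (g n) a) \<longlonglongrightarrow> emb (indicator A) a"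
    proof (rule emb_tendsto[where w = "\<lambda>_. 1"])
      show "g n \<in> borel_measurable M" for n
        using borel_measurable_continuous_onI[OF g] measurable_cong_sets[OF sets refl] by blast
      show "(indicator A :: _ \<Rightarrow> complex) \<in> borel_measurable M"
        using A by (intro borel_measurable_indicator) (simp add: sets)
      show "(\<lambda>_. 1) \<in> L2 M" using fin by (simp add: L2_def finite_measure.integrable_const)
      show "cmod (g n x) \<le> cmod 1" for n x
        unfolding g_def by (simp add: infdist_nonneg)
      show "(\<lambda>n. g n x) \<longlonglongrightarrow> indicator A x" for x
      proof (cases "x \<in> A")
        case True
        then show ?thesis by (simp add: g_def)
      next
        case x: False
        then have pos: "0 < infdist x A"
          using infdist_pos_not_in_closed[OF A False] by simp
        obtain N where N: "1 / infdist x A < real N" using reals_Archimedean2 by blast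
        have "g n x = 0" if "n \<ge> N" for n
        proof -
          have "1 / infdist x A \<le> real n" using N that by linarith
          then have "1 \<le> real n * infdist x A" using pos by (simp add: field_simps)
          then show ?thesis by (simp add: g_def)
        qed
        then have "eventually (\<lambda>n. g n x = indicator A x) sequentially"
          using x by (auto simp: eventually_sequentially)
        then show ?thesis by (rule tendsto_eventually)
      qed
    qed
    then show ?thesis using closed_sequentially[OF C(2), of "\<lambda>n. emb (g n) a"] gC[OF g] by blast
  qed
  have "emb f a \<in> C" if "f \<in> L2 M" for f a
  proof (rule emb_in_closed_subspace[OF fin C, where G = "Collect closed"])
    show "sets M = sigma_sets (space M) (Collect closed)"
      unfolding sets space borel_eq_closed by (simp add: sets_measure_of)
  qed (auto simp: Int_stable_def space closedC that)
  then show ?thesis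
    by (intro closure_span_eq_UNIV_trans[OF dense_emb]) (auto simp: C_def)
qed

section \<open>Leg notation\<close>

locale l2_module_square =
  X: l2_module \<mu> ip act emb + XX: l2_module "\<mu> \<Otimes>\<^sub>M \<mu>" ip2 act2 emb2
  for \<mu> :: "'y measure"
    and ip :: "'m::banach \<Rightarrow> 'm \<Rightarrow> 'a::cstar_algebra" and act :: "'m \<Rightarrow> 'a \<Rightarrow> 'm"
    and emb :: "('y \<Rightarrow> complex) \<Rightarrow> 'a \<Rightarrow> 'm"
    and ip2 :: "'n::banach \<Rightarrow> 'n \<Rightarrow> 'a" and act2 :: "'n \<Rightarrow> 'a \<Rightarrow> 'n"
    and emb2 :: "('y \<times> 'y \<Rightarrow> complex) \<Rightarrow> 'a \<Rightarrow> 'n" +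
  assumes prob: "prob_space \<mu>"

sublocale l2_module_square \<subseteq> P: prob_space \<mu>
  by (rule prob)

sublocale l2_module_square \<subseteq> PP: pair_prob_space \<mu> \<mu>
  by unfold_locales

abbreviation tens :: "('y \<Rightarrow> complex) \<Rightarrow> ('y \<Rightarrow> complex) \<Rightarrow> 'y \<times> 'y \<Rightarrow> complex" where
  "tens g h \<equiv> \<lambda>(x, y). g x * h y"

context l2_module_square
begin

section \<open>Elementary tensors on the product space\<close>

lemma tens_integrable:
  assumes g: "integrable \<mu> g" and h: "integrable \<mu> h"
  shows "integrable (\<mu> \<Otimes>\<^sub>M \<mu>) (tens g h)"
    and "integral\<^sup>L (\<mu> \<Otimes>\<^sub>M \<mu>) (tens g h) = integral\<^sup>L \<mu> g * integral\<^sup>L \<mu> h"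
proof -
  have [measurable]: "g \<in> borel_measurable \<mu>" "h \<in> borel_measurable \<mu>" using g h by auto
  show int: "integrable (\<mu> \<Otimes>\<^sub>M \<mu>) (tens g h)"
  proof (rule PP.Fubini_integrable)
    show "tens g h \<in> borel_measurable (\<mu> \<Otimes>\<^sub>M \<mu>)" by measurable
    show "integrable \<mu> (\<lambda>x. \<integral>y. norm (tens g h (x, y)) \<partial>\<mu>)"
      using g by (simp add: norm_mult integrable_norm)
    show "AE x in \<mu>. integrable \<mu> (\<lambda>y. tens g h (x, y))" using h by simp
  qed
  have "integral\<^sup>L (\<mu> \<Otimes>\<^sub>M \<mu>) (tens g h) = (\<integral>x. (\<integral>y. g x * h y \<partial>\<mu>) \<partial>\<mu>)"
    using PP.integral_fst'[OF int] by simp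
  then show "integral\<^sup>L (\<mu> \<Otimes>\<^sub>M \<mu>) (tens g h) = integral\<^sup>L \<mu> g * integral\<^sup>L \<mu> h" by simp
qed

lemma tens_L2:
  assumes "g \<in> L2 \<mu>" "h \<in> L2 \<mu>"
  shows "tens g h \<in> L2 (\<mu> \<Otimes>\<^sub>M \<mu>)"
proof -
  note [measurable] = L2_measurable[OF assms(1)] L2_measurable[OF assms(2)]
  have c: "integrable \<mu> (\<lambda>y. complex_of_real ((cmod (f y))\<^sup>2))" if "f \<in> L2 \<mu>" for f
    using L2_integrable[OF that] by (rule integrable_of_real)
  have "integrable (\<mu> \<Otimes>\<^sub>M \<mu>)
      (\<lambda>z. norm (tens (\<lambda>y. complex_of_real ((cmod (g y))\<^sup>2)) (\<lambda>y. complex_of_real ((cmod (h y))\<^sup>2)) z))"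
    by (intro integrable_norm tens_integrable c assms)
  moreover have "(\<lambda>z. norm (tens (\<lambda>y. complex_of_real ((cmod (g y))\<^sup>2)) (\<lambda>y. complex_of_real ((cmod (h y))\<^sup>2)) z))
      = (\<lambda>z. (cmod (tens g h z))\<^sup>2)"
    by (auto simp: fun_eq_iff norm_mult power_mult_distrib norm_power)
  ultimately show ?thesis by (simp add: L2_def)
qed

lemma ip2_tens:
  assumes "g \<in> L2 \<mu>" "h \<in> L2 \<mu>" "g' \<in> L2 \<mu>" "h' \<in> L2 \<mu>"
  shows "ip2 (emb2 (tens g h) a) (emb2 (tens g' h') b) =
    ((\<integral>y. cnj (g y) * g' y \<partial>\<mu>) * (\<integral>y. cnj (h y) * h' y \<partial>\<mu>)) *\<^sub>C (star a * b)"
proof -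
  have "(\<lambda>z. cnj (tens g h z) * tens g' h' z) = tens (\<lambda>y. cnj (g y) * g' y) (\<lambda>y. cnj (h y) * h' y)"
    by (auto simp: fun_eq_iff mult_ac)
  then show ?thesis
    using assms by (simp add: XX.ip_emb tens_L2 tens_integrable L2_ip_integrable)
qed

text \<open>Measurable rectangles generate the product sigma-algebra, and their indicators are
  elementary tensors.\<close>

lemma dense_tens:
  "closure (span {emb2 (tens g h) a |g h a. g \<in> L2 \<mu> \<and> h \<in> L2 \<mu>}) = UNIV"
proof -
  define C where "C = closure (span {emb2 (tens g h) a |g h a. g \<in> L2 \<mu> \<and> h \<in> L2 \<mu>})"
  have C: "subspace C" "closed C" unfolding C_def by (auto intro: subspace_closure)
  have "emb2 f a \<in> C" if f: "f \<in> L2 (\<mu> \<Otimes>\<^sub>M \<mu>)" for f a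
  proof (rule XX.emb_in_closed_subspace[OF _ C Int_stable_pair_measure_generator[of \<mu> \<mu>] _ _ _ _ f])
    show "finite_measure (\<mu> \<Otimes>\<^sub>M \<mu>)" by (rule PP.P.finite_measure_axioms)
    show "{a \<times> b |a b. a \<in> sets \<mu> \<and> b \<in> sets \<mu>} \<subseteq> Pow (space (\<mu> \<Otimes>\<^sub>M \<mu>))"
      using sets.space_closed[of \<mu>] by (auto simp: space_pair_measure)
    show "sets (\<mu> \<Otimes>\<^sub>M \<mu>) = sigma_sets (space (\<mu> \<Otimes>\<^sub>M \<mu>)) {a \<times> b |a b. a \<in> sets \<mu> \<and> b \<in> sets \<mu>}"
      by (simp add: sets_pair_measure space_pair_measure)
    show "space (\<mu> \<Otimes>\<^sub>M \<mu>) \<in> {a \<times> b |a b. a \<in> sets \<mu> \<and> b \<in> sets \<mu>}"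
      by (auto simp: space_pair_measure)
    fix S a assume "S \<in> {a \<times> b |a b. a \<in> sets \<mu> \<and> b \<in> sets \<mu>}"
    then obtain A B where AB: "S = A \<times> B" "A \<in> sets \<mu>" "B \<in> sets \<mu>" by auto
    have ind: "(indicator A :: 'y \<Rightarrow> complex) \<in> L2 \<mu>" if "A \<in> sets \<mu>" for A
      using that by (intro L2_bounded[where B = 1]) (auto simp: indicator_def intro: P.finite_measure_axioms)
    have "indicator S = tens (indicator A) (indicator B)"
      unfolding AB by (auto simp: fun_eq_iff indicator_def)
    then have "emb2 (indicator S) a \<in> {emb2 (tens g h) a |g h a. g \<in> L2 \<mu> \<and> h \<in> L2 \<mu>}"
      using ind AB by auto
    then show "emb2 (indicator S) a \<in> C"
      unfolding C_def by (intro subsetD[OF closure_subset] span_base)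
  qed
  then show ?thesis
    by (intro closure_span_eq_UNIV_trans[OF XX.dense_emb]) (auto simp: C_def)
qed

section \<open>Insertion maps and the second leg of an isometry\<close>

abbreviation ins1 :: "('y \<Rightarrow> complex) \<Rightarrow> 'm \<Rightarrow> 'n" where
  "ins1 \<equiv> insert1 \<mu> emb emb2"

lemma ins1_exists:
  assumes h: "h \<in> L2 \<mu>"
  shows "\<exists>T. bounded_linear T \<and> (\<forall>f\<in>L2 \<mu>. \<forall>a. T (emb f a) = emb2 (tens h f) a)"
proof -
  define S where "S = {(emb f a, emb2 (tens h f) a) |f a. f \<in> L2 \<mu>}"
  have fst: "fst ` S = {emb f a |f a. f \<in> L2 \<mu>}" unfolding S_def by force
  have hh: "(\<integral>y. cnj (h y) * h y \<partial>\<mu>) = of_real (\<integral>y. (cmod (h y))\<^sup>2 \<partial>\<mu>)"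
  proof -
    have "(\<integral>y. cnj (h y) * h y \<partial>\<mu>) = (\<integral>y. of_real ((cmod (h y))\<^sup>2) \<partial>\<mu>)"
      by (intro Bochner_Integration.integral_cong refl) (metis complex_norm_square mult.commute)
    also have "\<dots> = of_real (\<integral>y. (cmod (h y))\<^sup>2 \<partial>\<mu>)" by (rule integral_complex_of_real)
    finally show ?thesis .
  qed
  have iso: "ip2 y y' = (\<integral>y. (cmod (h y))\<^sup>2 \<partial>\<mu>) *\<^sub>R ip x x'" if xy: "(x, y) \<in> S" "(x', y') \<in> S" for x y x' y'
  proof -
    from xy obtain f a f' a' where f: "f \<in> L2 \<mu>" "f' \<in> L2 \<mu>"
      and x: "x = emb f a" "y = emb2 (tens h f) a" "x' = emb f' a'" "y' = emb2 (tens h f') a'"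
      unfolding S_def by blast
    show ?thesis
      unfolding x ip2_tens[OF h f(1) h f(2)] X.ip_emb[OF f] hh
      by (simp flip: scaleC_scaleC add: scaleC_of_real)
  qed
  have "0 \<le> (\<integral>y. (cmod (h y))\<^sup>2 \<partial>\<mu>)" by (rule Bochner_Integration.integral_nonneg) simp
  from isometric_extension[OF X.hilbert_module XX.hilbert_module X.dense_emb[folded fst] iso this]
  obtain T where "bounded_linear T" "\<And>x y. (x, y) \<in> S \<Longrightarrow> T x = y" by blast
  then show ?thesis unfolding S_def by (intro exI[of _ T]) auto
qed

lemma ins1:
  assumes "h \<in> L2 \<mu>"
  shows bounded_linear_ins1: "bounded_linear (ins1 h)"
    and ins1_emb: "f \<in> L2 \<mu> \<Longrightarrow> ins1 h (emb f a) = emb2 (tens h f) a"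
proof -
  obtain T where T: "bounded_linear T" "\<And>f a. f \<in> L2 \<mu> \<Longrightarrow> T (emb f a) = emb2 (tens h f) a"
    using ins1_exists[OF assms] by blast
  have "ins1 h = T"
    unfolding insert1_def
  proof (rule the_equality)
    fix T' assume "bounded_linear T' \<and> (\<forall>f\<in>L2 \<mu>. \<forall>a. T' (emb f a) = emb2 (tens h f) a)"
    then have T': "bounded_linear T'" "\<And>g a. g \<in> L2 \<mu> \<Longrightarrow> T' (emb g a) = T (emb g a)"
      using T(2) by simp_all
    show "T' = T" by (rule ext) (rule X.bounded_linear_eq_on_emb[OF T'(1) T(1) T'(2)])
  qed (use T in auto)
  with T show "bounded_linear (ins1 h)" "f \<in> L2 \<mu> \<Longrightarrow> ins1 h (emb f a) = emb2 (tens h f) a" by auto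
qed

lemma ip2_ins1:
  assumes g: "g \<in> L2 \<mu>" and h: "h \<in> L2 \<mu>"
  shows "ip2 (ins1 g x) (ins1 h y) = (\<integral>y. cnj (g y) * h y \<partial>\<mu>) *\<^sub>C ip x y"
proof -
  have *: "ip2 (ins1 g (emb f a)) (ins1 h y) = (\<integral>y. cnj (g y) * h y \<partial>\<mu>) *\<^sub>C ip (emb f a) y"
    if f: "f \<in> L2 \<mu>" for f a
    by (rule X.bounded_linear_eq_on_emb[where
          S = "\<lambda>y. ip2 (ins1 g (emb f a)) (ins1 h y)" and
          T = "\<lambda>y. (\<integral>y. cnj (g y) * h y \<partial>\<mu>) *\<^sub>C ip (emb f a) y", OF
          bounded_linear_compose[OF XX.bounded_linear_ip_right bounded_linear_ins1[OF h]]
          bounded_linear_compose[OF bounded_linear_scaleC X.bounded_linear_ip_right]])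
      (simp add: ins1_emb g h f ip2_tens X.ip_emb scaleC_scaleC)
  show ?thesis
    by (rule X.bounded_linear_eq_on_emb[where
          S = "\<lambda>x. ip2 (ins1 g x) (ins1 h y)" and
          T = "\<lambda>x. (\<integral>y. cnj (g y) * h y \<partial>\<mu>) *\<^sub>C ip x y", OF
          bounded_linear_compose[OF XX.bounded_linear_ip_left bounded_linear_ins1[OF g]]
          bounded_linear_compose[OF bounded_linear_scaleC X.bounded_linear_ip_left]]) (rule *)
qed

lemma dense_ins1: "closure (span {ins1 h x |h x. h \<in> L2 \<mu>}) = UNIV"
proof (rule closure_span_eq_UNIV_trans[OF dense_tens])
  have "{emb2 (tens g h) a |g h a. g \<in> L2 \<mu> \<and> h \<in> L2 \<mu>} \<subseteq> {ins1 h x |h x. h \<in> L2 \<mu>}"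
  proof
    fix u assume "u \<in> {emb2 (tens g h) a |g h a. g \<in> L2 \<mu> \<and> h \<in> L2 \<mu>}"
    then obtain g h a where u: "u = emb2 (tens g h) a" "g \<in> L2 \<mu>" "h \<in> L2 \<mu>" by blast
    then have "u = ins1 g (emb h a)" by (simp add: ins1_emb)
    with u(2) show "u \<in> {ins1 h x |h x. h \<in> L2 \<mu>}" by blast
  qed
  then show "{emb2 (tens g h) a |g h a. g \<in> L2 \<mu> \<and> h \<in> L2 \<mu>} \<subseteq> closure (span {ins1 h x |h x. h \<in> L2 \<mu>})"
    by (meson closure_subset order_trans span_superset)
qed

lemma bounded_linear_eq_on_ins1:
  assumes "bounded_linear S" "bounded_linear T" "\<And>h x. h \<in> L2 \<mu> \<Longrightarrow> S (ins1 h x) = T (ins1 h x)"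
  shows "S x = T x"
  by (rule bounded_linear_eq_on_dense[OF assms(1,2) dense_ins1]) (use assms(3) in blast)

abbreviation leg2 :: "('m \<Rightarrow> 'm) \<Rightarrow> 'n \<Rightarrow> 'n" where
  "leg2 \<equiv> leg23 \<mu> emb emb2"

text \<open>Insertions multiply inner products by scalars, so \<open>V\<close> on the second leg
  preserves inner products whenever \<open>V\<close> does. Nothing else is asked of
  \<open>V\<close>: linearity and boundedness come from the extension, and the lemma serves
  \<open>U\<close> and its inverse alike.\<close>

lemma leg2:
  assumes iso: "\<And>x y. ip (V x) (V y) = ip x y"
  shows bounded_linear_leg2: "bounded_linear (leg2 V)"
    and leg2_ins1: "h \<in> L2 \<mu> \<Longrightarrow> leg2 V (ins1 h x) = ins1 h (V x)"
    and ip2_leg2: "ip2 (leg2 V u) (leg2 V v) = ip2 u v"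
proof -
  define S where "S = {(ins1 h x, ins1 h (V x)) |h x. h \<in> L2 \<mu>}"
  have fst: "fst ` S = {ins1 h x |h x. h \<in> L2 \<mu>}" unfolding S_def by force
  have iso: "ip2 y y' = 1 *\<^sub>R ip2 x x'" if "(x, y) \<in> S" "(x', y') \<in> S" for x y x' y'
    using that iso unfolding S_def by (auto simp: ip2_ins1)
  from isometric_extension[OF XX.hilbert_module XX.hilbert_module dense_ins1[folded fst] iso zero_le_one]
  obtain T where T: "bounded_linear T" "\<And>x y. (x, y) \<in> S \<Longrightarrow> T x = y" "\<And>x x'. ip2 (T x) (T x') = 1 *\<^sub>R ip2 x x'"
    by blast
  have TS: "T (ins1 h x) = ins1 h (V x)" if "h \<in> L2 \<mu>" for h x using T(2) that by (auto simp: S_def)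
  have "leg2 V = T"
    unfolding leg23_def
  proof (rule the_equality)
    fix T' assume "bounded_linear T' \<and> (\<forall>h\<in>L2 \<mu>. \<forall>x. T' (ins1 h x) = ins1 h (V x))"
    then have T': "bounded_linear T'" "\<And>g a. g \<in> L2 \<mu> \<Longrightarrow> T' (ins1 g a) = T (ins1 g a)"
      using TS by simp_all
    show "T' = T" by (rule ext) (rule bounded_linear_eq_on_ins1[OF T'(1) T(1) T'(2)])
  qed (use T TS in auto)
  with T TS show "bounded_linear (leg2 V)" "h \<in> L2 \<mu> \<Longrightarrow> leg2 V (ins1 h x) = ins1 h (V x)"
    "ip2 (leg2 V u) (leg2 V v) = ip2 u v" by auto
qed

lemma leg2_inverse:
  assumes "\<And>x y. ip (V x) (V y) = ip x y" "\<And>x y. ip (V' x) (V' y) = ip x y" "\<And>x. V (V' x) = x"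
  shows "leg2 V (leg2 V' u) = u"
  by (rule bounded_linear_eq_on_ins1[OF bounded_linear_compose[OF bounded_linear_leg2[OF assms(1)]
        bounded_linear_leg2[OF assms(2)]] bounded_linear_ident])
    (simp add: leg2_ins1[OF assms(1)] leg2_ins1[OF assms(2)] assms(3))

section \<open>Exchange of the two coordinates\<close>

lemma swap_L2:
  assumes "f \<in> L2 (\<mu> \<Otimes>\<^sub>M \<mu>)"
  shows "(\<lambda>(x, y). f (y, x)) \<in> L2 (\<mu> \<Otimes>\<^sub>M \<mu>)"
proof -
  note [measurable] = L2_measurable[OF assms]
  have "integrable (\<mu> \<Otimes>\<^sub>M \<mu>) (\<lambda>(x, y). (cmod (f (y, x)))\<^sup>2)"
    using PP.integrable_product_swap[OF L2_integrable[OF assms]] .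
  moreover have "(\<lambda>z. (cmod ((\<lambda>(x, y). f (y, x)) z))\<^sup>2) = (\<lambda>(x, y). (cmod (f (y, x)))\<^sup>2)" by auto
  ultimately show ?thesis by (simp add: L2_def)
qed

text \<open>The embedding with exchanged coordinates is a second realization on the same module with
  the same inner product. Hence each fact about \<open>leg23\<close> and \<open>insert1\<close>,
  read for this realization, is a fact about \<open>leg13\<close> and \<open>insert2\<close> for
  \<open>emb2\<close>; in the end \<open>Z\<close> turns into \<open>W\<close> in the same
  way.\<close>

lemma L2_module_swap:
  "L2_module (\<mu> \<Otimes>\<^sub>M \<mu>) ip2 act2 (\<lambda>f. emb2 (\<lambda>(x, y). f (y, x)))"
  unfolding L2_module_def
proof (intro conjI ballI allI)
  let ?s = "\<lambda>(f :: 'y \<times> 'y \<Rightarrow> complex) (x, y). f (y, x)"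
  show "hilbert_module ip2 act2" by (rule XX.hilbert_module)
  fix f a b assume f: "f \<in> L2 (\<mu> \<Otimes>\<^sub>M \<mu>)"
  show "act2 (emb2 (?s f) a) b = emb2 (?s f) (a * b)" by (rule XX.act_emb[OF swap_L2[OF f]])
  fix g assume g: "g \<in> L2 (\<mu> \<Otimes>\<^sub>M \<mu>)"
  note [measurable] = L2_measurable[OF f] L2_measurable[OF g]
  have "(\<integral>z. cnj (?s f z) * ?s g z \<partial>(\<mu> \<Otimes>\<^sub>M \<mu>)) = (\<integral>(x, y). (\<lambda>z. cnj (f z) * g z) (y, x) \<partial>(\<mu> \<Otimes>\<^sub>M \<mu>))"
    by (intro Bochner_Integration.integral_cong) auto
  also have "\<dots> = (\<integral>z. cnj (f z) * g z \<partial>(\<mu> \<Otimes>\<^sub>M \<mu>))"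
    by (rule PP.integral_product_swap) measurable
  finally show "ip2 (emb2 (?s f) a) (emb2 (?s g) b) = (\<integral>z. cnj (f z) * g z \<partial>(\<mu> \<Otimes>\<^sub>M \<mu>)) *\<^sub>C (star a * b)"
    unfolding XX.ip_emb[OF swap_L2[OF f] swap_L2[OF g]] by simp
next
  let ?s = "\<lambda>(f :: 'y \<times> 'y \<Rightarrow> complex) (x, y). f (y, x)"
  have "{emb2 (?s f) a |f a. f \<in> L2 (\<mu> \<Otimes>\<^sub>M \<mu>)} = {emb2 f a |f a. f \<in> L2 (\<mu> \<Otimes>\<^sub>M \<mu>)}"
  proof (intro equalityI subsetI)
    fix u assume "u \<in> {emb2 f a |f a. f \<in> L2 (\<mu> \<Otimes>\<^sub>M \<mu>)}"
    then obtain f a where f: "u = emb2 (?s (?s f)) a" "f \<in> L2 (\<mu> \<Otimes>\<^sub>M \<mu>)" by auto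
    from f(1) swap_L2[OF f(2)] show "u \<in> {emb2 (?s f) a |f a. f \<in> L2 (\<mu> \<Otimes>\<^sub>M \<mu>)}" by blast
  qed (use swap_L2 in blast)
  then show "closure (span {emb2 (?s f) a |f a. f \<in> L2 (\<mu> \<Otimes>\<^sub>M \<mu>)}) = UNIV"
    using XX.dense_emb by simp
qed

lemma square_swap: "l2_module_square \<mu> ip act emb ip2 act2 (\<lambda>f. emb2 (\<lambda>(x, y). f (y, x)))"
  by (intro l2_module_square.intro l2_module.intro l2_module_square_axioms.intro)
    (rule X.L2_module L2_module_swap prob)+

lemma insert1_swap: "insert1 \<mu> emb (\<lambda>f. emb2 (\<lambda>(x, y). f (y, x))) = insert2 \<mu> emb emb2"
  unfolding insert1_def insert2_def by (simp add: mult.commute)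

lemma leg23_swap: "leg23 \<mu> emb (\<lambda>f. emb2 (\<lambda>(x, y). f (y, x))) = leg13 \<mu> emb emb2"
  unfolding leg23_def leg13_def insert1_swap ..

lemma leg13_swap: "leg13 \<mu> emb (\<lambda>f. emb2 (\<lambda>(x, y). f (y, x))) = leg23 \<mu> emb emb2"
  unfolding leg23_def leg13_def insert1_def insert2_def by (simp add: mult.commute)

abbreviation ins2 :: "('y \<Rightarrow> complex) \<Rightarrow> 'm \<Rightarrow> 'n" where
  "ins2 \<equiv> insert2 \<mu> emb emb2"

abbreviation leg1 :: "('m \<Rightarrow> 'm) \<Rightarrow> 'n \<Rightarrow> 'n" where
  "leg1 \<equiv> leg13 \<mu> emb emb2"

lemmas bounded_linear_ins2 = l2_module_square.bounded_linear_ins1[OF square_swap, unfolded insert1_swap]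
  and ip2_ins2 = l2_module_square.ip2_ins1[OF square_swap, unfolded insert1_swap]
  and bounded_linear_leg1 = l2_module_square.bounded_linear_leg2[OF square_swap, unfolded leg23_swap]
  and leg1_ins2 = l2_module_square.leg2_ins1[OF square_swap, unfolded leg23_swap insert1_swap]
  and ip2_leg1 = l2_module_square.ip2_leg2[OF square_swap, unfolded leg23_swap]
  and leg1_inverse = l2_module_square.leg2_inverse[OF square_swap, unfolded leg23_swap]

lemma ins2_emb:
  assumes "h \<in> L2 \<mu>" "f \<in> L2 \<mu>"
  shows "ins2 h (emb f a) = emb2 (tens f h) a"
  using l2_module_square.ins1_emb[OF square_swap assms, unfolded insert1_swap, of a]
  by (simp add: mult.commute)

lemma ins1_ins2:
  assumes "g \<in> L2 \<mu>" "h \<in> L2 \<mu>"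
  shows "ins1 g (emb h a) = ins2 h (emb g a)"
  using assms by (simp add: ins1_emb ins2_emb)

end

section \<open>Kernel operators\<close>

text \<open>Stone-Weierstrass as an induction principle: distances from a fixed point in one of the
  coordinates separate points, and constants come from \<open>fst\<close>. It serves measurability
  and the commutation with \<open>B2\<close>; complex functions are treated through real and
  imaginary part.\<close>

lemma product_Stone_Weierstrass:
  fixes P :: "('x::metric_space \<times> 'x \<Rightarrow> real) \<Rightarrow> bool"
  assumes compact: "compact (UNIV :: 'x set)"
    and fst: "\<And>g. continuous_on UNIV g \<Longrightarrow> P (\<lambda>(x, y). g x)"
    and snd: "\<And>g. continuous_on UNIV g \<Longrightarrow> P (\<lambda>(x, y). g y)"
    and add: "\<And>f g. continuous_on UNIV f \<Longrightarrow> continuous_on UNIV g \<Longrightarrow> P f \<Longrightarrow> P g \<Longrightarrow> P (\<lambda>z. f z + g z)"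
    and mult: "\<And>f g. continuous_on UNIV f \<Longrightarrow> continuous_on UNIV g \<Longrightarrow> P f \<Longrightarrow> P g \<Longrightarrow> P (\<lambda>z. f z * g z)"
    and lim: "\<And>f. continuous_on UNIV f \<Longrightarrow>
      (\<And>e. 0 < e \<Longrightarrow> \<exists>g. continuous_on UNIV g \<and> P g \<and> (\<forall>z. \<bar>f z - g z\<bar> < e)) \<Longrightarrow> P f"
    and f: "continuous_on UNIV f"
  shows "P f"
proof -
  interpret function_ring_on "{f. continuous_on UNIV f \<and> P f}" "UNIV :: ('x \<times> 'x) set"
  proof
    show "compact (UNIV :: ('x \<times> 'x) set)" using compact_Times[OF compact compact] by simp
    show "(\<lambda>_. c) \<in> {f. continuous_on UNIV f \<and> P f}" for c
      using fst[of "\<lambda>_. c"] by (simp add: case_prod_unfold)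
    fix z w :: "'x \<times> 'x" assume "z \<noteq> w"
    show "\<exists>f\<in>{f. continuous_on UNIV f \<and> P f}. f z \<noteq> f w"
    proof (cases "fst z = fst w")
      case True
      with \<open>z \<noteq> w\<close> have "snd z \<noteq> snd w" by (simp add: prod_eq_iff)
      then show ?thesis using snd[of "dist (snd z)", OF continuous_on_dist[OF continuous_on_const continuous_on_id]]
        by (intro bexI[of _ "\<lambda>(x, y). dist (snd z) y"])
          (auto simp: case_prod_unfold continuous_on_dist intro!: continuous_intros)
    next
      case False
      then show ?thesis using fst[of "dist (fst z)", OF continuous_on_dist[OF continuous_on_const continuous_on_id]]
        by (intro bexI[of _ "\<lambda>(x, y). dist (fst z) x"])
          (auto simp: case_prod_unfold continuous_on_dist intro!: continuous_intros)
    qed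
  qed (auto intro: add mult continuous_intros)
  show ?thesis
    using Stone_Weierstrass_basic[OF f] by (intro lim f) auto
qed

locale compact_square = l2_module_square \<mu> ip act emb ip2 act2 emb2
  for \<mu> :: "'x::metric_space measure"
    and ip :: "'m::banach \<Rightarrow> 'm \<Rightarrow> 'a::cstar_algebra" and act :: "'m \<Rightarrow> 'a \<Rightarrow> 'm"
    and emb :: "('x \<Rightarrow> complex) \<Rightarrow> 'a \<Rightarrow> 'm"
    and ip2 :: "'n::banach \<Rightarrow> 'n \<Rightarrow> 'a" and act2 :: "'n \<Rightarrow> 'a \<Rightarrow> 'n"
    and emb2 :: "('x \<times> 'x \<Rightarrow> complex) \<Rightarrow> 'a \<Rightarrow> 'n" +
  assumes compact: "compact (UNIV :: 'x set)" and sets_mu: "sets \<mu> = sets borel"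
begin

lemma continuous_measurable:
  "continuous_on UNIV g \<Longrightarrow> g \<in> borel_measurable \<mu>"
  using borel_measurable_continuous_onI[of g] measurable_cong_sets[OF sets_mu refl] by blast

text \<open>The type \<open>'x\<close> is only a \<open>metric_space\<close>, so the Borel sets of
  the square are not simply identified with the product sigma-algebra. Approximation by sums of
  products of functions of one variable gives measurability for the latter directly.\<close>

lemma continuous_measurable2_real:
  fixes F :: "'x \<times> 'x \<Rightarrow> real"
  assumes "continuous_on UNIV F"
  shows "F \<in> borel_measurable (\<mu> \<Otimes>\<^sub>M \<mu>)"
  using compact _ _ _ _ _ assms
proof (rule product_Stone_Weierstrass)
  fix g :: "'x \<Rightarrow> real" assume "continuous_on UNIV g"
  from continuous_measurable[OF this]
  show "(\<lambda>(x, y). g x) \<in> borel_measurable (\<mu> \<Otimes>\<^sub>M \<mu>)" "(\<lambda>(x, y). g y) \<in> borel_measurable (\<mu> \<Otimes>\<^sub>M \<mu>)"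
    by measurable
next
  fix f :: "'x \<times> 'x \<Rightarrow> real"
  assume "\<And>e. 0 < e \<Longrightarrow> \<exists>g. continuous_on UNIV g \<and> g \<in> borel_measurable (\<mu> \<Otimes>\<^sub>M \<mu>) \<and> (\<forall>z. \<bar>f z - g z\<bar> < e)"
  from this[of "1 / real (Suc n)" for n] obtain g
    where g: "\<And>n. g n \<in> borel_measurable (\<mu> \<Otimes>\<^sub>M \<mu>)" "\<And>n z. \<bar>f z - g n z\<bar> < 1 / real (Suc n)"
    by (metis of_nat_0_less_iff zero_less_Suc zero_less_divide_1_iff)
  have "(\<lambda>n. g n z) \<longlonglongrightarrow> f z" for z
  proof -
    have "(\<lambda>n. g n z - f z) \<longlonglongrightarrow> 0"
      by (rule Lim_null_comparison[OF _ lim_inverse_n'[THEN LIMSEQ_Suc]])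
        (use g(2)[of z] in \<open>auto simp: abs_minus_commute intro!: always_eventually less_imp_le\<close>)
    then show ?thesis by (rule LIM_zero_cancel)
  qed
  then show "f \<in> borel_measurable (\<mu> \<Otimes>\<^sub>M \<mu>)"
    by (rule borel_measurable_LIMSEQ_metric[OF g(1)])
qed auto

lemma continuous_bounded:
  fixes F :: "'b::metric_space \<Rightarrow> complex"
  assumes "continuous_on UNIV F" "compact (UNIV :: 'b set)"
  obtains B where "0 < B" "\<And>z. cmod (F z) \<le> B"
  using compact_imp_bounded[OF compact_continuous_image[OF assms]] that
  unfolding bounded_pos by auto

lemma compact2: "compact (UNIV :: ('x \<times> 'x) set)"
  using compact_Times[OF compact compact] by simp

lemma continuous_Linf:
  assumes "continuous_on UNIV g"
  shows "g \<in> Linf \<mu>"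
  by (rule continuous_bounded[OF assms compact]) (rule LinfI[OF continuous_measurable[OF assms]])

lemma continuous_L2: "continuous_on UNIV g \<Longrightarrow> g \<in> L2 \<mu>"
  by (intro Linf_L2 continuous_Linf P.finite_measure_axioms)

lemma continuous_measurable2:
  fixes F :: "'x \<times> 'x \<Rightarrow> complex"
  assumes "continuous_on UNIV F"
  shows "F \<in> borel_measurable (\<mu> \<Otimes>\<^sub>M \<mu>)"
proof -
  have "(\<lambda>z. Re (F z)) \<in> borel_measurable (\<mu> \<Otimes>\<^sub>M \<mu>)" "(\<lambda>z. Im (F z)) \<in> borel_measurable (\<mu> \<Otimes>\<^sub>M \<mu>)"
    by (intro continuous_measurable2_real continuous_intros assms)+
  then show ?thesis by (subst borel_measurable_complex_iff) auto
qed

lemma continuous_Linf2: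
  fixes F :: "'x \<times> 'x \<Rightarrow> complex"
  assumes "continuous_on UNIV F"
  shows "F \<in> Linf (\<mu> \<Otimes>\<^sub>M \<mu>)"
  by (rule continuous_bounded[OF assms compact2]) (rule LinfI[OF continuous_measurable2[OF assms]])

lemma continuous_swap: "continuous_on UNIV F \<Longrightarrow> continuous_on UNIV (\<lambda>(x, y). F (y, x))"
  unfolding case_prod_unfold by (rule continuous_on_compose2[of UNIV F]) (auto intro!: continuous_intros)

lemma one_L2: "(\<lambda>_. 1) \<in> L2 \<mu>"
  by (simp add: continuous_L2)

section \<open>Kernel operators on square-integrable functions\<close>

lemma section_measurable:
  fixes F :: "'x \<times> 'x \<Rightarrow> complex"
  assumes "continuous_on UNIV F"
  shows "(\<lambda>y. F (x, y)) \<in> borel_measurable \<mu>"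
  by (intro continuous_measurable continuous_on_compose2[OF assms] continuous_intros) auto

lemma kernel_integrable:
  fixes F :: "'x \<times> 'x \<Rightarrow> complex"
  assumes F: "continuous_on UNIV F" and g: "g \<in> L2 \<mu>"
  shows "integrable \<mu> (\<lambda>y. F (x, y) * g y)"
proof -
  obtain B where "\<And>z. cmod (F z) \<le> B" using continuous_bounded[OF F compact2] by blast
  then show ?thesis
    by (intro L2_integrable_finite[OF P.finite_measure_axioms] L2_mult_bounded[OF g section_measurable[OF F]])
qed

lemma kernel_bound:
  fixes F :: "'x \<times> 'x \<Rightarrow> complex"
  assumes F: "continuous_on UNIV F" and g: "g \<in> L2 \<mu>" and B: "\<And>z. cmod (F z) \<le> B"
  shows "cmod (kernel_operator \<mu> F g x) \<le> B * (\<integral>y. cmod (g y) \<partial>\<mu>)"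
proof -
  note gi = L2_integrable_finite[OF P.finite_measure_axioms g]
  have "cmod (kernel_operator \<mu> F g x) \<le> (\<integral>y. cmod (F (x, y) * g y) \<partial>\<mu>)"
    unfolding kernel_operator_def by (rule integral_norm_bound)
  also have "\<dots> \<le> (\<integral>y. B * cmod (g y) \<partial>\<mu>)"
    by (intro integral_mono integrable_norm kernel_integrable[OF F g])
      (auto simp: norm_mult B mult_right_mono gi)
  finally show ?thesis by simp
qed

text \<open>Continuity of the image allows \<open>kernel_operator \<mu> F p\<close> to be used as a
  function in C(X) later, in \<open>B\<close> and under \<beta>.\<close>

lemma kernel_continuous:
  fixes F :: "'x \<times> 'x \<Rightarrow> complex"
  assumes F: "continuous_on UNIV F" and g: "g \<in> L2 \<mu>"
  shows "continuous_on UNIV (kernel_operator \<mu> F g)"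
  unfolding continuous_on_sequentially
proof (intro ballI allI impI; elim conjE)
  fix s :: "nat \<Rightarrow> 'x" and x
  assume "s \<longlonglongrightarrow> x"
  note gi = L2_integrable_finite[OF P.finite_measure_axioms g]
  obtain B where B: "\<And>z. cmod (F z) \<le> B" using continuous_bounded[OF F compact2] by blast
  have "(\<lambda>n. \<integral>y. F (s n, y) * g y \<partial>\<mu>) \<longlonglongrightarrow> (\<integral>y. F (x, y) * g y \<partial>\<mu>)"
  proof (rule integral_dominated_convergence)
    show "integrable \<mu> (\<lambda>y. B * cmod (g y))" using gi by simp
    have "(\<lambda>n. F (s n, y)) \<longlonglongrightarrow> F (x, y)" for y
      by (rule continuous_on_tendsto_compose[OF F]) (auto intro!: tendsto_intros \<open>s \<longlonglongrightarrow> x\<close>)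
    then show "AE y in \<mu>. (\<lambda>n. F (s n, y) * g y) \<longlonglongrightarrow> F (x, y) * g y"
      by (intro AE_I2 tendsto_mult tendsto_const)
    show "AE y in \<mu>. norm (F (s n, y) * g y) \<le> B * cmod (g y)" for n
      by (intro AE_I2) (simp add: norm_mult B mult_right_mono)
  qed (use kernel_integrable[OF F g] in auto)
  then show "(kernel_operator \<mu> F g \<circ> s) \<longlonglongrightarrow> kernel_operator \<mu> F g x"
    by (simp add: kernel_operator_def o_def)
qed

lemma kernel_L2: "continuous_on UNIV F \<Longrightarrow> g \<in> L2 \<mu> \<Longrightarrow> kernel_operator \<mu> F g \<in> L2 \<mu>"
  by (rule continuous_L2[OF kernel_continuous])

lemma kernel_bounded_L2_operator:
  fixes F :: "'x \<times> 'x \<Rightarrow> complex"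
  assumes F: "continuous_on UNIV F"
  shows "bounded_L2_operator \<mu> (kernel_operator \<mu> F)"
  unfolding bounded_L2_operator_def
proof (intro conjI ballI allI)
  obtain B where B: "0 < B" "\<And>z. cmod (F z) \<le> B" using continuous_bounded[OF F compact2] by blast
  show "\<exists>K. \<forall>g\<in>L2 \<mu>. (\<integral>y. (cmod (kernel_operator \<mu> F g y))\<^sup>2 \<partial>\<mu>) \<le> K * (\<integral>y. (cmod (g y))\<^sup>2 \<partial>\<mu>)"
  proof (intro exI[of _ "B\<^sup>2"] ballI)
    fix g assume g: "g \<in> L2 \<mu>"
    have gi: "integrable \<mu> (\<lambda>y. cmod (g y))"
      using L2_integrable_finite[OF P.finite_measure_axioms g] by (rule integrable_norm)
    define m where "m = (\<integral>y. cmod (g y) \<partial>\<mu>)"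
    have m: "m\<^sup>2 \<le> (\<integral>y. (cmod (g y))\<^sup>2 \<partial>\<mu>)"
    proof -
      \<comment> \<open>The variance of \<open>cmod (g y)\<close> under the probability measure
        \<mu> is nonnegative.\<close>
      have "0 \<le> (\<integral>y. (cmod (g y) - m)\<^sup>2 \<partial>\<mu>)" by (rule Bochner_Integration.integral_nonneg) simp
      also have "\<dots> = (\<integral>y. (cmod (g y))\<^sup>2 - 2 * m * cmod (g y) + m\<^sup>2 \<partial>\<mu>)"
        by (simp add: power2_diff algebra_simps)
      also have "\<dots> = (\<integral>y. (cmod (g y))\<^sup>2 \<partial>\<mu>) - 2 * m * m + m\<^sup>2"
        using gi L2_integrable[OF g] by (simp add: m_def P.prob_space)
      finally show ?thesis by (simp add: power2_eq_square)
    qed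
    have "(\<integral>y. (cmod (kernel_operator \<mu> F g y))\<^sup>2 \<partial>\<mu>) \<le> (\<integral>y. (B * m)\<^sup>2 \<partial>\<mu>)"
    proof (rule integral_mono)
      show "integrable \<mu> (\<lambda>y. (cmod (kernel_operator \<mu> F g y))\<^sup>2)" by (rule L2_integrable[OF kernel_L2[OF F g]])
      show "(cmod (kernel_operator \<mu> F g y))\<^sup>2 \<le> (B * m)\<^sup>2" for y
        unfolding m_def by (intro power_mono kernel_bound[OF F g B(2)]) simp
    qed simp
    also have "\<dots> = B\<^sup>2 * m\<^sup>2" by (simp add: P.prob_space power_mult_distrib)
    also have "\<dots> \<le> B\<^sup>2 * (\<integral>y. (cmod (g y))\<^sup>2 \<partial>\<mu>)" using m by (intro mult_left_mono) auto
    finally show "(\<integral>y. (cmod (kernel_operator \<mu> F g y))\<^sup>2 \<partial>\<mu>) \<le> B\<^sup>2 * (\<integral>y. (cmod (g y))\<^sup>2 \<partial>\<mu>)" .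
  qed
  fix g h assume gh: "g \<in> L2 \<mu>" "h \<in> L2 \<mu>"
  show "AE y in \<mu>. kernel_operator \<mu> F (\<lambda>y. g y + h y) y = kernel_operator \<mu> F g y + kernel_operator \<mu> F h y"
    using kernel_integrable[OF F gh(1)] kernel_integrable[OF F gh(2)]
    by (intro AE_I2) (simp add: kernel_operator_def distrib_left)
next
  fix c g assume g: "g \<in> L2 \<mu>"
  have "(\<lambda>y. F (x, y) * (c * g y)) = (\<lambda>y. c * (F (x, y) * g y))" for x by (simp add: mult.left_commute)
  then show "AE y in \<mu>. kernel_operator \<mu> F (\<lambda>y. c * g y) y = c * kernel_operator \<mu> F g y"
    by (intro AE_I2) (simp add: kernel_operator_def)
qed (rule kernel_L2[OF F])

text \<open>By Fubini, pairing with the constant 1 in the second variable integrates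
  \<open>F (x, y) * h y\<close> over \<open>y\<close>, while \<open>g\<close> depends on
  \<open>x\<close> only and stays outside. This is the bridge between multiplication by
  \<open>F\<close>, of which the orbital algebra speaks, and the kernel operator.\<close>

lemma ip2_mop_tens:
  fixes F :: "'x \<times> 'x \<Rightarrow> complex"
  assumes F: "continuous_on UNIV F" and k: "k \<in> L2 \<mu>" and h: "h \<in> L2 \<mu>" and g: "g \<in> Linf \<mu>"
  shows "ip2 (emb2 (tens k (\<lambda>_. 1)) b) (XX.mop F (emb2 (tens g h) a)) =
    ip (emb k b) (emb (\<lambda>x. g x * kernel_operator \<mu> F h x) a)"
proof -
  have gL: "g \<in> L2 \<mu>" by (rule Linf_L2[OF P.finite_measure_axioms g])
  note FL = continuous_Linf2[OF F] and gh = tens_L2[OF gL h] and k1 = tens_L2[OF k one_L2]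
  have "(\<integral>z. cnj (tens k (\<lambda>_. 1) z) * (F z * tens g h z) \<partial>(\<mu> \<Otimes>\<^sub>M \<mu>))
      = (\<integral>x. \<integral>y. cnj (tens k (\<lambda>_. 1) (x, y)) * (F (x, y) * tens g h (x, y)) \<partial>\<mu> \<partial>\<mu>)"
    by (rule PP.integral_fst'[symmetric]) (intro L2_ip_integrable k1 Linf_mult_L2 FL gh)
  also have "\<dots> = (\<integral>x. \<integral>y. (cnj (k x) * g x) * (F (x, y) * h y) \<partial>\<mu> \<partial>\<mu>)"
    by (simp add: mult_ac)
  also have "\<dots> = (\<integral>x. cnj (k x) * (g x * kernel_operator \<mu> F h x) \<partial>\<mu>)"
    unfolding kernel_operator_def integral_mult_right_zero by (simp add: mult_ac)
  finally show ?thesis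
    unfolding XX.mop_emb[OF FL gh] XX.ip_emb[OF k1 Linf_mult_L2[OF FL gh]]
      X.ip_emb[OF k Linf_mult_L2[OF g kernel_L2[OF F h]]] by simp
qed

abbreviation kop :: "('x \<times> 'x \<Rightarrow> complex) \<Rightarrow> 'm \<Rightarrow> 'm" where
  "kop F \<equiv> ampliation \<mu> emb (kernel_operator \<mu> F)"

lemma norm_ins_one: "norm (ins1 (\<lambda>_. 1) x) = norm x" "norm (ins2 (\<lambda>_. 1) x) = norm x"
proof -
  have "(\<integral>y. cnj 1 * 1 \<partial>\<mu>) = (1::complex)" using P.prob_space by simp
  then show "norm (ins1 (\<lambda>_. 1) x) = norm x" "norm (ins2 (\<lambda>_. 1) x) = norm x"
    by (simp_all add: XX.norm_ip X.norm_ip[of x] ip2_ins1 ip2_ins2 one_L2 scaleC_one P.prob_space)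
qed

text \<open>Formally the operator is \<open>XX.mop F\<close> between \<open>ins1\<close> of 1 and
  the adjoint of \<open>ins2\<close> of 1. This adjoint is not constructed; the slice identity is
  used weakly, inside inner products, and still yields the bound for the graph criterion.\<close>

lemma kop_exists:
  fixes F :: "'x \<times> 'x \<Rightarrow> complex"
  assumes F: "continuous_on UNIV F"
  shows "\<exists>T. bounded_linear T \<and> (\<forall>g\<in>L2 \<mu>. \<forall>a. T (emb g a) = emb (kernel_operator \<mu> F g) a)"
proof -
  obtain B where B: "0 < B" "\<And>z. cmod (F z) \<le> B" using continuous_bounded[OF F compact2] by blast
  note bF = XX.bounded_linear_mop[OF continuous_Linf2[OF F]]
  define S where "S = {(emb g a, emb (kernel_operator \<mu> F g) a) |g a. g \<in> L2 \<mu>}"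
  have fst: "fst ` S = {emb f a |f a. f \<in> L2 \<mu>}" unfolding S_def by force
  note bl = bounded_linear_compose[OF bF bounded_linear_ins1[OF one_L2]]
  have slice: "ip (emb k b) (snd p) = ip2 (ins2 (\<lambda>_. 1) (emb k b)) (XX.mop F (ins1 (\<lambda>_. 1) (fst p)))"
    if "p \<in> span S" and k: "k \<in> L2 \<mu>" for p k b
    using that(1)
  proof (induction rule: span_induct_alt)
    case base
    then show ?case by (simp add: X.ip_zero_right XX.ip_zero_right linear_0[OF bounded_linear.linear[OF bl]])
  next
    case (step r x y)
    from step(1) obtain g a where x: "x = (emb g a, emb (kernel_operator \<mu> F g) a)" and g: "g \<in> L2 \<mu>"
      unfolding S_def by blast
    have "ip (emb k b) (snd x) = ip2 (ins2 (\<lambda>_. 1) (emb k b)) (XX.mop F (ins1 (\<lambda>_. 1) (fst x)))"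
      using ip2_mop_tens[OF F k g Linf_const[of 1], of b a] by (simp add: x ins1_emb ins2_emb g k one_L2)
    with step(2) show ?case
      by (simp add: X.ip_add_right XX.ip_add_right X.ip_scaleR_right XX.ip_scaleR_right
          linear_add[OF bounded_linear.linear[OF bl]] linear_scale[OF bounded_linear.linear[OF bl]])
  qed
  have slice': "ip m (snd p) = ip2 (ins2 (\<lambda>_. 1) m) (XX.mop F (ins1 (\<lambda>_. 1) (fst p)))"
    if "p \<in> span S" for p m
    by (rule X.bounded_linear_eq_on_emb[where S = "\<lambda>m. ip m (snd p)" and
          T = "\<lambda>m. ip2 (ins2 (\<lambda>_. 1) m) (XX.mop F (ins1 (\<lambda>_. 1) (fst p)))", OF X.bounded_linear_ip_left
          bounded_linear_compose[OF XX.bounded_linear_ip_left bounded_linear_ins2[OF one_L2]]])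
      (rule slice[OF that])
  have bd: "norm (snd p) \<le> (8 * B) * norm (fst p)" if p: "p \<in> span S" for p
  proof -
    \<comment> \<open>The identity is tested against \<open>snd p\<close> itself. The 4 of
      \<open>norm_ip_le\<close> and the 2 of \<open>mop_norm\<close> give the 8.\<close>
    have "(norm (snd p))\<^sup>2 \<le> 4 * norm (snd p) * norm (XX.mop F (ins1 (\<lambda>_. 1) (fst p)))"
      using XX.norm_ip_le[of "ins2 (\<lambda>_. 1) (snd p)" "XX.mop F (ins1 (\<lambda>_. 1) (fst p))"]
      by (simp add: slice'[OF p, of "snd p", symmetric] X.norm_ip_self norm_ins_one)
    also have "\<dots> \<le> 4 * norm (snd p) * (2 * B * norm (fst p))"
      using XX.mop_norm(3)[OF continuous_measurable2[OF F] B, of "ins1 (\<lambda>_. 1) (fst p)"]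
      by (intro mult_left_mono) (auto simp: norm_ins_one)
    finally have "norm (snd p) * norm (snd p) \<le> norm (snd p) * (8 * B * norm (fst p))"
      by (simp add: power2_eq_square mult_ac)
    then show ?thesis using B by (cases "snd p = 0") auto
  qed
  have "0 \<le> 8 * B" using B by simp
  from graph_extension[OF X.dense_emb[folded fst] bd this]
  obtain T where "bounded_linear T" "\<And>x y. (x, y) \<in> S \<Longrightarrow> T x = y" by blast
  then show ?thesis unfolding S_def by (intro exI[of _ T]) auto
qed

lemma kop:
  fixes F :: "'x \<times> 'x \<Rightarrow> complex"
  assumes "continuous_on UNIV F"
  shows bounded_linear_kop: "bounded_linear (kop F)"
    and kop_emb: "g \<in> L2 \<mu> \<Longrightarrow> kop F (emb g a) = emb (kernel_operator \<mu> F g) a"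
proof -
  obtain T where T: "bounded_linear T" "\<And>g a. g \<in> L2 \<mu> \<Longrightarrow> T (emb g a) = emb (kernel_operator \<mu> F g) a"
    using kop_exists[OF assms] by blast
  have "kop F = T" using T by (rule X.ampliation_eqI)
  with T show "bounded_linear (kop F)" "g \<in> L2 \<mu> \<Longrightarrow> kop F (emb g a) = emb (kernel_operator \<mu> F g) a"
    by auto
qed

text \<open>The slice formula has to hold for all module vectors, because it is applied to vectors
  \<open>U x\<close>, which need not be elementary tensors.\<close>

lemma ip2_ins2_mop_ins1:
  fixes F :: "'x \<times> 'x \<Rightarrow> complex"
  assumes F: "continuous_on UNIV F" and g: "g \<in> Linf \<mu>"
  shows "ip2 (ins2 (\<lambda>_. 1) m) (XX.mop F (ins1 g n)) = ip m (X.mop g (kop F n))"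
proof -
  have gL: "g \<in> L2 \<mu>" by (rule Linf_L2[OF P.finite_measure_axioms g])
  note bl = bounded_linear_compose[OF XX.bounded_linear_mop[OF continuous_Linf2[OF F]] bounded_linear_ins1[OF gL]]
  note bl' = bounded_linear_compose[OF X.bounded_linear_mop[OF g] bounded_linear_kop[OF F]]
  have *: "ip2 (ins2 (\<lambda>_. 1) (emb k b)) (XX.mop F (ins1 g n)) = ip (emb k b) (X.mop g (kop F n))"
    if k: "k \<in> L2 \<mu>" for k b
    by (rule X.bounded_linear_eq_on_emb[where
          S = "\<lambda>n. ip2 (ins2 (\<lambda>_. 1) (emb k b)) (XX.mop F (ins1 g n))" and
          T = "\<lambda>n. ip (emb k b) (X.mop g (kop F n))", OF
          bounded_linear_compose[OF XX.bounded_linear_ip_right bl]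
          bounded_linear_compose[OF X.bounded_linear_ip_right bl']])
      (simp only: ins1_emb[OF gL] ins2_emb[OF one_L2 k] ip2_mop_tens[OF F k _ g] kop_emb[OF F]
        X.mop_emb[OF g kernel_L2[OF F]])
  show ?thesis
    by (rule X.bounded_linear_eq_on_emb[where
          S = "\<lambda>m. ip2 (ins2 (\<lambda>_. 1) m) (XX.mop F (ins1 g n))" and
          T = "\<lambda>m. ip m (X.mop g (kop F n))", OF
          bounded_linear_compose[OF XX.bounded_linear_ip_left bounded_linear_ins2[OF one_L2]]
          X.bounded_linear_ip_left])
      (rule *)
qed

lemma kop_act:
  fixes F :: "'x \<times> 'x \<Rightarrow> complex"
  assumes F: "continuous_on UNIV F"
  shows "kop F (act x a) = act (kop F x) a"
  by (rule X.bounded_linear_eq_on_emb[OF bounded_linear_compose[OF bounded_linear_kop[OF F]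
        X.bounded_linear_act] bounded_linear_compose[OF X.bounded_linear_act bounded_linear_kop[OF F]]])
    (simp add: F X.act_emb kop_emb kernel_L2)

lemma continuous_adjoint:
  "continuous_on UNIV F \<Longrightarrow> continuous_on UNIV (\<lambda>(x, y). cnj (F (y, x)))"
  using continuous_on_cnj[OF continuous_swap] by (simp add: case_prod_unfold)

lemma ip_kernel:
  fixes F :: "'x \<times> 'x \<Rightarrow> complex"
  assumes F: "continuous_on UNIV F" and k: "k \<in> L2 \<mu>" and h: "h \<in> L2 \<mu>"
  shows "(\<integral>x. cnj (kernel_operator \<mu> (\<lambda>(x, y). cnj (F (y, x))) k x) * h x \<partial>\<mu>) =
    (\<integral>x. cnj (k x) * kernel_operator \<mu> F h x \<partial>\<mu>)"
proof -
  have int: "integrable (\<mu> \<Otimes>\<^sub>M \<mu>) (\<lambda>(x, y). cnj (k x) * (F (x, y) * h y))"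
  proof -
    have "integrable (\<mu> \<Otimes>\<^sub>M \<mu>) (\<lambda>z. cnj (tens k (\<lambda>_. 1) z) * (F z * tens (\<lambda>_. 1) h z))"
      by (intro L2_ip_integrable tens_L2 Linf_mult_L2 continuous_Linf2 F one_L2 k h)
    then show ?thesis by (simp add: case_prod_unfold)
  qed
  have "(\<integral>x. cnj (k x) * kernel_operator \<mu> F h x \<partial>\<mu>) = (\<integral>x. \<integral>y. cnj (k x) * (F (x, y) * h y) \<partial>\<mu> \<partial>\<mu>)"
    by (simp add: kernel_operator_def)
  also have "\<dots> = (\<integral>y. \<integral>x. cnj (k x) * (F (x, y) * h y) \<partial>\<mu> \<partial>\<mu>)"
    by (rule PP.Fubini_integral[OF int, symmetric])
  also have "\<dots> = (\<integral>y. cnj (\<integral>x. cnj (F (x, y)) * k x \<partial>\<mu>) * h y \<partial>\<mu>)"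
  proof (intro Bochner_Integration.integral_cong refl)
    fix y
    have "cnj (\<integral>x. cnj (F (x, y)) * k x \<partial>\<mu>) * h y = (\<integral>x. F (x, y) * cnj (k x) \<partial>\<mu>) * h y"
      by (subst Bochner_Integration.integral_cnj[symmetric]) simp
    also have "\<dots> = (\<integral>x. F (x, y) * cnj (k x) * h y \<partial>\<mu>)" by simp
    also have "\<dots> = (\<integral>x. cnj (k x) * (F (x, y) * h y) \<partial>\<mu>)"
      by (intro Bochner_Integration.integral_cong refl) (simp only: mult_ac)
    finally show "(\<integral>x. cnj (k x) * (F (x, y) * h y) \<partial>\<mu>) = cnj (\<integral>x. cnj (F (x, y)) * k x \<partial>\<mu>) * h y" ..
  qed
  finally show ?thesis by (simp add: kernel_operator_def)
qed

lemma ip_kop: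
  fixes F :: "'x \<times> 'x \<Rightarrow> complex"
  assumes F: "continuous_on UNIV F"
  shows "ip x (kop F y) = ip (kop (\<lambda>(x, y). cnj (F (y, x))) x) y"
proof -
  let ?G = "\<lambda>(x, y). cnj (F (y, x))"
  note G = continuous_adjoint[OF F]
  have *: "ip (emb k b) (kop F y) = ip (kop ?G (emb k b)) y" if k: "k \<in> L2 \<mu>" for k b
    by (rule X.bounded_linear_eq_on_emb[where S = "\<lambda>y. ip (emb k b) (kop F y)" and
          T = "\<lambda>y. ip (kop ?G (emb k b)) y", OF
          bounded_linear_compose[OF X.bounded_linear_ip_right bounded_linear_kop[OF F]]
          X.bounded_linear_ip_right])
      (simp add: kop_emb[OF F] kop_emb[OF G] k X.ip_emb kernel_L2[OF F] kernel_L2[OF G] ip_kernel[OF F k])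
  show ?thesis
    by (rule X.bounded_linear_eq_on_emb[where S = "\<lambda>x. ip x (kop F y)" and
          T = "\<lambda>x. ip (kop ?G x) y", OF X.bounded_linear_ip_left
          bounded_linear_compose[OF X.bounded_linear_ip_left bounded_linear_kop[OF G]]]) (rule *)
qed

lemma cnj_kernel:
  "cnj (kernel_operator \<mu> F g x) = kernel_operator \<mu> (\<lambda>z. cnj (F z)) (\<lambda>y. cnj (g y)) x"
  unfolding kernel_operator_def by (subst Bochner_Integration.integral_cnj[symmetric]) simp

end

text \<open>\<open>unitary_operator\<close> does not mention linearity. It follows from the
  existence of an adjoint, since \<open>ip (S z) x\<close> is linear in \<open>x\<close> over the
  reals and over the algebra.\<close>

lemma (in hilbert_mod) adjointable_linear:
  assumes "\<And>x z. ip z (T x) = ip (S z) x"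
  shows "T (x + y) = T x + T y" "T (r *\<^sub>R x) = r *\<^sub>R T x" "T (act x a) = act (T x) a"
  by (rule eqI_ip, simp add: assms ip_add_right ip_scaleR_right ip_act_right)+

lemma (in hilbert_mod) isometry_bounded_linear:
  assumes adj: "\<And>x z. ip z (T x) = ip (S z) x" and iso: "\<And>x y. ip (T x) (T y) = ip x y"
  shows "bounded_linear T"
  by (rule bounded_linear_intro[where K = 1])
    (simp_all add: adjointable_linear[OF adj] norm_ip[of "T _"] iso flip: norm_ip)

lemma closed_subspace_mem:
  assumes T: "bounded_linear T" and "closure (span A) = UNIV" "subspace C" "closed C"
    and A: "\<And>x. x \<in> A \<Longrightarrow> T x \<in> C"
  shows "T x \<in> C"
proof -
  have "subspace (T -` C)"
    using assms(3) by (rule linear_subspace_vimage[OF bounded_linear.linear[OF T]])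
  then have "span A \<subseteq> T -` C" using A by (intro span_minimal) auto
  moreover have "closed (T -` C)"
    using assms(4) by (intro continuous_closed_vimage) (auto intro: linear_continuous_at T)
  ultimately have "closure (span A) \<subseteq> T -` C" by (rule closure_minimal)
  with assms(2) show ?thesis by auto
qed

text \<open>One leg is approximated at a time: with a continuous first factor inserted, the second
  ranges over the whole module by continuity of \<open>ins1 g\<close>; then the first factor is
  freed through \<open>ins2 h\<close>.\<close>

lemma (in compact_square) dense_continuous_tens:
  "closure (span {emb2 (tens g h) a |g h a. continuous_on UNIV g \<and> continuous_on UNIV h}) = UNIV"
    (is "closure (span ?A) = _")
proof -
  define C where "C = closure (span ?A)"
  have C: "subspace C" "closed C" unfolding C_def by (auto intro: subspace_closure)
  note D = dense_continuous[OF compact P.finite_measure_axioms sets_mu X.L2_module]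
  have cont: "continuous_on UNIV (apply_bcontfun g)" for g :: "'x \<Rightarrow>\<^sub>C complex"
    by (intro continuous_on_apply_bcontfun continuous_on_id)
  have 0: "emb2 (tens g h) a \<in> C" if "continuous_on UNIV g" "continuous_on UNIV h" for g h a
    unfolding C_def by (rule subsetD[OF closure_subset], rule span_base) (use that in blast)
  have 1: "ins1 g x \<in> C" if g: "continuous_on UNIV g" for g x
    by (rule closed_subspace_mem[OF bounded_linear_ins1[OF continuous_L2[OF g]] D C])
      (auto simp: ins1_emb continuous_L2 cont g intro!: 0)
  have 2: "ins2 h x \<in> C" if h: "h \<in> L2 \<mu>" for h x
  proof (rule closed_subspace_mem[OF bounded_linear_ins2[OF h] D C])
    fix x assume "x \<in> {emb (apply_bcontfun g) a |g a. True}"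
    then obtain g a where "x = emb (apply_bcontfun g) a" by blast
    then show "ins2 h x \<in> C" using 1[OF cont] by (simp add: ins1_ins2[symmetric] continuous_L2 cont h)
  qed
  have "emb2 (tens g h) a \<in> C" if "g \<in> L2 \<mu>" "h \<in> L2 \<mu>" for g h a
    using 2[of h "emb g a"] that by (simp add: ins2_emb)
  then show ?thesis
    by (intro closure_span_eq_UNIV_trans[OF dense_tens]) (auto simp: C_def)
qed

section \<open>Actions\<close>

locale compact_action = compact_square \<mu> ip act emb ip2 act2 emb2
  for \<mu> :: "'x::metric_space measure"
    and ip :: "'m::banach \<Rightarrow> 'm \<Rightarrow> 'a::cstar_algebra" and act :: "'m \<Rightarrow> 'a \<Rightarrow> 'm"
    and emb :: "('x \<Rightarrow> complex) \<Rightarrow> 'a \<Rightarrow> 'm"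
    and ip2 :: "'n::banach \<Rightarrow> 'n \<Rightarrow> 'a" and act2 :: "'n \<Rightarrow> 'a \<Rightarrow> 'n"
    and emb2 :: "('x \<times> 'x \<Rightarrow> complex) \<Rightarrow> 'a \<Rightarrow> 'n" +
  fixes tXA :: "('x \<Rightarrow>\<^sub>C complex) \<Rightarrow> 'a \<Rightarrow> 'xa::cstar_algebra"
    and \<beta> :: "('x \<Rightarrow>\<^sub>C complex) \<Rightarrow> 'xa" and U :: "'m \<Rightarrow> 'm"
  assumes tensor: "minimal_tensor tXA"
    and hom: "star_hom \<beta>"
    and dense_action: "closure (span {\<beta> f * tXA 1 a |f a. True}) = UNIV"
    and invariant: "invariant_measure tXA \<beta> \<mu>"
    and unitary: "associated_unitary tXA \<beta> ip emb U"
begin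

section \<open>The unitary \<open>U\<close> and left multiplication by \<beta>(g)\<close>

lemma tXA_mult: "tXA a b * tXA a' b' = tXA (a * a') (b * b')"
  and tXA_star: "star (tXA a b) = tXA (star a) (star b)"
  and tXA_one: "tXA 1 1 = 1"
  and dense_tXA: "closure (span {tXA a b |a b. True}) = UNIV"
  using tensor unfolding minimal_tensor_def by auto

lemma \<beta>_mult: "\<beta> (f * g) = \<beta> f * \<beta> g" and \<beta>_star: "\<beta> (star f) = star (\<beta> f)" and \<beta>_one: "\<beta> 1 = 1"
  using hom unfolding star_hom_def by auto

definition Ui :: "'m \<Rightarrow> 'm" where "Ui = module_adjoint ip U"

lemma ip_U_left: "ip (U x) y = ip x (Ui y)" and U_Ui: "U (Ui x) = x" and Ui_U: "Ui (U x) = x"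
proof -
  have "unitary_operator ip U" using unitary unfolding associated_unitary_def by blast
  then obtain S where S: "\<And>x y. ip (U x) y = ip x (S y)" "\<And>x. U (S x) = x" "\<And>x. S (U x) = x"
    by (rule X.unitary_operatorE) (rule that)
  have "Ui = S" unfolding Ui_def by (rule X.module_adjoint_eqI[OF S(1)])
  with S show "ip (U x) y = ip x (Ui y)" "U (Ui x) = x" "Ui (U x) = x" by auto
qed

lemma ip_U: "ip (U x) (U y) = ip x y"
  by (simp add: ip_U_left Ui_U)

lemma ip_Ui: "ip (Ui x) (Ui y) = ip x y"
  by (simp flip: ip_U_left add: U_Ui)

lemma ip_U_right: "ip z (U x) = ip (Ui z) x"
  using ip_U[of "Ui z" x] by (simp add: U_Ui)

lemma ip_Ui_right: "ip z (Ui x) = ip (U z) x"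
  by (simp add: ip_U_left)

lemma bounded_linear_U: "bounded_linear U"
  using ip_U_right ip_U by (rule X.isometry_bounded_linear)

lemma bounded_linear_Ui: "bounded_linear Ui"
  using ip_Ui_right ip_Ui by (rule X.isometry_bounded_linear)

lemmas U_act = X.adjointable_linear(3)[where T = U and S = Ui, OF ip_U_right]

definition \<kappa> :: "'xa \<Rightarrow> 'm" where
  "\<kappa> = (SOME \<kappa>. bounded_linear \<kappa> \<and> (\<forall>f a. \<kappa> (tXA f a) = emb (apply_bcontfun f) a) \<and>
    (\<forall>f a. U (emb (apply_bcontfun f) a) = \<kappa> (\<beta> f * tXA 1 a)))"

lemma bounded_linear_\<kappa>: "bounded_linear \<kappa>"
  and \<kappa>_tXA: "\<kappa> (tXA f a) = emb (apply_bcontfun f) a"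
  and U_emb: "U (emb (apply_bcontfun f) a) = \<kappa> (\<beta> f * tXA 1 a)"
proof -
  have "\<exists>\<kappa>. bounded_linear \<kappa> \<and> (\<forall>f a. \<kappa> (tXA f a) = emb (apply_bcontfun f) a) \<and>
    (\<forall>f a. U (emb (apply_bcontfun f) a) = \<kappa> (\<beta> f * tXA 1 a))"
    using unitary unfolding associated_unitary_def by blast
  from someI_ex[OF this, folded \<kappa>_def]
  show "bounded_linear \<kappa>" "\<kappa> (tXA f a) = emb (apply_bcontfun f) a"
    "U (emb (apply_bcontfun f) a) = \<kappa> (\<beta> f * tXA 1 a)" by auto
qed

lemma apply_times: "apply_bcontfun (f * g) = (\<lambda>x. apply_bcontfun f x * apply_bcontfun g x)"
  for f g :: "'x \<Rightarrow>\<^sub>C complex"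
  by (rule ext) (simp add: times_bcontfun.rep_eq)

lemma bcontfun_mult_commute: "f * g = g * f"
  for f g :: "'x \<Rightarrow>\<^sub>C complex"
  by (rule bcontfun_eqI) (simp add: times_bcontfun.rep_eq mult.commute)

lemma apply_one: "apply_bcontfun (1 :: 'x \<Rightarrow>\<^sub>C complex) = (\<lambda>_. 1)"
  by (rule ext) (simp add: one_bcontfun.rep_eq)

lemma apply_star: "apply_bcontfun (star f) = (\<lambda>x. cnj (apply_bcontfun f x))"
  for f :: "'x \<Rightarrow>\<^sub>C complex"
  by (rule ext) (simp add: star_bcontfun.rep_eq star_complex_def)

lemma apply_Linf: "apply_bcontfun f \<in> Linf \<mu>"
  by (rule bcontfun_Linf[OF sets_mu])

lemma apply_L2: "apply_bcontfun f \<in> L2 \<mu>"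
  by (rule Linf_L2[OF P.finite_measure_axioms apply_Linf])

text \<open>As \<beta> is unital, constants are invariant vectors; this is what makes pairing with 1
  in one leg compatible with \<open>U\<close>.\<close>

lemma U_one: "U (emb (\<lambda>_. 1) a) = emb (\<lambda>_. 1) a"
  using U_emb[of 1 a] \<kappa>_tXA[of 1 a] by (simp add: apply_one \<beta>_one)

lemma Ui_one: "Ui (emb (\<lambda>_. 1) a) = emb (\<lambda>_. 1) a"
  using Ui_U[of "emb (\<lambda>_. 1) a"] by (simp add: U_one)

lemma mop_\<kappa>: "X.mop (apply_bcontfun f) (\<kappa> z) = \<kappa> (tXA f 1 * z)"
  by (rule bounded_linear_eq_on_dense[OF
        bounded_linear_compose[OF X.bounded_linear_mop[OF apply_Linf] bounded_linear_\<kappa>]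
        bounded_linear_compose[OF bounded_linear_\<kappa> bounded_linear_mult_right] dense_tXA])
    (auto simp: \<kappa>_tXA X.mop_emb apply_Linf apply_L2 tXA_mult apply_times)

text \<open>This is left multiplication by \<beta>(g) on the module, as \<open>B_\<kappa>\<close>
  confirms. Written as a conjugate of \<open>X.mop g\<close> by \<open>U\<close>, it is bounded on
  the whole module at once and cancels against \<open>U\<close> later.\<close>

definition B :: "('x \<Rightarrow> complex) \<Rightarrow> 'm \<Rightarrow> 'm" where
  "B g x = U (X.mop g (Ui x))"

lemma bounded_linear_B: "g \<in> Linf \<mu> \<Longrightarrow> bounded_linear (B g)"
  unfolding B_def
  by (intro bounded_linear_compose[OF bounded_linear_U] bounded_linear_compose[OF X.bounded_linear_mop]
      bounded_linear_Ui)

text \<open>By the density condition of the action, \<open>z\<close> may be taken as \<beta>(f)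
  times \<open>tXA 1 a\<close>; then \<open>\<kappa> z\<close> is \<open>U\<close> of an elementary
  tensor and multiplicativity of \<beta> suffices.\<close>

lemma B_\<kappa>: "B (apply_bcontfun g) (\<kappa> z) = \<kappa> (\<beta> g * z)"
proof (rule bounded_linear_eq_on_dense[OF
        bounded_linear_compose[OF bounded_linear_B[OF apply_Linf] bounded_linear_\<kappa>]
        bounded_linear_compose[OF bounded_linear_\<kappa> bounded_linear_mult_right] dense_action])
  fix z assume "z \<in> {\<beta> f * tXA 1 a |f a. True}"
  then obtain f a where z: "z = \<beta> f * tXA 1 a" by blast
  have "B (apply_bcontfun g) (\<kappa> z) = U (emb (apply_bcontfun (g * f)) a)"
    unfolding z B_def U_emb[symmetric] Ui_U X.mop_emb[OF apply_Linf apply_L2] apply_times ..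
  also have "\<dots> = \<kappa> (\<beta> g * z)" unfolding U_emb \<beta>_mult z mult.assoc ..
  finally show "B (apply_bcontfun g) (\<kappa> z) = \<kappa> (\<beta> g * z)" .
qed

text \<open>This is where the commutativity of \<open>C(X)\<close> enters.\<close>

lemma tXA_central: "tXA f 1 * z = z * tXA f 1"
  by (rule bounded_linear_eq_on_dense[OF bounded_linear_mult_right bounded_linear_mult_left dense_tXA])
    (auto simp: tXA_mult bcontfun_mult_commute[of f])

lemma dense_emb_continuous:
  "closure (span {emb g a |g a. continuous_on UNIV g}) = UNIV"
proof (rule closure_span_eq_UNIV_trans[OF dense_continuous[OF compact P.finite_measure_axioms sets_mu X.L2_module]])
  have "continuous_on UNIV (apply_bcontfun g)" for g :: "'x \<Rightarrow>\<^sub>C complex"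
    by (intro continuous_on_apply_bcontfun continuous_on_id)
  then have "{emb (apply_bcontfun g) a |g a. True} \<subseteq> {emb g a |g a. continuous_on UNIV g}" by blast
  then show "{emb (apply_bcontfun g) a |g a. True} \<subseteq> closure (span {emb g a |g a. continuous_on UNIV g})"
    by (meson closure_subset order_trans span_superset)
qed

text \<open>On the image of \<kappa> the two operators are left multiplications by
  \<open>tXA f' 1\<close> and by \<open>\<beta> g'\<close>, and the former is central.\<close>

lemma mop_B_commute:
  assumes f: "continuous_on UNIV f" and g: "continuous_on UNIV g"
  shows "X.mop f (B g x) = B g (X.mop f x)"
proof -
  obtain f' where f': "apply_bcontfun f' = f" using compact_bcontfun[OF compact f] .
  obtain g' where g': "apply_bcontfun g' = g" using compact_bcontfun[OF compact g] .
  note bl = X.bounded_linear_mop[OF continuous_Linf[OF f]] bounded_linear_B[OF continuous_Linf[OF g]]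
  show ?thesis
  proof (rule bounded_linear_eq_on_dense[OF bounded_linear_compose[OF bl] bounded_linear_compose[OF bl(2,1)]
        dense_emb_continuous])
    fix x assume "x \<in> {emb g a |g a. continuous_on UNIV g}"
    then obtain h a where x: "x = emb h a" "continuous_on UNIV h" by blast
    obtain h' where "apply_bcontfun h' = h" using compact_bcontfun[OF compact x(2)] .
    with x(1) have z: "x = \<kappa> (tXA h' a)" by (simp add: \<kappa>_tXA)
    show "X.mop f (B g x) = B g (X.mop f x)"
      unfolding z f'[symmetric] g'[symmetric] mop_\<kappa> B_\<kappa>
      by (metis mult.assoc tXA_central)
  qed
qed

section \<open>The slice map and complex conjugation\<close>

definition E :: "'xa \<Rightarrow> 'a" where
  "E = (SOME E. bounded_linear E \<and> (\<forall>f a. E (tXA f a) = (\<integral>x. apply_bcontfun f x \<partial>\<mu>) *\<^sub>C a))"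

lemma bounded_linear_E: "bounded_linear E"
  and E_tXA: "E (tXA f a) = (\<integral>x. apply_bcontfun f x \<partial>\<mu>) *\<^sub>C a"
proof -
  have "\<exists>E. bounded_linear E \<and> (\<forall>f a. E (tXA f a) = (\<integral>x. apply_bcontfun f x \<partial>\<mu>) *\<^sub>C a)"
    using invariant unfolding invariant_measure_def by blast
  from someI_ex[OF this, folded E_def]
  show "bounded_linear E" "E (tXA f a) = (\<integral>x. apply_bcontfun f x \<partial>\<mu>) *\<^sub>C a" by auto
qed

lemma E_star: "E (star z) = star (E z)"
  by (rule bounded_linear_eq_on_dense[OF bounded_linear_compose[OF bounded_linear_E bounded_linear_star]
        bounded_linear_compose[OF bounded_linear_star bounded_linear_E] dense_tXA])
    (auto simp: tXA_star E_tXA star_scaleC apply_star)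

text \<open>Matrix coefficients are moved from the module into C(X) \<otimes> C(G), where the
  involution can be applied to them.\<close>

lemma ip_\<kappa>: "ip (emb (apply_bcontfun k) 1) (\<kappa> z) = E (tXA (star k) 1 * z)"
  by (rule bounded_linear_eq_on_dense[OF bounded_linear_compose[OF X.bounded_linear_ip_right bounded_linear_\<kappa>]
        bounded_linear_compose[OF bounded_linear_E bounded_linear_mult_right] dense_tXA])
    (auto simp: tXA_mult E_tXA \<kappa>_tXA X.ip_emb apply_L2 apply_times apply_star star_one)

text \<open>\<beta> preserves the involution, and the factors that \<open>star\<close> reverses
  commute again by \<open>tXA_central\<close>. The algebra entries are 1, since \<open>star\<close>
  would also reverse the order of general entries.\<close>

lemma ip_U_cnj:
  assumes k: "continuous_on UNIV k" and h: "continuous_on UNIV h"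
  shows "ip (emb (\<lambda>x. cnj (k x)) 1) (U (emb (\<lambda>x. cnj (h x)) 1)) = star (ip (emb k 1) (U (emb h 1)))"
proof -
  obtain k' where k': "apply_bcontfun k' = k" using compact_bcontfun[OF compact k] .
  obtain h' where h': "apply_bcontfun h' = h" using compact_bcontfun[OF compact h] .
  have "ip (emb (apply_bcontfun (star k')) 1) (U (emb (apply_bcontfun (star h')) 1)) =
      E (tXA k' 1 * star (\<beta> h'))"
    by (simp add: U_emb ip_\<kappa> star_star tXA_one \<beta>_star)
  also have "\<dots> = E (star (\<beta> h' * tXA (star k') 1))"
    by (simp add: star_mult tXA_star star_star star_one)
  also have "\<dots> = star (ip (emb (apply_bcontfun k') 1) (U (emb (apply_bcontfun h') 1)))"
    unfolding E_star by (simp add: U_emb ip_\<kappa> tXA_one tXA_central)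
  finally show ?thesis by (simp add: apply_star k' h')
qed

section \<open>Adjoints and transposes of intertwining kernels\<close>

definition intertwines :: "('x \<times> 'x \<Rightarrow> complex) \<Rightarrow> bool" where
  "intertwines F \<longleftrightarrow> (\<forall>x. U (kop F x) = kop F (U x))"

lemma intertwines_adjoint:
  assumes F: "continuous_on UNIV F" and "intertwines F"
  shows "intertwines (\<lambda>(x, y). cnj (F (y, x)))"
  unfolding intertwines_def
proof
  let ?G = "\<lambda>(x, y). cnj (F (y, x))"
  have T: "U (kop F x) = kop F (U x)" for x using assms unfolding intertwines_def by blast
  have T': "kop F (Ui x) = Ui (kop F x)" for x by (metis T U_Ui Ui_U)
  have adj: "ip (kop ?G x) y = ip x (kop F y)" for x y by (rule ip_kop[OF F, symmetric])
  fix y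
  show "U (kop ?G y) = kop ?G (U y)"
  proof (rule X.eqI_ip)
    fix x
    have "ip (U (kop ?G y)) x = ip (kop ?G (U y)) x"
      by (simp add: ip_U_left adj T')
    then show "ip x (U (kop ?G y)) = ip x (kop ?G (U y))" by (metis X.star_ip)
  qed
qed

text \<open>Conjugation is carried out on matrix coefficients: \<open>ip_U_cnj\<close> is applied
  once before and once after, and in between \<open>?A\<close> is moved past \<open>U\<close> and
  then, as \<open>F\<close>, to the other side. All functions stay continuous on the way, as
  \<open>ip_U_cnj\<close> demands.\<close>

lemma intertwines_swap:
  assumes F: "continuous_on UNIV F" and int: "intertwines F"
  shows "intertwines (\<lambda>(x, y). F (y, x))"
proof -
  let ?T = "\<lambda>(x, y). F (y, x)" and ?A = "\<lambda>(x, y). cnj (F (y, x))" and ?C = "\<lambda>z. cnj (F z)"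
  note cT = continuous_swap[OF F] and cA = continuous_adjoint[OF F] and cC = continuous_on_cnj[OF F]
  have A: "U (kop ?A x) = kop ?A (U x)" for x
    using intertwines_adjoint[OF F int] unfolding intertwines_def by blast
  have adj: "ip (kop ?A x) y = ip x (kop F y)" for x y by (rule ip_kop[OF F, symmetric])
  have adj': "ip x (kop ?A y) = ip (kop F x) y" for x y by (metis X.star_ip adj)
  have adjT: "ip x (kop ?T y) = ip (kop ?C x) y" for x y
    using ip_kop[OF cT, of x y] by (simp add: case_prod_unfold)
  have main: "ip (emb k 1) (U (kop ?T (emb h 1))) = ip (emb k 1) (kop ?T (U (emb h 1)))"
    if k: "continuous_on UNIV k" and h: "continuous_on UNIV h" for k h
  proof -
    let ?k = "\<lambda>x. cnj (k x)" and ?h = "\<lambda>x. cnj (h x)"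
    note ck = continuous_on_cnj[OF k] and ch = continuous_on_cnj[OF h]
    note L = continuous_L2[OF k] continuous_L2[OF h] continuous_L2[OF ck] continuous_L2[OF ch]
    have "ip (emb k 1) (U (kop ?T (emb h 1))) = ip (emb k 1) (U (emb (kernel_operator \<mu> ?T h) 1))"
      by (simp add: kop_emb[OF cT] L)
    also have "\<dots> = star (ip (emb ?k 1) (U (emb (\<lambda>x. cnj (kernel_operator \<mu> ?T h x)) 1)))"
      using ip_U_cnj[OF ck continuous_on_cnj[OF kernel_continuous[OF cT L(2)]]] by simp
    also have "(\<lambda>x. cnj (kernel_operator \<mu> ?T h x)) = kernel_operator \<mu> ?A ?h"
      by (simp add: cnj_kernel case_prod_unfold)
    also have "emb (kernel_operator \<mu> ?A ?h) 1 = kop ?A (emb ?h 1)" by (simp add: kop_emb[OF cA] L)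
    also have "ip (emb ?k 1) (U (kop ?A (emb ?h 1))) = ip (kop F (emb ?k 1)) (U (emb ?h 1))"
      unfolding A adj' ..
    also have "kop F (emb ?k 1) = emb (kernel_operator \<mu> F ?k) 1" by (simp add: kop_emb[OF F] L)
    also have "star (ip (emb (kernel_operator \<mu> F ?k) 1) (U (emb ?h 1))) =
        ip (emb (\<lambda>x. cnj (kernel_operator \<mu> F ?k x)) 1) (U (emb h 1))"
      using ip_U_cnj[OF kernel_continuous[OF F L(3)] ch] by simp
    also have "(\<lambda>x. cnj (kernel_operator \<mu> F ?k x)) = kernel_operator \<mu> ?C k"
      by (simp add: cnj_kernel)
    also have "emb (kernel_operator \<mu> ?C k) 1 = kop ?C (emb k 1)" by (simp add: kop_emb[OF cC] L)
    finally show ?thesis by (simp add: adjT)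
  qed
  \<comment> \<open>General algebra entries are restored by linearity over the algebra.\<close>
  have act: "emb k b = act (emb k 1) b" if "continuous_on UNIV k" for k b
    using that by (simp add: X.act_emb continuous_L2)
  have main': "ip (emb k b) (U (kop ?T (emb h a))) = ip (emb k b) (kop ?T (U (emb h a)))"
    if k: "continuous_on UNIV k" and h: "continuous_on UNIV h" for k h a b
    unfolding act[OF k, of b] act[OF h, of a] kop_act[OF cT] U_act X.ip_act_right X.ip_act_left main[OF k h] ..
  have eq: "U (kop ?T (emb h a)) = kop ?T (U (emb h a))" if h: "continuous_on UNIV h" for h a
    by (rule X.eqI_ip_dense[OF dense_emb_continuous]) (use main'[OF _ h] in auto)
  show ?thesis
    unfolding intertwines_def
  proof
    fix x
    show "U (kop ?T x) = kop ?T (U x)"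
      by (rule bounded_linear_eq_on_dense[OF bounded_linear_compose[OF bounded_linear_U bounded_linear_kop[OF cT]]
            bounded_linear_compose[OF bounded_linear_kop[OF cT] bounded_linear_U] dense_emb_continuous])
        (use eq in auto)
  qed
qed

end

section \<open>The orbital algebra\<close>

context compact_square
begin

lemma mop_tens_ins1:
  assumes f: "continuous_on UNIV f" and g: "continuous_on UNIV g" and h: "h \<in> L2 \<mu>"
  shows "XX.mop (tens f g) (ins1 h x) = ins1 (\<lambda>x. f x * h x) (X.mop g x)"
proof -
  have fg: "continuous_on UNIV (tens f g)"
    unfolding case_prod_unfold
    by (intro continuous_intros continuous_on_compose2[OF f] continuous_on_compose2[OF g]) auto
  note fL = continuous_Linf[OF f] and gL = continuous_Linf[OF g] and fgL = continuous_Linf2[OF fg]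
  note fh = Linf_mult_L2[OF fL h]
  show ?thesis
  proof (rule X.bounded_linear_eq_on_emb[OF
        bounded_linear_compose[OF XX.bounded_linear_mop[OF fgL] bounded_linear_ins1[OF h]]
        bounded_linear_compose[OF bounded_linear_ins1[OF fh] X.bounded_linear_mop[OF gL]]])
    fix k a assume k: "k \<in> L2 \<mu>"
    have "(\<lambda>z. tens f g z * tens h k z) = tens (\<lambda>x. f x * h x) (\<lambda>y. g y * k y)"
      by (auto simp: fun_eq_iff)
    then show "XX.mop (tens f g) (ins1 h (emb k a)) = ins1 (\<lambda>x. f x * h x) (X.mop g (emb k a))"
      using k by (simp add: ins1_emb h fh XX.mop_emb fgL tens_L2 X.mop_emb gL Linf_mult_L2)
  qed
qed

lemma mop_tens_ins2:
  assumes g: "continuous_on UNIV g" and h: "h \<in> L2 \<mu>"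
  shows "XX.mop (\<lambda>(x, y). g y) (ins2 h x) = ins2 (\<lambda>x. g x * h x) x"
proof -
  have gg: "continuous_on UNIV (\<lambda>(x, y). g y)"
    unfolding case_prod_unfold by (intro continuous_on_compose2[OF g] continuous_intros) auto
  note gL = continuous_Linf[OF g] and ggL = continuous_Linf2[OF gg]
  note gh = Linf_mult_L2[OF gL h]
  show ?thesis
  proof (rule X.bounded_linear_eq_on_emb[OF
        bounded_linear_compose[OF XX.bounded_linear_mop[OF ggL] bounded_linear_ins2[OF h]]
        bounded_linear_ins2[OF gh]])
    fix k a assume k: "k \<in> L2 \<mu>"
    have "(\<lambda>z. (\<lambda>(x, y). g y) z * tens k h z) = tens k (\<lambda>y. g y * h y)"
      by (auto simp: fun_eq_iff)
    then show "XX.mop (\<lambda>(x, y). g y) (ins2 h (emb k a)) = ins2 (\<lambda>x. g x * h x) (emb k a)"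
      using k by (simp add: ins2_emb h gh XX.mop_emb ggL tens_L2)
  qed
qed

end

context compact_action
begin

lemmas bounded_linear_leg2U = bounded_linear_leg2[OF ip_U]
  and bounded_linear_leg2Ui = bounded_linear_leg2[OF ip_Ui]
  and leg2U_Ui = leg2_inverse[OF ip_U ip_Ui U_Ui]
  and leg2Ui_U = leg2_inverse[OF ip_Ui ip_U Ui_U]
  and bounded_linear_leg1U = bounded_linear_leg1[OF ip_U]
  and leg1U_Ui = leg1_inverse[OF ip_U ip_Ui U_Ui]
  and leg1Ui_U = leg1_inverse[OF ip_Ui ip_U Ui_U]

lemma ip2_leg2U_left: "ip2 (leg2 U u) v = ip2 u (leg2 Ui v)"
  using ip2_leg2[OF ip_U, of u "leg2 Ui v"] by (simp add: leg2U_Ui)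

lemma ip2_leg2U_right: "ip2 u (leg2 U v) = ip2 (leg2 Ui u) v"
  using ip2_leg2[OF ip_U, of "leg2 Ui u" v] by (simp add: leg2U_Ui)

lemma ip2_leg2Ui_right: "ip2 u (leg2 Ui v) = ip2 (leg2 U u) v"
  by (simp add: ip2_leg2U_left)

lemmas leg2U_act = XX.adjointable_linear(3)[where T = "leg2 U" and S = "leg2 Ui", OF ip2_leg2U_right]
  and leg2Ui_act = XX.adjointable_linear(3)[where T = "leg2 Ui" and S = "leg2 U", OF ip2_leg2Ui_right]

text \<open>The operator \<open>\<beta>(p)\<^sub>2\<^sub>3\<close>, encoded on the square like
  \<open>B\<close> on the single module.\<close>

definition B2 :: "('x \<Rightarrow> complex) \<Rightarrow> 'n \<Rightarrow> 'n" where
  "B2 p u = leg2 U (XX.mop (\<lambda>(x, y). p y) (leg2 Ui u))"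

lemma continuous_snd_tens: "continuous_on UNIV p \<Longrightarrow> continuous_on UNIV (\<lambda>(x, y). p y)"
  for p :: "'x \<Rightarrow> complex"
  unfolding case_prod_unfold by (rule continuous_on_compose2[of UNIV p]) (auto intro!: continuous_intros)

lemma bounded_linear_B2: "continuous_on UNIV p \<Longrightarrow> bounded_linear (B2 p)"
  unfolding B2_def
  by (intro bounded_linear_compose[OF bounded_linear_leg2U] bounded_linear_leg2Ui
      bounded_linear_compose[OF XX.bounded_linear_mop] continuous_Linf2 continuous_snd_tens)

lemma B2_scC:
  assumes "continuous_on UNIV p"
  shows "B2 p (XX.scC c u) = XX.scC c (B2 p u)"
  unfolding B2_def XX.scC_def leg2Ui_act XX.mop_act[OF continuous_Linf2[OF continuous_snd_tens[OF assms]]]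
    leg2U_act ..

lemma B2_ins1:
  assumes p: "continuous_on UNIV p" and h: "h \<in> L2 \<mu>"
  shows "B2 p (ins1 h x) = ins1 h (B p x)"
  using mop_tens_ins1[OF continuous_on_const[of _ 1] p h, of "Ui x"]
  by (simp add: B2_def B_def leg2_ins1[OF ip_U] leg2_ins1[OF ip_Ui] h)

lemma B2_mult:
  assumes p: "continuous_on UNIV p" and q: "continuous_on UNIV q"
  shows "B2 p (B2 q u) = B2 (\<lambda>x. p x * q x) u"
proof -
  have "(\<lambda>z. (\<lambda>(x :: 'x, y). p y) z * (\<lambda>(x, y). q y) z) = (\<lambda>(x, y). p y * q y)" by auto
  then show ?thesis
    using XX.mop_mult[OF continuous_Linf2[OF continuous_snd_tens[OF p]]
        continuous_Linf2[OF continuous_snd_tens[OF q]], of "leg2 Ui u"]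
    by (simp add: B2_def leg2Ui_U)
qed

lemma ip2_B2:
  assumes p: "continuous_on UNIV p"
  shows "ip2 (B2 p u) v = ip2 u (B2 (\<lambda>x. cnj (p x)) v)"
proof -
  have "(\<lambda>z. cnj ((\<lambda>(x :: 'x, y). p y) z)) = (\<lambda>(x, y). cnj (p y))" by auto
  then show ?thesis
    using XX.ip_mop[OF continuous_Linf2[OF continuous_snd_tens[OF p]], of "leg2 Ui u" "leg2 Ui v"]
    by (simp add: B2_def ip2_leg2U_left ip2_leg2U_right)
qed

text \<open>For functions of one variable this reduces to \<open>mop_B_commute\<close> in the second
  leg, since the first is untouched by \<open>B2\<close>. The passage to uniform limits uses only
  that multiplication by a function of size at most \<open>e\<close> has norm at most
  \<open>2 * e\<close>.\<close>

lemma mop_B2_commute_real: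
  fixes F :: "'x \<times> 'x \<Rightarrow> real"
  assumes p: "continuous_on UNIV p" and F: "continuous_on UNIV F"
  shows "\<forall>u. XX.mop (\<lambda>z. of_real (F z)) (B2 p u) = B2 p (XX.mop (\<lambda>z. of_real (F z)) u)"
    (is "?P F")
  using compact _ _ _ _ _ F
proof (rule product_Stone_Weierstrass[where P = ?P])
  have cont: "continuous_on UNIV (\<lambda>z. complex_of_real (f z))" if "continuous_on UNIV f"
    for f :: "'b::topological_space \<Rightarrow> real"
    using that by (intro continuous_intros)
  note L2 = continuous_Linf2[OF cont]
  note blB = bounded_linear_B2[OF p]
  have tens_case: "XX.mop (tens f g) (B2 p u) = B2 p (XX.mop (tens f g) u)"
    if f: "continuous_on UNIV f" and g: "continuous_on UNIV g" for f g u
  proof -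
    have "continuous_on UNIV (tens f g)"
      unfolding case_prod_unfold
      by (intro continuous_intros continuous_on_compose2[OF f] continuous_on_compose2[OF g]) auto
    note bl = XX.bounded_linear_mop[OF continuous_Linf2[OF this]]
    show ?thesis
      by (rule bounded_linear_eq_on_ins1[OF bounded_linear_compose[OF bl blB] bounded_linear_compose[OF blB bl]])
        (simp add: B2_ins1 p mop_tens_ins1 f g Linf_mult_L2 continuous_Linf mop_B_commute)
  qed
  show "?P (\<lambda>(x, y). g x)" if "continuous_on UNIV g" for g
    using tens_case[OF cont[OF that] continuous_on_const[of _ 1]] by (simp add: case_prod_unfold)
  show "?P (\<lambda>(x, y). g y)" if "continuous_on UNIV g" for g
    using tens_case[OF continuous_on_const[of _ 1] cont[OF that]] by (simp add: case_prod_unfold)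
  show "?P (\<lambda>z. f z + g z)" if "continuous_on UNIV f" "continuous_on UNIV g" "?P f" "?P g" for f g
    using that by (simp add: XX.mop_add L2 linear_add[OF bounded_linear.linear[OF blB]])
  show "?P (\<lambda>z. f z * g z)" if "continuous_on UNIV f" "continuous_on UNIV g" "?P f" "?P g" for f g
    using that by (simp add: XX.mop_mult[symmetric] L2)
  show "?P f" if f: "continuous_on UNIV f"
    and lim: "\<And>e. 0 < e \<Longrightarrow> \<exists>g. continuous_on UNIV g \<and> ?P g \<and> (\<forall>z. \<bar>f z - g z\<bar> < e)" for f
  proof
    fix u
    define D where "D = norm (XX.mop (\<lambda>z. of_real (f z)) (B2 p u) - B2 p (XX.mop (\<lambda>z. of_real (f z)) u))"
    obtain K where K: "0 < K" "\<And>x. norm (B2 p x) \<le> norm x * K"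
      using bounded_linear.pos_bounded[OF blB] by blast
    \<comment> \<open>The first two terms bound the two halves of the commutator with the error
      \<open>d\<close>, up to the factor \<open>e\<close>; the 1 keeps \<open>C\<close> positive, so
      that \<open>e / C\<close> makes sense.\<close>
    define C where "C = 2 * norm (B2 p u) + 2 * K * norm u + 1"
    have C: "0 < C" using K by (auto simp: C_def intro!: add_nonneg_pos)
    have le: "D \<le> e * C" if "0 < e" for e
    proof -
      from lim[OF that] obtain g where g: "continuous_on UNIV g" "?P g" "\<And>z. \<bar>f z - g z\<bar> < e" by blast
      define d where "d z = complex_of_real (f z - g z)" for z
      have d: "continuous_on UNIV d" "\<And>z. cmod (d z) \<le> e"
        unfolding d_def using f g(1) less_imp_le[OF g(3)] by (auto intro!: continuous_intros simp flip: of_real_diff)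
      have split: "XX.mop (\<lambda>z. of_real (f z)) v = XX.mop (\<lambda>z. of_real (g z)) v + XX.mop d v" for v
        using XX.mop_add[OF L2[OF g(1)] continuous_Linf2[OF d(1)], of v] by (simp add: d_def)
      have n: "norm (XX.mop d v) \<le> 2 * e * norm v" for v
        by (rule XX.mop_norm(3)[OF continuous_measurable2[OF d(1)] that d(2)])
      have "D = norm (XX.mop d (B2 p u) - B2 p (XX.mop d u))"
        unfolding D_def split using g(2) by (simp add: linear_add[OF bounded_linear.linear[OF blB]])
      also have "\<dots> \<le> norm (XX.mop d (B2 p u)) + norm (B2 p (XX.mop d u))" by (rule norm_triangle_ineq4)
      also have "\<dots> \<le> 2 * e * norm (B2 p u) + 2 * e * norm u * K"
        using n[of "B2 p u"] K(2)[of "XX.mop d u"] mult_right_mono[OF n[of u] less_imp_le[OF K(1)]]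
        by linarith
      also have "\<dots> \<le> e * C" using that by (simp add: C_def algebra_simps)
      finally show ?thesis .
    qed
    have "D \<le> 0"
    proof (rule field_le_epsilon)
      fix e :: real assume "0 < e"
      then show "D \<le> 0 + e" using le[of "e / C"] C by simp
    qed
    then show "XX.mop (\<lambda>z. of_real (f z)) (B2 p u) = B2 p (XX.mop (\<lambda>z. of_real (f z)) u)"
      by (simp add: D_def)
  qed
qed

lemma mop_B2_commute:
  assumes p: "continuous_on UNIV p" and F: "continuous_on UNIV F"
  shows "XX.mop F (B2 p u) = B2 p (XX.mop F u)"
proof -
  have re: "continuous_on UNIV (\<lambda>z. Re (F z))" and im: "continuous_on UNIV (\<lambda>z. Im (F z))"
    by (intro continuous_intros F)+
  have L: "(\<lambda>z. complex_of_real (Re (F z))) \<in> Linf (\<mu> \<Otimes>\<^sub>M \<mu>)" "(\<lambda>z. complex_of_real (Im (F z))) \<in> Linf (\<mu> \<Otimes>\<^sub>M \<mu>)"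
    by (intro continuous_Linf2 continuous_intros F)+
  have split: "XX.mop F v = XX.mop (\<lambda>z. of_real (Re (F z))) v + XX.scC \<i> (XX.mop (\<lambda>z. of_real (Im (F z))) v)" for v
    using XX.mop_add[OF L(1) Linf_mult[OF Linf_const[of \<i>] L(2)], of v] XX.mop_mult[OF Linf_const[of \<i>] L(2), of v]
    by (simp add: XX.mop_const flip: complex_eq)
  show ?thesis
    unfolding split using mop_B2_commute_real[OF p re] mop_B2_commute_real[OF p im]
    by (simp add: linear_add[OF bounded_linear.linear[OF bounded_linear_B2[OF p]]] B2_scC[OF p])
qed

lemma leg2_ins2_one: "leg2 U (ins2 (\<lambda>_. 1) x) = ins2 (\<lambda>_. 1) x"
  by (rule X.bounded_linear_eq_on_emb[OF
        bounded_linear_compose[OF bounded_linear_leg2U bounded_linear_ins2[OF one_L2]]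
        bounded_linear_ins2[OF one_L2]])
    (simp add: ins1_ins2[OF _ one_L2, symmetric] leg2_ins1[OF ip_U] U_one)

section \<open>The operator \<open>Z\<close> and its commutation with multiplication by
  \<open>F\<close>\<close>

abbreviation "Z \<equiv> Z_op \<mu> emb emb2 U"

lemma Z_bij: "Z (leg1 Ui (leg2 Ui u)) = u" "leg1 Ui (leg2 Ui (Z u)) = u"
  by (simp_all add: Z_op_def leg1U_Ui leg1Ui_U leg2U_Ui leg2Ui_U)

lemma ip2_Z: "ip2 (Z u) (Z v) = ip2 u v"
  by (simp add: Z_op_def ip2_leg2[OF ip_U] ip2_leg1[OF ip_U])

lemma bounded_linear_Z: "bounded_linear Z"
  unfolding Z_op_def o_def by (rule bounded_linear_compose[OF bounded_linear_leg2U bounded_linear_leg1U])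

lemma Z_adjoint: "module_adjoint ip2 Z = (\<lambda>u. leg1 Ui (leg2 Ui u))"
proof (rule XX.module_adjoint_eqI)
  show "ip2 (Z u) v = ip2 u (leg1 Ui (leg2 Ui v))" for u v
    using ip2_Z[of u "leg1 Ui (leg2 Ui v)"] by (simp add: Z_bij)
qed

text \<open>The first leg acts first and leaves \<open>l\<close> alone. Afterwards \<open>l\<close>
  is split off as a multiplication operator, and the rest has the constant 1 in the second leg and
  is fixed by \<open>leg2 U\<close>; so \<open>leg2 Ui\<close> may be inserted, which completes
  \<open>B2 l\<close>.\<close>

lemma Z_ins2:
  assumes l: "continuous_on UNIV l"
  shows "Z (ins2 l x) = B2 l (ins2 (\<lambda>_. 1) (U x))"
proof -
  have "Z (ins2 l x) = leg2 U (ins2 l (U x))"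
    by (simp add: Z_op_def leg1_ins2[OF ip_U] continuous_L2 l)
  also have "ins2 l (U x) = XX.mop (\<lambda>(x, y). l y) (ins2 (\<lambda>_. 1) (U x))"
    by (simp add: mop_tens_ins2 l one_L2)
  also have "ins2 (\<lambda>_. 1) (U x) = leg2 Ui (ins2 (\<lambda>_. 1) (U x))"
    by (metis leg2Ui_U leg2_ins2_one)
  finally show ?thesis by (simp only: B2_def)
qed

text \<open>Fubini's theorem inside the module: integrating \<open>F (x, y) \<beta>(p)(y)\<close> over \<open>y\<close> gives
  \<open>\<beta>(\<rho>(F) p)(x)\<close> when \<open>\<rho>(F)\<close> intertwines \<open>U\<close>.\<close>

lemma ip2_ins2_mop_B2:
  assumes F: "continuous_on UNIV F" and int: "intertwines F" and p: "continuous_on UNIV p"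
  shows "ip2 (ins2 (\<lambda>_. 1) m) (XX.mop F (B2 p (ins2 (\<lambda>_. 1) n))) = ip m (B (kernel_operator \<mu> F p) n)"
proof -
  let ?q = "kernel_operator \<mu> F p"
  have q: "continuous_on UNIV ?q" by (rule kernel_continuous[OF F continuous_L2[OF p]])
  have T: "kop F (U x) = U (kop F x)" for x using int unfolding intertwines_def by simp
  note bl = bounded_linear_compose[OF bounded_linear_compose[OF
        XX.bounded_linear_mop[OF continuous_Linf2[OF F]] bounded_linear_B2[OF p]] bounded_linear_ins2[OF one_L2]]
  show ?thesis
  proof (rule bounded_linear_eq_on_dense[where
        S = "\<lambda>n. ip2 (ins2 (\<lambda>_. 1) m) (XX.mop F (B2 p (ins2 (\<lambda>_. 1) n)))" and
        T = "\<lambda>n. ip m (B ?q n)", OF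
        bounded_linear_compose[OF XX.bounded_linear_ip_right bl]
        bounded_linear_compose[OF X.bounded_linear_ip_right bounded_linear_B[OF continuous_Linf[OF q]]]
        dense_emb_continuous])
    fix n assume "n \<in> {emb g a |g a. continuous_on UNIV g}"
    then obtain g a where n: "n = emb g a" and g: "continuous_on UNIV g" by blast
    have B_one: "B r (emb (\<lambda>_. 1) a) = U (emb r a)" if "continuous_on UNIV r" for r
      using that by (simp add: B_def Ui_one X.mop_emb continuous_Linf one_L2)
    \<comment> \<open>\<open>B2 p\<close> does not touch \<open>g\<close> in the first leg, and in
      the second it acts on the constant 1.\<close>
    have "B2 p (ins2 (\<lambda>_. 1) n) = ins1 g (U (emb p a))"
      unfolding n ins1_ins2[OF continuous_L2[OF g] one_L2, symmetric] B2_ins1[OF p continuous_L2[OF g]]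
        B_one[OF p] ..
    then have "ip2 (ins2 (\<lambda>_. 1) m) (XX.mop F (B2 p (ins2 (\<lambda>_. 1) n))) = ip m (X.mop g (U (emb ?q a)))"
      by (simp add: ip2_ins2_mop_ins1[OF F continuous_Linf[OF g]] T kop_emb[OF F] continuous_L2[OF p])
    \<comment> \<open>Once \<open>kop F\<close> has passed \<open>U\<close>, commutativity brings
      \<open>g\<close> back under \<open>B ?q\<close>.\<close>
    also have "X.mop g (U (emb ?q a)) = B ?q (X.mop g (emb (\<lambda>_. 1) a))"
      by (simp only: B_one[OF q, symmetric] mop_B_commute[OF g q])
    also have "X.mop g (emb (\<lambda>_. 1) a) = n"
      by (simp add: n X.mop_emb continuous_Linf g one_L2)
    finally show "ip2 (ins2 (\<lambda>_. 1) m) (XX.mop F (B2 p (ins2 (\<lambda>_. 1) n))) = ip m (B ?q n)" .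
  qed
qed

lemma ip2_Z_mop_Z:
  assumes F: "continuous_on UNIV F" and int: "intertwines F"
  shows "ip2 (Z u) (XX.mop F (Z v)) = ip2 u (XX.mop F v)"
proof -
  have tens: "ip2 (Z (emb2 (tens k l) b)) (XX.mop F (Z (emb2 (tens g h) a))) =
      ip2 (emb2 (tens k l) b) (XX.mop F (emb2 (tens g h) a))"
    if k: "continuous_on UNIV k" and l: "continuous_on UNIV l"
      and g: "continuous_on UNIV g" and h: "continuous_on UNIV h" for k l g h a b
  proof -
    define p where "p = (\<lambda>x. cnj (l x) * h x)"
    have p: "continuous_on UNIV p" unfolding p_def by (intro continuous_intros l h)
    let ?q = "kernel_operator \<mu> F p"
    have q: "continuous_on UNIV ?q" by (rule kernel_continuous[OF F continuous_L2[OF p]])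
    have cl: "continuous_on UNIV (\<lambda>x. cnj (l x))" by (intro continuous_intros l)
    note L = continuous_L2[OF k] continuous_L2[OF l] continuous_L2[OF g] continuous_L2[OF h]
    have "ip2 (Z (emb2 (tens k l) b)) (XX.mop F (Z (emb2 (tens g h) a))) =
        ip2 (B2 l (ins2 (\<lambda>_. 1) (U (emb k b)))) (XX.mop F (B2 h (ins2 (\<lambda>_. 1) (U (emb g a)))))"
      by (simp only: ins2_emb[OF L(2,1), symmetric] ins2_emb[OF L(4,3), symmetric] Z_ins2[OF l] Z_ins2[OF h])
    \<comment> \<open>\<open>B2 l\<close> moves to the other side with conjugated function, passes
      \<open>F\<close> and merges with \<open>B2 h\<close> into \<open>B2 p\<close>.\<close>
    also have "\<dots> = ip2 (ins2 (\<lambda>_. 1) (U (emb k b))) (XX.mop F (B2 p (ins2 (\<lambda>_. 1) (U (emb g a)))))"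
      by (simp add: ip2_B2[OF l] mop_B2_commute[OF cl F, symmetric] B2_mult[OF cl h] p_def)
    \<comment> \<open>After the integration, \<open>B ?q\<close> is a conjugate by \<open>U\<close>,
      so every \<open>U\<close> cancels.\<close>
    also have "\<dots> = ip (emb k b) (emb (\<lambda>x. g x * ?q x) a)"
      by (simp add: ip2_ins2_mop_B2[OF F int p] B_def Ui_U ip_U X.mop_emb continuous_Linf q L mult.commute)
    also have "\<dots> = ip2 (emb2 (tens k (\<lambda>_. 1)) b) (XX.mop F (emb2 (tens g p) a))"
      by (rule ip2_mop_tens[OF F L(1) continuous_L2[OF p] continuous_Linf[OF g], symmetric])
    \<comment> \<open>The same transfer of \<open>l\<close> in reverse, now with plain
      multiplication operators.\<close>
    also have "\<dots> = ip2 (emb2 (tens k l) b) (XX.mop F (emb2 (tens g h) a))"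
    proof -
      let ?l = "\<lambda>(x :: 'x, y). l y"
      note lL = continuous_Linf2[OF continuous_snd_tens[OF l]]
      note FL = continuous_Linf2[OF F]
      have k1: "tens k (\<lambda>_. 1) \<in> L2 (\<mu> \<Otimes>\<^sub>M \<mu>)" and gh: "tens g h \<in> L2 (\<mu> \<Otimes>\<^sub>M \<mu>)"
        using tens_L2[OF L(1) one_L2] tens_L2[OF L(3,4)] .
      have kl: "tens k l = (\<lambda>z. ?l z * tens k (\<lambda>_. 1) z)"
        by (auto simp: fun_eq_iff)
      have gp: "tens g p = (\<lambda>z. cnj (?l z) * tens g h z)"
        by (auto simp: fun_eq_iff p_def)
      have "ip2 (emb2 (tens k l) b) (XX.mop F (emb2 (tens g h) a))
          = ip2 (emb2 (tens k (\<lambda>_. 1)) b) (XX.mop (\<lambda>z. cnj (?l z)) (XX.mop F (emb2 (tens g h) a)))"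
        unfolding kl XX.mop_emb[OF lL k1, symmetric] XX.ip_mop[OF lL] ..
      also have "XX.mop (\<lambda>z. cnj (?l z)) (XX.mop F (emb2 (tens g h) a)) = XX.mop F (emb2 (tens g p) a)"
        unfolding XX.mop_mult[OF Linf_cnj[OF lL] FL] gp XX.mop_emb[OF Linf_cnj[OF lL] gh, symmetric]
          XX.mop_mult[OF FL Linf_cnj[OF lL]] by (simp only: mult.commute)
      finally show ?thesis ..
    qed
    finally show ?thesis .
  qed
  note bF = XX.bounded_linear_mop[OF continuous_Linf2[OF F]]
  have 1: "ip2 (Z (emb2 (tens k l) b)) (XX.mop F (Z v)) = ip2 (emb2 (tens k l) b) (XX.mop F v)"
    if "continuous_on UNIV k" "continuous_on UNIV l" for k l b
    by (rule bounded_linear_eq_on_dense[where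
          S = "\<lambda>v. ip2 (Z (emb2 (tens k l) b)) (XX.mop F (Z v))" and
          T = "\<lambda>v. ip2 (emb2 (tens k l) b) (XX.mop F v)", OF
          bounded_linear_compose[OF XX.bounded_linear_ip_right bounded_linear_compose[OF bF bounded_linear_Z]]
          bounded_linear_compose[OF XX.bounded_linear_ip_right bF] dense_continuous_tens])
      (use tens[OF that] in blast)
  show ?thesis
    by (rule bounded_linear_eq_on_dense[where
          S = "\<lambda>u. ip2 (Z u) (XX.mop F (Z v))" and T = "\<lambda>u. ip2 u (XX.mop F v)", OF
          bounded_linear_compose[OF XX.bounded_linear_ip_left bounded_linear_Z]
          XX.bounded_linear_ip_left dense_continuous_tens])
      (use 1 in blast)
qed

section \<open>From \<open>Z\<close> to \<open>W\<close> by exchange of coordinates\<close>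

lemma action_swap:
  "compact_action \<mu> ip act emb ip2 act2 (\<lambda>f. emb2 (\<lambda>(x, y). f (y, x))) tXA \<beta> U"
  by (intro compact_action.intro compact_square.intro compact_square_axioms.intro compact_action_axioms.intro
      square_swap compact sets_mu tensor hom dense_action invariant unitary)

lemma insert2_swap: "insert2 \<mu> emb (\<lambda>f. emb2 (\<lambda>(x, y). f (y, x))) = insert1 \<mu> emb emb2"
  unfolding insert1_def insert2_def by (simp add: mult.commute)

lemma leg1_ins1_one: "leg1 U (ins1 (\<lambda>_. 1) x) = ins1 (\<lambda>_. 1) x"
  using compact_action.leg2_ins2_one[OF action_swap, unfolded leg23_swap insert2_swap] .

lemma Z_mop_iff_intertwines:
  assumes F: "continuous_on UNIV F"
  shows "Z \<circ> XX.mop F \<circ> module_adjoint ip2 Z = XX.mop F \<longleftrightarrow> intertwines F"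
proof
  assume "Z \<circ> XX.mop F \<circ> module_adjoint ip2 Z = XX.mop F"
  then have "XX.mop F (Z u) = Z (XX.mop F u)" for u
    unfolding Z_adjoint by (metis Z_bij(2) comp_apply)
  then have Z: "ip2 (Z u) (XX.mop F (Z v)) = ip2 u (XX.mop F v)" for u v by (simp add: ip2_Z)
  have one: "(\<lambda>_. 1) \<in> Linf \<mu>" by (rule Linf_const)
  have id: "X.mop (\<lambda>_. 1) x = x" for x
    unfolding X.mop_const X.scC_def scaleC_one by (rule X.act_one)
  \<comment> \<open>The vectors have the constant 1 in the second and in the first leg respectively.
    On them \<open>Z\<close> acts as \<open>U\<close> in the other leg, and the slice formula turns
    \<open>XX.mop F\<close> into \<open>kop F\<close> on both sides of the identity for
    \<open>Z\<close>. As \<open>U\<close> is onto, testing against \<open>U x\<close> is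
    enough.\<close>
  have "ip (U x) (kop F (U y)) = ip (U x) (U (kop F y))" for x y
  proof -
    have "Z (ins2 (\<lambda>_. 1) x) = ins2 (\<lambda>_. 1) (U x)"
      by (simp add: Z_op_def leg1_ins2[OF ip_U] one_L2 leg2_ins2_one)
    moreover have "Z (ins1 (\<lambda>_. 1) y) = ins1 (\<lambda>_. 1) (U y)"
      by (simp add: Z_op_def leg1_ins1_one leg2_ins1[OF ip_U] one_L2)
    ultimately have "ip (U x) (kop F (U y)) = ip2 (Z (ins2 (\<lambda>_. 1) x)) (XX.mop F (Z (ins1 (\<lambda>_. 1) y)))"
      by (simp add: ip2_ins2_mop_ins1[OF F one] id)
    also have "\<dots> = ip (U x) (U (kop F y))"
      by (simp add: Z ip2_ins2_mop_ins1[OF F one] id ip_U)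
    finally show ?thesis .
  qed
  then show "intertwines F"
    unfolding intertwines_def by (intro allI X.eqI_ip) (metis U_Ui)
next
  assume int: "intertwines F"
  have "Z (XX.mop F v) = XX.mop F (Z v)" for v
  proof (rule XX.eqI_ip)
    fix w
    have "ip2 (Z u) (Z (XX.mop F v)) = ip2 (Z u) (XX.mop F (Z v))" for u
      by (simp add: ip2_Z ip2_Z_mop_Z[OF F int])
    from this[of "leg1 Ui (leg2 Ui w)"] show "ip2 w (Z (XX.mop F v)) = ip2 w (XX.mop F (Z v))"
      by (simp add: Z_bij)
  qed
  then show "Z \<circ> XX.mop F \<circ> module_adjoint ip2 Z = XX.mop F"
    by (simp add: fun_eq_iff Z_adjoint Z_bij)
qed

text \<open>The flipped embedding reads its argument with exchanged coordinates, so transposing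
  \<open>F\<close> as well leaves the operator unchanged.\<close>

lemma mop_swap:
  assumes F: "continuous_on UNIV F"
  shows "ampliation (\<mu> \<Otimes>\<^sub>M \<mu>) (\<lambda>f. emb2 (\<lambda>(x, y). f (y, x))) (multiplication_operator (\<lambda>(x, y). F (y, x))) = XX.mop F"
proof (rule l2_module.ampliation_eqI[OF l2_module.intro[OF L2_module_swap]])
  show "bounded_linear (XX.mop F)" by (rule XX.bounded_linear_mop[OF continuous_Linf2[OF F]])
  fix g a assume g: "g \<in> L2 (\<mu> \<Otimes>\<^sub>M \<mu>)"
  have "(\<lambda>z. F z * (\<lambda>(x, y). g (y, x)) z) =
      (\<lambda>(x, y). multiplication_operator (\<lambda>(x, y). F (y, x)) g (y, x))"
    by (auto simp: multiplication_operator_def)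
  then show "XX.mop F (emb2 (\<lambda>(x, y). g (y, x)) a) =
      emb2 (\<lambda>(x, y). multiplication_operator (\<lambda>(x, y). F (y, x)) g (y, x)) a"
    by (simp only: XX.mop_emb[OF continuous_Linf2[OF F] swap_L2[OF g]])
qed

text \<open>\<open>W\<close> is the \<open>Z\<close> of the flipped realization, which gives the
  criterion for the transposed kernel; \<open>intertwines_swap\<close>, used in both directions,
  removes the transposition.\<close>

lemma W_mop_iff_intertwines:
  assumes F: "continuous_on UNIV F"
  shows "W_op \<mu> emb emb2 U \<circ> XX.mop F \<circ> module_adjoint ip2 (W_op \<mu> emb emb2 U) = XX.mop F \<longleftrightarrow> intertwines F"
proof -
  have W: "Z_op \<mu> emb (\<lambda>f. emb2 (\<lambda>(x, y). f (y, x))) U = W_op \<mu> emb emb2 U"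
    unfolding Z_op_def W_op_def leg23_swap leg13_swap ..
  have "W_op \<mu> emb emb2 U \<circ> XX.mop F \<circ> module_adjoint ip2 (W_op \<mu> emb emb2 U) = XX.mop F \<longleftrightarrow>
      intertwines (\<lambda>(x, y). F (y, x))"
    using compact_action.Z_mop_iff_intertwines[OF action_swap continuous_swap[OF F]]
    unfolding W mop_swap[OF F] .
  also have "\<dots> \<longleftrightarrow> intertwines F"
    using intertwines_swap[OF F] intertwines_swap[OF continuous_swap[OF F]] by auto
  finally show ?thesis .
qed

end

theorem theorem2p1:
  fixes tAA :: "'a::cstar_algebra \<Rightarrow> 'a \<Rightarrow> 'aa::cstar_algebra"
    and tAA_A :: "'aa \<Rightarrow> 'a \<Rightarrow> 'aaa::cstar_algebra"
    and tA_AA :: "'a \<Rightarrow> 'aa \<Rightarrow> 'aaa"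
    and \<Delta> :: "'a \<Rightarrow> 'aa"
    and tXA :: "('x::metric_space \<Rightarrow>\<^sub>C complex) \<Rightarrow> 'a \<Rightarrow> 'xa::cstar_algebra"
    and tXA_A :: "'xa \<Rightarrow> 'a \<Rightarrow> 'xaa::cstar_algebra"
    and tX_AA :: "('x \<Rightarrow>\<^sub>C complex) \<Rightarrow> 'aa \<Rightarrow> 'xaa"
    and \<beta> :: "('x \<Rightarrow>\<^sub>C complex) \<Rightarrow> 'xa"
    and \<mu> :: "'x measure"
    and ip :: "'m::banach \<Rightarrow> 'm \<Rightarrow> 'a"
    and act :: "'m \<Rightarrow> 'a \<Rightarrow> 'm"
    and emb :: "('x \<Rightarrow> complex) \<Rightarrow> 'a \<Rightarrow> 'm"
    and ip2 :: "'n::banach \<Rightarrow> 'n \<Rightarrow> 'a"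
    and act2 :: "'n \<Rightarrow> 'a \<Rightarrow> 'n"
    and emb2 :: "('x \<times> 'x \<Rightarrow> complex) \<Rightarrow> 'a \<Rightarrow> 'n"
    and U :: "'m \<Rightarrow> 'm"
    and f :: "('x \<times> 'x) \<Rightarrow>\<^sub>C complex"
  assumes "compact (UNIV :: 'x set)"
    and "compact_quantum_group tAA tAA_A tA_AA \<Delta>"
    and "quantum_action tAA \<Delta> tXA tXA_A tX_AA \<beta>"
    and "faithful_prob_measure \<mu>"
    and "invariant_measure tXA \<beta> \<mu>"
    and "L2_module \<mu> ip act emb"
    and "L2_module (\<mu> \<Otimes>\<^sub>M \<mu>) ip2 act2 emb2"
    and "associated_unitary tXA \<beta> ip emb U"
    and "isometric_action \<mu> emb emb2 U"
  shows "intertwiner \<mu> emb U (kernel_operator \<mu> (apply_bcontfun f)) \<longleftrightarrow>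
           f \<in> orbital_algebra \<mu> emb ip2 emb2 U"
proof -
  have "prob_space \<mu>" "sets \<mu> = sets borel"
    using assms(4) unfolding faithful_prob_measure_def by blast+
  moreover have "minimal_tensor tXA" "star_hom \<beta>" "closure (span {\<beta> f * tXA 1 a |f a. True}) = UNIV"
    using assms(3) unfolding quantum_action_def minimal_tensor3_def by blast+
  ultimately interpret compact_action \<mu> ip act emb ip2 act2 emb2 tXA \<beta> U
    by (intro compact_action.intro compact_square.intro l2_module_square.intro l2_module.intro
        l2_module_square_axioms.intro compact_square_axioms.intro compact_action_axioms.intro assms)
  have f: "continuous_on UNIV (apply_bcontfun f)"
    by (intro continuous_on_apply_bcontfun continuous_on_id)
  \<comment> \<open>The boundedness that \<open>intertwiner\<close> includes holds for every
    continuous kernel, so only the commutation with \<open>U\<close> is left.\<close>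
  have "intertwiner \<mu> emb U (kernel_operator \<mu> (apply_bcontfun f)) \<longleftrightarrow> intertwines (apply_bcontfun f)"
    using kernel_bounded_L2_operator[OF f] by (simp add: intertwiner_def intertwines_def fun_eq_iff)
  also have "\<dots> \<longleftrightarrow> f \<in> orbital_algebra \<mu> emb ip2 emb2 U"
    using Z_mop_iff_intertwines[OF f] W_mop_iff_intertwines[OF f]
    by (simp add: orbital_algebra_def Let_def)
  finally show ?thesis .
qed

end
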